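(* Let $V_1,V_2,V_3$ be three independent holomorphic vector fields on a three-dimensional complex manifold $\mathcal W$ such that $$L_{0'}=V_1-\tilde\lambda V_2+f_{0'}\partial_{\tilde\lambda},\qquad L_{1'}=V_2-\tilde\lambda V_3+f_{1'}\partial_{\tilde\lambda}$$ span an integrable distribution on $\mathcal W\times\mathbb{CP}^1$ for some functions $f_{0'},f_{1'}$ which are third-order polynomials in the affine coordinate $\tilde\lambda\in\mathbb{CP}^1$ (with coefficients functions on $\mathcal W$). Then there exists a one-form $\nu$ such that the contravariant metric $$V_2\otimes V_2-\tfrac12\big(V_1\otimes V_3+V_3\otimes V_1\big)$$ and $\nu$ give an Einstein--Weyl structure on $\mathcal W$. Each Einstein--Weyl structure arises (locally) in this way.
   Context: "Third-order polynomial" means polynomial of degree at most three. Integrable means $[L_{0'},L_{1'}]$ is a linear combination of $L_{0'}$ and $L_{1'}$. A (holomorphic) 3-dimensional Weyl structure is represented by a pair $(h,\nu)$ of a metric and a one-form, with torsion-free connection $D$ determined by $D_ih_{jk}=\nu_ih_{jk}$; pairs related by $h\to\phi^2h$, $\nu\to\nu+2\,\mathrm{d}\ln\phi$ represent the same structure. It is Einstein--Weyl if the symmetrised Ricci tensor of $D$ is proportional to $h$, i.e. $R_{ij}+\tfrac12\nabla_{(i}\nu_{j)}+\tfrac14\nu_i\nu_j-\tfrac13(R+\tfrac12\nabla^k\nu_k+\tfrac14\nu^k\nu_k)h_{ij}=0$ with $\nabla$, $R_{ij}$, $R$ those of $h$. The contravariant metric displayed in the claim is the inverse of the metric $h$ (up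 to conformal scale). *)

theory Defs
  imports "HOL-Analysis.Analysis" "HOL-Computational_Algebra.Polynomial"
begin

section \<open>Holomorphic functions of several complex variables\<close>

text \<open>
  Complex Frechet differentiability on an open set: the real Frechet derivative exists at every
  point and is complex linear.
\<close>

definition holo_on :: "(complex^3 \<Rightarrow> complex) \<Rightarrow> (complex^3) set \<Rightarrow> bool" where
  "holo_on F S \<longleftrightarrow>
     (\<forall>x\<in>S. \<exists>F'. (F has_derivative F') (at x) \<and> (\<forall>c v. F' (c *s v) = c * F' v))"

text \<open>
  For functions that are complex differentiable at \<open>x\<close> this is the partial derivative of \<open>F\<close>
  with respect to the \<open>i\<close>-th complex coordinate.
\<close>

definition pd :: "3 \<Rightarrow> (complex^3 \<Rightarrow> complex) \<Rightarrow> complex^3 \<Rightarrow> complex" where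
  "pd i F x = frechet_derivative F (at x) (axis i 1)"


section \<open>Three-dimensional complex manifolds\<close>

text \<open>
  A chart is a pair of its domain and its coordinate map; the values of the coordinate map
  outside the domain are irrelevant.
\<close>

type_synonym 'a chart = "'a set \<times> ('a \<Rightarrow> complex^3)"

definition chart_inv :: "'a chart \<Rightarrow> complex^3 \<Rightarrow> 'a" where
  "chart_inv c = inv_into (fst c) (snd c)"

definition transition :: "'a chart \<Rightarrow> 'a chart \<Rightarrow> complex^3 \<Rightarrow> complex^3" where
  "transition c c' x = snd c' (chart_inv c x)"

definition complex_manifold3 :: "'a topology \<Rightarrow> 'a chart set \<Rightarrow> bool" where
  "complex_manifold3 W A \<longleftrightarrow>
     Hausdorff_space W \<and> second_countable W \<and>
     (\<forall>c\<in>A. openin W (fst c) \<and> open (snd c ` fst c) \<and>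
        homeomorphic_map (subtopology W (fst c)) (top_of_set (snd c ` fst c)) (snd c)) \<and>
     (\<Union>c\<in>A. fst c) = topspace W \<and>
     (\<forall>c\<in>A. \<forall>c'\<in>A. \<forall>i. holo_on (\<lambda>x. transition c c' x $ i) (snd c ` (fst c \<inter> fst c')))"

text \<open>
  Tensor fields on an open subset \<open>N\<close> of a manifold with atlas \<open>A\<close> are given by their components
  in every chart of \<open>A\<close>, as functions of the coordinates ranging over \<open>chart_image c N\<close>, subject to
  the usual transformation laws on overlaps.
\<close>

definition chart_image :: "'a chart \<Rightarrow> 'a set \<Rightarrow> (complex^3) set" where
  "chart_image c N = snd c ` (fst c \<inter> N)"

type_synonym 'a vecfield = "'a chart \<Rightarrow> complex^3 \<Rightarrow> complex^3"
type_synonym 'a oneform = "'a chart \<Rightarrow> complex^3 \<Rightarrow> complex^3"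
type_synonym 'a tensor2 = "'a chart \<Rightarrow> complex^3 \<Rightarrow> complex^3^3"

definition holo_fun :: "'a chart set \<Rightarrow> 'a set \<Rightarrow> ('a \<Rightarrow> complex) \<Rightarrow> bool" where
  "holo_fun A N g \<longleftrightarrow> (\<forall>c\<in>A. holo_on (\<lambda>x. g (chart_inv c x)) (chart_image c N))"

definition holo_vecfield :: "'a chart set \<Rightarrow> 'a set \<Rightarrow> 'a vecfield \<Rightarrow> bool" where
  "holo_vecfield A N V \<longleftrightarrow>
     (\<forall>c\<in>A. \<forall>i. holo_on (\<lambda>x. V c x $ i) (chart_image c N)) \<and>
     (\<forall>c\<in>A. \<forall>c'\<in>A. \<forall>x\<in>chart_image c (fst c' \<inter> N).
        V c' (transition c c' x) = jacobian (transition c c') (at x) *v V c x)"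

definition holo_oneform :: "'a chart set \<Rightarrow> 'a set \<Rightarrow> 'a oneform \<Rightarrow> bool" where
  "holo_oneform A N \<nu> \<longleftrightarrow>
     (\<forall>c\<in>A. \<forall>i. holo_on (\<lambda>x. \<nu> c x $ i) (chart_image c N)) \<and>
     (\<forall>c\<in>A. \<forall>c'\<in>A. \<forall>x\<in>chart_image c (fst c' \<inter> N).
        \<nu> c x = transpose (jacobian (transition c c') (at x)) *v \<nu> c' (transition c c' x))"

text \<open>Covariant holomorphic metrics: symmetric and nondegenerate, complex bilinear.\<close>

definition holo_metric :: "'a chart set \<Rightarrow> 'a set \<Rightarrow> 'a tensor2 \<Rightarrow> bool" where
  "holo_metric A N h \<longleftrightarrow>
     (\<forall>c\<in>A. \<forall>i j. holo_on (\<lambda>x. h c x $ i $ j) (chart_image c N)) \<and>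
     (\<forall>c\<in>A. \<forall>x\<in>chart_image c N. transpose (h c x) = h c x \<and> invertible (h c x)) \<and>
     (\<forall>c\<in>A. \<forall>c'\<in>A. \<forall>x\<in>chart_image c (fst c' \<inter> N).
        h c x = transpose (jacobian (transition c c') (at x)) ** h c' (transition c c' x)
                  ** jacobian (transition c c') (at x))"


section \<open>Einstein--Weyl structures\<close>

text \<open>\<open>\<Gamma> i j k\<close> stands for the connection coefficient $\Gamma^i_{jk}$ in a coordinate system.\<close>

type_synonym conn = "3 \<Rightarrow> 3 \<Rightarrow> 3 \<Rightarrow> complex^3 \<Rightarrow> complex"

text \<open>
  \<open>\<Gamma>\<close> is torsion-free and $D_i h_{jk} = \nu_i h_{jk}$ on \<open>S\<close>. For nondegenerate \<open>h\<close> this determines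
  \<open>\<Gamma>\<close> on \<open>S\<close>.
\<close>

definition weyl_connection_on ::
  "(complex^3) set \<Rightarrow> (complex^3 \<Rightarrow> complex^3^3) \<Rightarrow> (complex^3 \<Rightarrow> complex^3) \<Rightarrow> conn \<Rightarrow> bool" where
  "weyl_connection_on S h \<nu> \<Gamma> \<longleftrightarrow>
     (\<forall>x\<in>S. \<forall>i j k. \<Gamma> i j k x = \<Gamma> i k j x) \<and>
     (\<forall>x\<in>S. \<forall>i j k.
        pd i (\<lambda>y. h y $ j $ k) x - (\<Sum>l\<in>UNIV. \<Gamma> l i j x * h x $ l $ k)
          - (\<Sum>l\<in>UNIV. \<Gamma> l i k x * h x $ j $ l) = \<nu> x $ i * h x $ j $ k)"

definition ricci :: "conn \<Rightarrow> complex^3 \<Rightarrow> 3 \<Rightarrow> 3 \<Rightarrow> complex" where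
  "ricci \<Gamma> x j k =
     (\<Sum>i\<in>UNIV. pd i (\<Gamma> i j k) x - pd j (\<Gamma> i i k) x
        + (\<Sum>l\<in>UNIV. \<Gamma> i i l x * \<Gamma> l j k x - \<Gamma> i j l x * \<Gamma> l i k x))"

definition einstein_weyl :: "'a chart set \<Rightarrow> 'a set \<Rightarrow> 'a tensor2 \<Rightarrow> 'a oneform \<Rightarrow> bool" where
  "einstein_weyl A N h \<nu> \<longleftrightarrow>
     holo_metric A N h \<and> holo_oneform A N \<nu> \<and>
     (\<forall>c\<in>A. \<exists>\<Gamma>. weyl_connection_on (chart_image c N) (h c) (\<nu> c) \<Gamma> \<and>
        (\<forall>x\<in>chart_image c N. \<exists>\<Lambda>. \<forall>i j.
           (ricci \<Gamma> x i j + ricci \<Gamma> x j i) / 2 = \<Lambda> * h c x $ i $ j))"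

text \<open>
  The pairs \<open>(h, \<nu>)\<close> and \<open>(h', \<nu>')\<close> represent the same Weyl structure:
  $h' = \phi^2 h$ and $\nu' = \nu + 2\,\mathrm{d}\ln\phi$.
\<close>

definition same_weyl ::
  "'a chart set \<Rightarrow> 'a set \<Rightarrow> 'a tensor2 \<Rightarrow> 'a oneform \<Rightarrow> 'a tensor2 \<Rightarrow> 'a oneform \<Rightarrow> bool" where
  "same_weyl A N h \<nu> h' \<nu>' \<longleftrightarrow>
     (\<exists>\<phi>. holo_fun A N \<phi> \<and> (\<forall>p\<in>N. \<phi> p \<noteq> 0) \<and>
        (\<forall>c\<in>A. \<forall>x\<in>chart_image c N. \<forall>i j.
           h' c x $ i $ j = (\<phi> (chart_inv c x))\<^sup>2 * h c x $ i $ j \<and>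
           \<nu>' c x $ i = \<nu> c x $ i
              + 2 * (pd i (\<lambda>y. \<phi> (chart_inv c y)) x / \<phi> (chart_inv c x))))"


section \<open>The Lax distribution\<close>

text \<open>
  The inverse of the contravariant metric
  $V_2 \otimes V_2 - \frac12 (V_1 \otimes V_3 + V_3 \otimes V_1)$.
\<close>

definition frame_metric :: "'a vecfield \<Rightarrow> 'a vecfield \<Rightarrow> 'a vecfield \<Rightarrow> 'a tensor2" where
  "frame_metric V1 V2 V3 c x =
     matrix_inv (\<chi> i j. V2 c x $ i * V2 c x $ j
       - (V1 c x $ i * V3 c x $ j + V3 c x $ i * V1 c x $ j) / 2)"

definition independent_on ::
  "'a chart set \<Rightarrow> 'a set \<Rightarrow> 'a vecfield \<Rightarrow> 'a vecfield \<Rightarrow> 'a vecfield \<Rightarrow> bool" where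
  "independent_on A N V1 V2 V3 \<longleftrightarrow>
     (\<forall>c\<in>A. \<forall>x\<in>chart_image c N. \<forall>\<alpha> \<beta> \<gamma>.
        \<alpha> *s V1 c x + \<beta> *s V2 c x + \<gamma> *s V3 c x = 0 \<longrightarrow> \<alpha> = 0 \<and> \<beta> = 0 \<and> \<gamma> = 0)"

definition cubic_on :: "'a chart set \<Rightarrow> 'a set \<Rightarrow> ('a \<Rightarrow> complex poly) \<Rightarrow> bool" where
  "cubic_on A N f \<longleftrightarrow>
     (\<forall>p\<in>N. degree (f p) \<le> 3) \<and> (\<forall>k. holo_fun A N (\<lambda>p. poly.coeff (f p) k))"

text \<open>
  Vector fields on the product of a coordinate domain with an affine patch of the projective line
  are maps into \<open>complex^3 \<times> complex\<close>, the last entry being the coefficient of the derivation along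
  the affine coordinate. The field $X - \lambda Y + f \partial_\lambda$ is \<open>lax X Y f\<close>. In the
  patch around $\lambda = \infty$, with coordinate $\mu = 1/\lambda$, the distribution is spanned
  by the multiples $\mu (X - \lambda Y + f \partial_\lambda)
  = \mu X - Y - \mu^3 f(1/\mu) \partial_\mu$, which extend to $\mu = 0$ as \<open>f\<close> has degree at
  most three; these are \<open>lax_inf X Y f\<close>.
\<close>

definition lax :: "'a vecfield \<Rightarrow> 'a vecfield \<Rightarrow> ('a \<Rightarrow> complex poly) \<Rightarrow>
    'a chart \<Rightarrow> (complex^3) \<times> complex \<Rightarrow> (complex^3) \<times> complex" where
  "lax X Y f c = (\<lambda>(x, l). (X c x - l *s Y c x, poly (f (chart_inv c x)) l))"

definition lax_inf :: "'a vecfield \<Rightarrow> 'a vecfield \<Rightarrow> ('a \<Rightarrow> complex poly) \<Rightarrow>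
    'a chart \<Rightarrow> (complex^3) \<times> complex \<Rightarrow> (complex^3) \<times> complex" where
  "lax_inf X Y f c = (\<lambda>(x, m). (m *s X c x - Y c x,
     - (\<Sum>k\<le>3. poly.coeff (f (chart_inv c x)) k * m ^ (3 - k))))"

definition lie_bracket :: "('v::real_normed_vector \<Rightarrow> 'v) \<Rightarrow> ('v \<Rightarrow> 'v) \<Rightarrow> 'v \<Rightarrow> 'v" where
  "lie_bracket X Y z = frechet_derivative Y (at z) (X z) - frechet_derivative X (at z) (Y z)"

definition bracket_in_span ::
  "((complex^3) \<times> complex \<Rightarrow> (complex^3) \<times> complex) \<Rightarrow>
   ((complex^3) \<times> complex \<Rightarrow> (complex^3) \<times> complex) \<Rightarrow> (complex^3) \<times> complex \<Rightarrow> bool" where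
  "bracket_in_span X Y z \<longleftrightarrow>
     (\<exists>\<alpha> \<beta>. lie_bracket X Y z =
        (\<alpha> *s fst (X z) + \<beta> *s fst (Y z), \<alpha> * snd (X z) + \<beta> * snd (Y z)))"

definition lax_integrable :: "'a chart set \<Rightarrow> 'a set \<Rightarrow> 'a vecfield \<Rightarrow> 'a vecfield \<Rightarrow> 'a vecfield \<Rightarrow>
    ('a \<Rightarrow> complex poly) \<Rightarrow> ('a \<Rightarrow> complex poly) \<Rightarrow> bool" where
  "lax_integrable A N V1 V2 V3 f0 f1 \<longleftrightarrow>
     (\<forall>c\<in>A. \<forall>x\<in>chart_image c N. \<forall>s.
        bracket_in_span (lax V1 V2 f0 c) (lax V2 V3 f1 c) (x, s) \<and>
        bracket_in_span (lax_inf V1 V2 f0 c) (lax_inf V2 V3 f1 c) (x, s))"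

definition lax_data :: "'a chart set \<Rightarrow> 'a set \<Rightarrow> 'a vecfield \<Rightarrow> 'a vecfield \<Rightarrow> 'a vecfield \<Rightarrow>
    ('a \<Rightarrow> complex poly) \<Rightarrow> ('a \<Rightarrow> complex poly) \<Rightarrow> bool" where
  "lax_data A N V1 V2 V3 f0 f1 \<longleftrightarrow>
     holo_vecfield A N V1 \<and> holo_vecfield A N V2 \<and> holo_vecfield A N V3 \<and>
     independent_on A N V1 V2 V3 \<and> cubic_on A N f0 \<and> cubic_on A N f1 \<and>
     lax_integrable A N V1 V2 V3 f0 f1"

end

theory Submission
  imports Defs "HOL-Complex_Analysis.Cauchy_Integral_Formula"
begin

text \<open>
  Fix a frame \<open>V 1, V 2, V 3\<close> with dual coframe $\theta^1, \theta^2, \theta^3$. A value $s$ of the spectral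
  parameter singles out the plane spanned by $l_0 = V_1 - s V_2$ and $l_1 = V_2 - s V_3$, which is null for the
  metric of the theorem: its conormal is $s^2 \theta^1 + s \theta^2 + \theta^3$ and its null normal is
  $n_s = V_1 - 2 s V_2 + s^2 V_3$. A Weyl connection transports null planes to null planes, so it lifts
  vector fields to the bundle of null planes, that is, to the product with the projective line. The vertical
  component of the lift is a 1-form $\sigma_s$ that is quadratic in $s$, because the rotations act on the
  conic of null planes through quadratic vector fields. The lifts of $l_0$ and $l_1$ therefore have
  the form of a Lax pair with cubic polynomials $f_0 = \sigma_s(l_0)$ and $f_1 = \sigma_s(l_1)$.

  Consider the bracket of these two lifts. Its horizontal part lies in the null plane since the connection
  is torsion-free. Once the lift of that horizontal part is subtracted, the value on $(l_0, l_1)$ of the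
  curvature of $\sigma_s$ remains, and a trace computation
  (\<open>ricci_null_eq_defect\<close>) identifies it with $-\frac12 \mathrm{Ric}(n_s, n_s)$. Hence the lifts span
  an integrable distribution iff the Ricci form vanishes on the null cone
  (\<open>bracket_in_span_lift_iff\<close>), and a quadratic form that vanishes on the null cone is a multiple of
  the metric (\<open>einstein_iff_ricci_null\<close>). This is the Einstein--Weyl equation.

  For the first half of the theorem it remains to see that every integrable cubic Lax pair is
  the lift of a Weyl connection. The horizontal condition expresses $f_0$ and the top coefficient of $f_1$
  through the other coefficients of $f_1$ and the structure coefficients of the frame; the three
  remaining coefficients of $f_1$ correspond linearly to the three components of $\nu$
  (\<open>lax_nu\<close>, \<open>lax_imp_lift\<close>). For the second half, an adapted null frame exists locally by a Gram--Schmidt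
  process with holomorphic square roots (\<open>local_null_frame\<close>), and the Lax pair is read off from the
  connection; no differential equation has to be solved. Near $s = \infty$ the same results apply to the
  reversed frame \<open>V 3, V 2, V 1\<close> (\<open>einstein_imp_lax_inf\<close>).

  Two facts of general nature enter. Curvature involves second derivatives of holomorphic functions,
  which exist and commute by Cauchy's formula (\<open>has_partials_pd\<close>, \<open>pd_commute\<close>). And the
  polynomials and the 1-form are expressed through structure coefficients of the frame, which do not
  depend on the chart because the Lie bracket is natural (\<open>lie3_natural\<close>).
\<close>

section \<open>Calculus of holomorphic functions of three variables\<close>

definition has_partials :: "(complex^3 \<Rightarrow> complex) \<Rightarrow> (3 \<Rightarrow> complex) \<Rightarrow> complex^3 \<Rightarrow> bool" where
  "has_partials F D x \<longleftrightarrow> (F has_derivative (\<lambda>v. \<Sum>j\<in>UNIV. D j * v $ j)) (at x)"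

lemma pd_eqI: "has_partials F D x \<Longrightarrow> pd i F x = D i"
proof -
  assume "has_partials F D x"
  then have "frechet_derivative F (at x) = (\<lambda>v. \<Sum>j\<in>UNIV. D j * v $ j)"
    unfolding has_partials_def by (metis frechet_derivative_at)
  then show ?thesis
    by (simp add: pd_def axis_def if_distrib if_distribR sum.delta cong: if_cong)
qed

lemma holo_on_has_partials:
  assumes "holo_on F S" "x \<in> S"
  shows "has_partials F (\<lambda>j. pd j F x) x"
proof -
  obtain F' where F': "(F has_derivative F') (at x)" and lin: "\<And>c v. F' (c *s v) = c * F' v"
    using assms unfolding holo_on_def by blast
  have eq: "frechet_derivative F (at x) = F'"
    using F' by (metis frechet_derivative_at)
  interpret bounded_linear F' using F' by (rule has_derivative_bounded_linear)
  have "F' v = (\<Sum>j\<in>UNIV. pd j F x * v $ j)" for v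
  proof -
    have "F' v = F' (\<Sum>j\<in>UNIV. v $ j *s axis j 1)" by (simp add: basis_expansion)
    also have "\<dots> = (\<Sum>j\<in>UNIV. v $ j * F' (axis j 1))" by (simp add: sum lin)
    finally show ?thesis by (simp add: pd_def eq mult.commute)
  qed
  then have "F' = (\<lambda>v. \<Sum>j\<in>UNIV. pd j F x * v $ j)" by blast
  then show ?thesis using F' unfolding has_partials_def by simp
qed

lemma holo_onI:
  assumes "\<And>x. x \<in> S \<Longrightarrow> \<exists>D. has_partials F D x"
  shows "holo_on F S"
  unfolding holo_on_def
proof
  fix x assume "x \<in> S"
  then obtain D where "has_partials F D x" using assms by blast
  then show "\<exists>F'. (F has_derivative F') (at x) \<and> (\<forall>c v. F' (c *s v) = c * F' v)"
    unfolding has_partials_def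
    by (intro exI conjI) (auto simp: sum_distrib_left ac_simps)
qed

lemma has_partials_const: "has_partials (\<lambda>_. c) (\<lambda>_. 0) x"
  by (simp add: has_partials_def)

lemma has_partials_proj: "has_partials (\<lambda>y. y $ k) (\<lambda>j. if j = k then 1 else 0) x"
  using bounded_linear_imp_has_derivative[OF bounded_linear_vec_nth, of k "at x"]
  unfolding has_partials_def by (simp add: if_distrib if_distribR sum.delta cong: if_cong)

lemma has_partials_add:
  assumes "has_partials F D x" "has_partials G E x"
  shows "has_partials (\<lambda>y. F y + G y) (\<lambda>j. D j + E j) x"
  using assms unfolding has_partials_def
  by (auto intro!: derivative_eq_intros simp: sum.distrib algebra_simps)

lemma has_partials_mult:
  assumes "has_partials F D x" "has_partials G E x"
  shows "has_partials (\<lambda>y. F y * G y) (\<lambda>j. D j * G x + F x * E j) x"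
  using assms unfolding has_partials_def
  by (auto intro!: derivative_eq_intros simp: sum.distrib algebra_simps sum_distrib_left)

lemma has_partials_comp_field:
  assumes "has_partials F D x" "(g has_field_derivative g') (at (F x))"
  shows "has_partials (\<lambda>y. g (F y)) (\<lambda>j. g' * D j) x"
proof -
  have "((\<lambda>y. g (F y)) has_derivative (\<lambda>v. g' * (\<Sum>j\<in>UNIV. D j * v $ j))) (at x)"
    using has_derivative_compose[OF assms(1)[unfolded has_partials_def]
        assms(2)[unfolded has_field_derivative_def]] by simp
  then show ?thesis unfolding has_partials_def
    by (simp add: sum_distrib_left mult.assoc)
qed

lemma has_derivative_componentwise_vec:
  fixes T :: "'a::real_normed_vector \<Rightarrow> 'b::euclidean_space^'n"
  assumes "\<And>i. ((\<lambda>y. T y $ i) has_derivative (\<lambda>v. T' v $ i)) (at x)"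
  shows "(T has_derivative T') (at x)"
  unfolding has_derivative_componentwise_within[of T]
proof
  fix b :: "'b^'n" assume "b \<in> Basis"
  then obtain i u where b: "b = axis i u" "u \<in> Basis" by (auto simp: Basis_vec_def)
  show "((\<lambda>y. T y \<bullet> b) has_derivative (\<lambda>v. T' v \<bullet> b)) (at x)"
    unfolding b inner_axis
    by (rule has_derivative_inner_left) (rule assms)
qed

lemma has_partials_compose:
  assumes "has_partials F D (T x)" "\<And>i. has_partials (\<lambda>y. T y $ i) (\<lambda>j. J i j) x"
  shows "has_partials (\<lambda>y. F (T y)) (\<lambda>j. \<Sum>i\<in>UNIV. D i * J i j) x"
proof -
  have "(T has_derivative (\<lambda>v. \<chi> i. \<Sum>j\<in>UNIV. J i j * v $ j)) (at x)"
    by (rule has_derivative_componentwise_vec) (use assms(2) in \<open>simp add: has_partials_def\<close>)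
  from has_derivative_compose[OF this assms(1)[unfolded has_partials_def]]
  show ?thesis unfolding has_partials_def
    by (auto elim!: has_derivative_eq_rhs
        simp: fun_eq_iff sum_distrib_left sum_distrib_right mult.assoc intro: sum.swap)
qed

lemma has_partials_cong:
  assumes "has_partials F D x" "open S" "x \<in> S" "\<And>y. y \<in> S \<Longrightarrow> F y = G y"
  shows "has_partials G D x"
  using has_derivative_transform_within_open[OF assms(1)[unfolded has_partials_def] assms(2-4)]
  unfolding has_partials_def .

lemma holo_on_const [intro]: "holo_on (\<lambda>_. c) S"
  by (rule holo_onI) (blast intro: has_partials_const)

lemma holo_on_proj: "holo_on (\<lambda>y. y $ k) S"
  by (rule holo_onI) (blast intro: has_partials_proj)

lemma holo_on_add: "holo_on F S \<Longrightarrow> holo_on G S \<Longrightarrow> holo_on (\<lambda>y. F y + G y) S"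
  by (rule holo_onI) (blast intro: has_partials_add holo_on_has_partials)

lemma holo_on_mult: "holo_on F S \<Longrightarrow> holo_on G S \<Longrightarrow> holo_on (\<lambda>y. F y * G y) S"
  by (rule holo_onI) (blast intro: has_partials_mult holo_on_has_partials)

lemma holo_on_uminus: "holo_on F S \<Longrightarrow> holo_on (\<lambda>y. - F y) S"
  using holo_on_mult[OF holo_on_const[of "-1"], of F S] by simp

lemma holo_on_diff: "holo_on F S \<Longrightarrow> holo_on G S \<Longrightarrow> holo_on (\<lambda>y. F y - G y) S"
  using holo_on_add[OF _ holo_on_uminus, of F S G] by simp

lemma holo_on_sum: "(\<And>i. i \<in> I \<Longrightarrow> holo_on (F i) S) \<Longrightarrow> holo_on (\<lambda>y. \<Sum>i\<in>I. F i y) S"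
  by (induction I rule: infinite_finite_induct) (auto intro: holo_on_add)

lemma holo_on_comp_field:
  assumes "holo_on F S" "\<And>x. x \<in> S \<Longrightarrow> g field_differentiable at (F x)"
  shows "holo_on (\<lambda>y. g (F y)) S"
  using assms unfolding field_differentiable_def
  by (intro holo_onI) (blast intro: has_partials_comp_field holo_on_has_partials)

lemma holo_on_inverse:
  assumes "holo_on F S" "\<And>x. x \<in> S \<Longrightarrow> F x \<noteq> 0"
  shows "holo_on (\<lambda>y. inverse (F y)) S"
proof (rule holo_on_comp_field[OF assms(1)])
  fix x assume "x \<in> S"
  then show "inverse field_differentiable at (F x)"
    using DERIV_inverse[OF assms(2)] field_differentiable_def by blast
qed

lemma holo_on_divide:
  assumes "holo_on F S" "holo_on G S" "\<And>x. x \<in> S \<Longrightarrow> G x \<noteq> 0"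
  shows "holo_on (\<lambda>y. F y / G y) S"
  unfolding divide_inverse by (intro holo_on_mult holo_on_inverse assms)

lemma holo_on_compose:
  assumes "holo_on F R" "\<And>i. holo_on (\<lambda>y. T y $ i) S" "\<And>x. x \<in> S \<Longrightarrow> T x \<in> R"
  shows "holo_on (\<lambda>y. F (T y)) S"
proof (rule holo_onI)
  fix x assume x: "x \<in> S"
  show "\<exists>D. has_partials (\<lambda>y. F (T y)) D x"
    by (rule exI, rule has_partials_compose[OF holo_on_has_partials[OF assms(1) assms(3)[OF x]]
          holo_on_has_partials[OF assms(2) x]])
qed

lemma holo_on_cong:
  assumes "holo_on F S" "open S" "\<And>y. y \<in> S \<Longrightarrow> F y = G y"
  shows "holo_on G S"
proof (rule holo_onI)
  fix x assume x: "x \<in> S"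
  show "\<exists>D. has_partials G D x"
    using has_partials_cong[OF holo_on_has_partials[OF assms(1) x] assms(2) x] assms(3) by blast
qed

lemma holo_on_subset: "holo_on F S \<Longrightarrow> R \<subseteq> S \<Longrightarrow> holo_on F R"
  unfolding holo_on_def by blast

lemmas holo_intros = holo_on_const holo_on_proj holo_on_add holo_on_mult holo_on_uminus
  holo_on_diff holo_on_sum holo_on_divide

lemma pd_cong:
  assumes "holo_on F S" "open S" "x \<in> S" "\<And>y. y \<in> S \<Longrightarrow> F y = G y"
  shows "pd i F x = pd i G x"
  using has_partials_cong[OF holo_on_has_partials[OF assms(1,3)] assms(2-4)] pd_eqI by metis

lemma pd_const [simp]: "pd i (\<lambda>_. c) x = 0"
  by (rule pd_eqI[OF has_partials_const])

lemma pd_add: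
  "holo_on F S \<Longrightarrow> holo_on G S \<Longrightarrow> x \<in> S \<Longrightarrow> pd i (\<lambda>y. F y + G y) x = pd i F x + pd i G x"
  by (rule pd_eqI[OF has_partials_add[OF holo_on_has_partials holo_on_has_partials]])

lemma pd_mult:
  "holo_on F S \<Longrightarrow> holo_on G S \<Longrightarrow> x \<in> S \<Longrightarrow>
     pd i (\<lambda>y. F y * G y) x = pd i F x * G x + F x * pd i G x"
  by (rule pd_eqI[OF has_partials_mult[OF holo_on_has_partials holo_on_has_partials]])

lemma pd_sum:
  assumes "\<And>i. i \<in> I \<Longrightarrow> holo_on (F i) S" "x \<in> S"
  shows "pd k (\<lambda>y. \<Sum>i\<in>I. F i y) x = (\<Sum>i\<in>I. pd k (F i) x)"
  using assms(1)
  by (induction I rule: infinite_finite_induct)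
    (auto simp: pd_add[OF _ holo_on_sum assms(2)])

lemma pd_uminus: "holo_on F S \<Longrightarrow> x \<in> S \<Longrightarrow> pd i (\<lambda>y. - F y) x = - pd i F x"
  using pd_mult[OF holo_on_const[of "-1"], of F S x i] by simp

lemma pd_diff:
  "holo_on F S \<Longrightarrow> holo_on G S \<Longrightarrow> x \<in> S \<Longrightarrow> pd i (\<lambda>y. F y - G y) x = pd i F x - pd i G x"
  using pd_add[of F S "\<lambda>y. - G y" x i] pd_uminus[of G S x i] holo_on_uminus[of G S] by simp

lemma pd_chain:
  assumes "holo_on F R" "\<And>i. holo_on (\<lambda>y. T y $ i) S" "x \<in> S" "T x \<in> R"
  shows "pd j (\<lambda>y. F (T y)) x = (\<Sum>i\<in>UNIV. pd i F (T x) * pd j (\<lambda>y. T y $ i) x)"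
  by (rule pd_eqI, rule has_partials_compose[OF holo_on_has_partials[OF assms(1,4)]
        holo_on_has_partials[OF assms(2,3)]])

lemma holo_on_imp_continuous_on: "holo_on F S \<Longrightarrow> continuous_on S F"
  unfolding holo_on_def
  by (metis continuous_at_imp_continuous_on has_derivative_continuous)

abbreviation unit_circle :: "real \<Rightarrow> complex" where
  "unit_circle t \<equiv> exp (2 * of_real pi * \<i> * of_real t)"

lemma norm_axis_complex: "norm (axis i z :: complex^3) = norm z"
proof -
  have "axis i z = z *s (axis i 1 :: complex^3)" by (simp add: vec_eq_iff axis_def)
  show ?thesis
    unfolding norm_vec_def L2_set_def
    by (simp add: axis_def if_distrib if_distribR sum.delta cong: if_cong)
qed

lemma bounded_linear_axis: "bounded_linear (\<lambda>z. axis i z :: complex^3)"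
  by (rule bounded_linear_intro[where K = 1])
    (auto simp: vec_eq_iff axis_def norm_axis_complex[unfolded axis_def])

text \<open>
  A partial derivative is an average of values of the function, by Cauchy's formula in the
  \<open>i\<close>-th variable alone. Unlike the difference quotient, this expression can be differentiated
  with respect to \<open>y\<close>, so that holomorphic functions have partial derivatives of all orders.
\<close>

lemma cauchy_partial:
  assumes F: "holo_on F S" and "open S" and r: "0 < r"
    and disc: "\<And>z. norm z \<le> r \<Longrightarrow> y + axis i z \<in> S"
  shows "pd i F y = integral {0..1} (\<lambda>t. F (y + axis i (r * unit_circle t)) / (r * unit_circle t))"
proof -
  define g where "g = (\<lambda>z. F (y + axis i z))"
  have der: "(g has_field_derivative pd i F (y + axis i z)) (at z)" if "norm z \<le> r" for z
  proof -
    have "((\<lambda>z. y + axis i z) has_derivative (\<lambda>v. axis i v)) (at z)"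
      by (auto intro!: derivative_eq_intros bounded_linear.has_derivative[OF bounded_linear_axis])
    from has_derivative_compose[OF this
        holo_on_has_partials[OF F disc[OF that], unfolded has_partials_def]]
    show ?thesis
      unfolding g_def has_field_derivative_def
      by (simp add: axis_def if_distrib if_distribR sum.delta cong: if_cong)
  qed
  have hol: "g holomorphic_on cball 0 r"
    unfolding holomorphic_on_def
    using der by (meson field_differentiable_def field_differentiable_at_within mem_cball_0)
  have "contour_integral (circlepath 0 r) (\<lambda>u. g u/(u-0)^2) = (2 * pi * \<i>) * deriv g 0"
    by (rule Cauchy_contour_integral_circlepath_2)
      (use hol r in \<open>auto intro: holomorphic_on_imp_continuous_on holomorphic_on_subset\<close>)
  also have "deriv g 0 = pd i F y"
  proof -
    have "y + axis i 0 = y" by (simp add: vec_eq_iff axis_def)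
    then show ?thesis using DERIV_imp_deriv[OF der[of 0]] r by (simp only:) simp
  qed
  finally have "(2 * pi * \<i>) * pd i F y = contour_integral (circlepath 0 r) (\<lambda>u. g u/(u-0)^2)" ..
  also have "\<dots> = integral {0..1} (\<lambda>t. (2 * pi * \<i>) * (g (r * unit_circle t) / (r * unit_circle t)))"
    unfolding contour_integral_integral vector_derivative_circlepath
    by (rule integral_cong) (use r in \<open>simp add: circlepath power2_eq_square field_simps\<close>)
  also have "\<dots> = (2 * pi * \<i>) * integral {0..1} (\<lambda>t. g (r * unit_circle t) / (r * unit_circle t))"
    by (rule integral_mult_right)
  finally show ?thesis by (simp add: g_def)
qed

context
  fixes F S x0 and r :: real
  assumes F: "holo_on F S" and S: "open S" and r: "0 < r" and sub: "ball x0 (2 * r) \<subseteq> S"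
begin

lemma shifted_disc_in: "y \<in> ball x0 r \<Longrightarrow> norm z \<le> r \<Longrightarrow> y + axis i z \<in> S"
proof -
  assume "y \<in> ball x0 r" "norm z \<le> r"
  then have "dist x0 (y + axis i z) < 2 * r"
    using norm_triangle_ineq4[of "x0 - y" "axis i z"] norm_axis_complex[of i z]
    by (simp add: dist_norm algebra_simps)
  then show ?thesis using sub by auto
qed

lemma continuous_on_cauchy_kernel:
  assumes "continuous_on S G"
  shows "continuous_on (ball x0 r \<times> cbox 0 1)
    (\<lambda>(y, t). G (y + axis i (r * unit_circle t)) / (r * unit_circle t))"
  unfolding split_beta
proof (intro continuous_on_divide)
  have "continuous_on (ball x0 r \<times> cbox 0 (1::real))
      (\<lambda>p. fst p + axis i (complex_of_real r * unit_circle (snd p)))"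
    by (intro continuous_intros bounded_linear.continuous_on[OF bounded_linear_axis])
  then show "continuous_on (ball x0 r \<times> cbox 0 (1::real))
     (\<lambda>p. G (fst p + axis i (complex_of_real r * unit_circle (snd p))))"
    by (rule continuous_on_compose2[OF assms]) (use r shifted_disc_in in \<open>auto simp: norm_mult\<close>)
qed (use r in \<open>auto intro!: continuous_intros\<close>)

lemma continuous_on_pd_ball: "continuous_on (ball x0 r) (pd i F)"
proof -
  have "continuous_on (ball x0 r)
     (\<lambda>y. integral (cbox 0 1) (\<lambda>t. F (y + axis i (r * unit_circle t)) / (r * unit_circle t)))"
    by (rule integral_continuous_on_param) (rule continuous_on_cauchy_kernel[OF holo_on_imp_continuous_on[OF F]])
  then show ?thesis
    by (rule continuous_on_eq) (use cauchy_partial[OF F S r shifted_disc_in] in auto)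
qed

end

text \<open>
  First of two passes through Cauchy's formula: differentiation under the integral sign requires
  the continuity of the derivative, which complex differentiability does not provide by definition.
\<close>

lemma continuous_on_pd:
  assumes "holo_on F S" "open S"
  shows "continuous_on S (pd i F)"
proof (rule continuous_at_imp_continuous_on, rule ballI)
  fix x assume "x \<in> S"
  then obtain e where e: "e > 0" "ball x e \<subseteq> S" using \<open>open S\<close> open_contains_ball by blast
  then have "continuous_on (ball x (e/2)) (pd i F)"
    using continuous_on_pd_ball[OF assms, of "e/2" x] by simp
  then show "isCont (pd i F) x" using e by (simp add: continuous_on_eq_continuous_at)
qed

text \<open>
  Second pass: the averaging formula of \<open>cauchy_partial\<close> is differentiated under the integral
  sign. The integrals that appear are again those of \<open>cauchy_partial\<close>, for the functions
  \<open>pd j F\<close>, which is why second derivatives commute.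
\<close>

lemma has_partials_pd:
  assumes F: "holo_on F S" and S: "open S" and r: "0 < r" and sub: "ball x0 (2 * r) \<subseteq> S"
  shows "has_partials (pd i F)
    (\<lambda>j. integral {0..1} (\<lambda>t. pd j F (x0 + axis i (r * unit_circle t)) / (r * unit_circle t))) x0"
proof -
  note disc = shifted_disc_in[OF F S r sub]
  let ?K = "\<lambda>G y t. G (y + axis i (complex_of_real r * unit_circle t)) / (complex_of_real r * unit_circle t)"
  let ?N = "\<lambda>j. Blinfun (\<lambda>v::complex^3. v $ j)"
  have N: "blinfun_apply (?N j) v = v $ j" for j v
    by (simp add: bounded_linear_Blinfun_apply bounded_linear_vec_nth)
  \<comment> \<open>the derivative of the integrand as a bounded linear map, the form in which its continuity is needed\<close>
  define fx where "fx = (\<lambda>y t. \<Sum>j\<in>UNIV. blinfun_mult_right (?K (pd j F) y t) o\<^sub>L ?N j)"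
  have fxv: "blinfun_apply (fx y t) v = (\<Sum>j\<in>UNIV. ?K (pd j F) y t * v $ j)" for y t v
    unfolding fx_def by (simp add: blinfun.sum_left N)
  have ck: "continuous_on (ball x0 r \<times> cbox 0 1) (\<lambda>(y, t). ?K (pd j F) y t)" for j
    by (rule continuous_on_cauchy_kernel[OF F S r sub continuous_on_pd[OF F S]])
  have ck1: "continuous_on (cbox 0 1) (\<lambda>t. ?K G x0 t)" if "continuous_on S G" for G
  proof -
    have "continuous_on (cbox 0 (1::real)) (Pair x0)" "Pair x0 ` cbox 0 1 \<subseteq> ball x0 r \<times> cbox 0 (1::real)"
      using r by (auto intro: continuous_intros)
    from continuous_on_compose2[OF continuous_on_cauchy_kernel[OF F S r sub that] this]
    show ?thesis by simp
  qed
  have "((\<lambda>y. integral (cbox 0 1) (?K F y)) has_derivative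
           blinfun_apply (integral (cbox 0 1) (fx x0))) (at x0 within ball x0 r)"
  proof (rule leibniz_rule)
    fix y t assume y: "y \<in> ball x0 r" and t: "(t::real) \<in> cbox 0 1"
    have in_S: "y + axis i (complex_of_real r * unit_circle t) \<in> S"
      by (rule disc[OF y]) (use r in \<open>simp add: norm_mult\<close>)
    have "((\<lambda>y. y + axis i (complex_of_real r * unit_circle t)) has_derivative (\<lambda>v. v)) (at y)"
      by (auto intro!: derivative_eq_intros)
    from has_derivative_compose[OF this holo_on_has_partials[OF F in_S, unfolded has_partials_def]]
    have "((\<lambda>y. F (y + axis i (complex_of_real r * unit_circle t))) has_derivative
       (\<lambda>v. \<Sum>j\<in>UNIV. pd j F (y + axis i (complex_of_real r * unit_circle t)) * v $ j)) (at y)" .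
    then have "((\<lambda>y. ?K F y t) has_derivative
       (\<lambda>v. (\<Sum>j\<in>UNIV. pd j F (y + axis i (complex_of_real r * unit_circle t)) * v $ j)
              / (complex_of_real r * unit_circle t))) (at y)"
      by (rule bounded_linear.has_derivative[OF bounded_linear_divide])
    moreover have "blinfun_apply (fx y t) =
       (\<lambda>v. (\<Sum>j\<in>UNIV. pd j F (y + axis i (complex_of_real r * unit_circle t)) * v $ j)
              / (complex_of_real r * unit_circle t))"
      by (rule ext) (simp add: fxv sum_divide_distrib)
    ultimately show "((\<lambda>y. ?K F y t) has_derivative blinfun_apply (fx y t)) (at y within ball x0 r)"
      by (simp only: has_derivative_at_withinI)
  next
    fix y assume y: "y \<in> ball x0 r"
    show "?K F y integrable_on cbox 0 1"
    proof (rule integrable_continuous)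
      have "continuous_on (cbox 0 (1::real)) (Pair y)" "Pair y ` cbox 0 1 \<subseteq> ball x0 r \<times> cbox 0 (1::real)"
        using y by (auto intro: continuous_intros)
      from continuous_on_compose2[OF continuous_on_cauchy_kernel[OF F S r sub holo_on_imp_continuous_on[OF F]] this]
      show "continuous_on (cbox 0 1) (?K F y)" by simp
    qed
  next
    show "continuous_on (ball x0 r \<times> cbox 0 1) (\<lambda>(y, t). fx y t)"
      unfolding fx_def split_beta
      by (intro continuous_on_sum bounded_bilinear.continuous_on[OF bounded_bilinear_blinfun_compose]
          bounded_linear.continuous_on[OF bounded_linear_blinfun_mult_right] continuous_on_const
          ck[unfolded split_beta])
  qed (use r in auto)
  moreover have "blinfun_apply (integral (cbox 0 1) (fx x0))
       = (\<lambda>v. \<Sum>j\<in>UNIV. integral {0..1} (?K (pd j F) x0) * v $ j)"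
  proof
    fix v
    have "continuous_on (cbox 0 1) (fx x0)"
      unfolding fx_def by (intro continuous_intros ck1 continuous_on_pd[OF F S])
    then have "blinfun_apply (integral (cbox 0 1) (fx x0)) v
        = integral (cbox 0 1) (\<lambda>t. blinfun_apply (fx x0 t) v)"
      by (intro blinfun_apply_integral integrable_continuous)
    also have "\<dots> = (\<Sum>j\<in>UNIV. integral (cbox 0 1) (\<lambda>t. ?K (pd j F) x0 t * v $ j))"
      unfolding fxv by (intro integral_sum integrable_continuous continuous_intros ck1 continuous_on_pd[OF F S]) auto
    finally show "blinfun_apply (integral (cbox 0 1) (fx x0)) v
       = (\<Sum>j\<in>UNIV. integral {0..1} (?K (pd j F) x0) * v $ j)"
      by (simp only: integral_mult_left box_real)
  qed
  ultimately have "((\<lambda>y. integral (cbox 0 1) (?K F y)) has_derivative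
        (\<lambda>v. \<Sum>j\<in>UNIV. integral {0..1} (?K (pd j F) x0) * v $ j)) (at x0)"
    using at_within_open[of x0 "ball x0 r"] r by simp
  then have "has_partials (\<lambda>y. integral (cbox 0 1) (?K F y))
       (\<lambda>j. integral {0..1} (?K (pd j F) x0)) x0"
    unfolding has_partials_def by simp
  then show ?thesis
    by (rule has_partials_cong[of _ _ _ "ball x0 r"])
      (use r cauchy_partial[OF F S r disc] in auto)
qed

lemma holo_on_pd:
  assumes "holo_on F S" "open S"
  shows "holo_on (pd i F) S"
proof (rule holo_onI)
  fix x assume "x \<in> S"
  then obtain e where "e > 0" "ball x e \<subseteq> S" using \<open>open S\<close> open_contains_ball by blast
  then show "\<exists>D. has_partials (pd i F) D x"
    using has_partials_pd[OF assms, of "e/2" x i] by auto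
qed

lemma pd_commute:
  assumes F: "holo_on F S" and S: "open S" and "x \<in> S"
  shows "pd i (pd j F) x = pd j (pd i F) x"
proof -
  obtain e where e: "e > 0" "ball x e \<subseteq> S" using \<open>x \<in> S\<close> \<open>open S\<close> open_contains_ball by blast
  let ?r = "e / 2"
  have sub: "ball x (2 * ?r) \<subseteq> S" and r: "0 < ?r" using e by auto
  have "pd i (pd j F) x = integral {0..1} (\<lambda>t. pd i F (x + axis j (?r * unit_circle t)) / (?r * unit_circle t))"
    by (rule pd_eqI[OF has_partials_pd[OF F S r sub]])
  also have "\<dots> = pd j (pd i F) x"
    by (rule cauchy_partial[OF holo_on_pd[OF F S] S r, symmetric])
      (use shifted_disc_in[OF F S r sub] r in auto)
  finally show ?thesis .
qed


section \<open>Matrix-valued functions\<close>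

definition holo_mat :: "(complex^3 \<Rightarrow> complex^3^3) \<Rightarrow> (complex^3) set \<Rightarrow> bool" where
  "holo_mat A S \<longleftrightarrow> (\<forall>a b. holo_on (\<lambda>x. A x $ a $ b) S)"

definition holo_vec :: "(complex^3 \<Rightarrow> complex^3) \<Rightarrow> (complex^3) set \<Rightarrow> bool" where
  "holo_vec X S \<longleftrightarrow> (\<forall>a. holo_on (\<lambda>x. X x $ a) S)"

definition pdm :: "3 \<Rightarrow> (complex^3 \<Rightarrow> complex^3^3) \<Rightarrow> complex^3 \<Rightarrow> complex^3^3" where
  "pdm i A x = (\<chi> a b. pd i (\<lambda>y. A y $ a $ b) x)"

lemma pdm_nth [simp]: "pdm i A x $ a $ b = pd i (\<lambda>y. A y $ a $ b) x"
  by (simp add: pdm_def)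

lemma matrix_mul_nth: "(A ** B) $ i $ j = (\<Sum>k\<in>UNIV. A $ i $ k * B $ k $ j)"
  by (simp add: matrix_matrix_mult_def)

lemma matrix_vector_nth: "(A *v x) $ i = (\<Sum>k\<in>UNIV. A $ i $ k * x $ k)"
  by (simp add: matrix_vector_mult_def)

lemma transpose_nth: "transpose A $ i $ j = A $ j $ i"
  by (simp add: transpose_def)

lemma matrix_diff_ldistrib: "A ** (B - C) = A ** B - A ** (C :: 'a::ring_1^'n^'m)"
  by (simp add: vec_eq_iff matrix_mul_nth sum_subtractf algebra_simps)

lemma matrix_diff_rdistrib: "(B - C) ** A = B ** A - (C :: 'a::ring_1^'n^'m) ** A"
  by (simp add: vec_eq_iff matrix_mul_nth sum_subtractf algebra_simps)

lemma matrix_add_rdistrib: "(B + C) ** A = B ** A + (C :: 'a::ring_1^'n^'m) ** A"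
  by (simp add: vec_eq_iff matrix_mul_nth sum.distrib algebra_simps)

lemma holo_mat_mult: "holo_mat A S \<Longrightarrow> holo_mat B S \<Longrightarrow> holo_mat (\<lambda>x. A x ** B x) S"
  unfolding holo_mat_def matrix_mul_nth by (intro allI holo_intros) auto

lemma holo_mat_transpose: "holo_mat A S \<Longrightarrow> holo_mat (\<lambda>x. transpose (A x)) S"
  unfolding holo_mat_def transpose_nth by auto

lemma holo_mat_const: "holo_mat (\<lambda>_. A) S"
  unfolding holo_mat_def by (intro allI holo_intros)

lemma holo_mat_diff: "holo_mat A S \<Longrightarrow> holo_mat B S \<Longrightarrow> holo_mat (\<lambda>x. A x - B x) S"
  unfolding holo_mat_def by (simp add: holo_on_diff)

lemma holo_mat_pdm: "holo_mat A S \<Longrightarrow> open S \<Longrightarrow> holo_mat (pdm i A) S"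
  unfolding holo_mat_def pdm_nth by (auto intro: holo_on_pd)

lemma holo_mat_vec: "holo_mat A S \<Longrightarrow> holo_vec X S \<Longrightarrow> holo_vec (\<lambda>x. A x *v X x) S"
  unfolding holo_mat_def holo_vec_def matrix_vector_nth by (intro allI holo_intros) auto

lemma holo_mat_cong:
  assumes "holo_mat A S" "open S" "\<And>x. x \<in> S \<Longrightarrow> A x = B x"
  shows "holo_mat B S"
  using assms(1) unfolding holo_mat_def
  by (metis (mono_tags, lifting) holo_on_cong[OF _ assms(2)] assms(3))

lemma matrix_inv_right: "invertible (A :: complex^3^3) \<Longrightarrow> A ** matrix_inv A = mat 1"
  and matrix_inv_left: "invertible A \<Longrightarrow> matrix_inv A ** A = mat 1"
  unfolding invertible_def matrix_inv_def by (metis (mono_tags, lifting) someI_ex)+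

lemma matrix_inv_unique:
  assumes "A ** B = mat 1"
  shows "matrix_inv A = (B :: complex^3^3)"
proof -
  have "invertible A" using assms invertible_right_inverse by blast
  then have "matrix_inv A ** (A ** B) = B"
    by (simp add: matrix_mul_assoc matrix_inv_left)
  then show ?thesis by (simp add: assms)
qed

lemma holo_mat_inv:
  assumes A: "holo_mat A S" and inv: "\<And>x. x \<in> S \<Longrightarrow> invertible (A x)" and S: "open S"
  shows "holo_mat (\<lambda>x. matrix_inv (A x)) S"
proof -
  have det: "holo_on (\<lambda>x. det (M x)) S" if "holo_mat M S" for M
    using that unfolding det_3 holo_mat_def by (intro holo_intros) auto
  define C :: "complex^3 \<Rightarrow> complex^3^3" where
    "C = (\<lambda>x. \<chi> k l. det (\<chi> i j. if j = k then (if i = l then 1 else 0) else A x $ i $ j) / det (A x))"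
  \<comment> \<open>Cramer's rule exhibits the inverse as a rational expression in the entries\<close>
  have eq: "matrix_inv (A x) = C x" if "x \<in> S" for x
  proof (rule matrix_inv_unique)
    have d: "det (A x) \<noteq> 0" using inv[OF that] invertible_det_nz by blast
    have "A x *v column l (C x) = axis l 1" for l
    proof (subst cramer[OF d])
      show "column l (C x) =
        (\<chi> k. det (\<chi> i j. if j = k then axis l 1 $ i else A x $ i $ j) / det (A x))"
        unfolding C_def column_def axis_def by (simp cong: if_cong)
    qed
    then show "A x ** C x = mat 1"
      by (simp add: vec_eq_iff matrix_mul_nth matrix_vector_nth column_def mat_def axis_def)
  qed
  have "holo_on (\<lambda>x. C x $ k $ l) S" for k l
    unfolding C_def vec_lambda_beta
  proof (rule holo_on_divide)
    show "holo_on (\<lambda>x. det (\<chi> i j. if j = k then if i = l then 1 else 0 else A x $ i $ j)) S"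
    proof (rule det, unfold holo_mat_def vec_lambda_beta, intro allI)
      show "holo_on (\<lambda>x. if b = k then if a = l then 1 else 0 else A x $ a $ b) S" for a b
        using A by (cases "b = k"; cases "a = l") (auto simp: holo_mat_def)
    qed
    show "holo_on (\<lambda>x. det (A x)) S" by (rule det[OF A])
    show "det (A x) \<noteq> 0" if "x \<in> S" for x using inv[OF that] invertible_det_nz by blast
  qed
  then have "holo_mat C S" by (simp add: holo_mat_def)
  then show ?thesis by (rule holo_mat_cong[OF _ S]) (simp add: eq)
qed

lemma pdm_mult:
  assumes "holo_mat A S" "holo_mat B S" "x \<in> S"
  shows "pdm i (\<lambda>y. A y ** B y) x = pdm i A x ** B x + A x ** pdm i B x"
proof -
  have h: "holo_on (\<lambda>y. A y $ a $ b) S" "holo_on (\<lambda>y. B y $ a $ b) S" for a b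
    using assms by (auto simp: holo_mat_def)
  show ?thesis
    by (simp add: vec_eq_iff matrix_mul_nth pd_sum[OF holo_on_mult[OF h] assms(3)]
        pd_mult[OF h assms(3)] sum.distrib)
qed

lemma pdm_transpose: "pdm i (\<lambda>y. transpose (A y)) x = transpose (pdm i A x)"
  by (simp add: vec_eq_iff transpose_nth)

lemma pdm_const [simp]: "pdm i (\<lambda>_. A) x = 0"
  by (simp add: vec_eq_iff)

lemma pdm_diff:
  assumes "holo_mat A S" "holo_mat B S" "x \<in> S"
  shows "pdm i (\<lambda>y. A y - B y) x = pdm i A x - pdm i B x"
  using assms by (simp add: vec_eq_iff holo_mat_def pd_diff[where S = S])

lemma pdm_cong:
  assumes "holo_mat A S" "open S" "x \<in> S" "\<And>y. y \<in> S \<Longrightarrow> A y = B y"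
  shows "pdm i A x = pdm i B x"
proof -
  have "pd i (\<lambda>y. A y $ a $ b) x = pd i (\<lambda>y. B y $ a $ b) x" for a b
    by (rule pd_cong[OF _ assms(2,3)]) (use assms in \<open>auto simp: holo_mat_def\<close>)
  then show ?thesis by (simp add: vec_eq_iff)
qed

lemma pdm_commute:
  assumes "holo_mat A S" "open S" "x \<in> S"
  shows "pdm i (pdm j A) x = pdm j (pdm i A) x"
proof -
  have "pd i (pd j (\<lambda>y. A y $ a $ b)) x = pd j (pd i (\<lambda>y. A y $ a $ b)) x" for a b
    by (rule pd_commute[OF _ assms(2,3)]) (use assms in \<open>auto simp: holo_mat_def\<close>)
  then show ?thesis by (simp add: vec_eq_iff)
qed

text \<open>
  Tensor identities are proved by evaluating a covariant 2-tensor \<open>M\<close> on a frame, the columns of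
  \<open>E\<close>; this lemma returns from the frame to coordinates.
\<close>

lemma congruence_eq_0:
  assumes "invertible (E :: complex^3^3)" "transpose E ** M ** E = 0"
  shows "M = 0"
proof -
  have "transpose (matrix_inv E) ** (transpose E ** M ** E) ** matrix_inv E
      = transpose (E ** matrix_inv E) ** M ** (E ** matrix_inv E)"
    by (simp add: matrix_transpose_mul matrix_mul_assoc)
  then show ?thesis using assms by (simp add: matrix_inv_right)
qed


section \<open>Frames and the connection of a Weyl structure\<close>

definition lie3 :: "(complex^3 \<Rightarrow> complex^3) \<Rightarrow> (complex^3 \<Rightarrow> complex^3) \<Rightarrow> complex^3 \<Rightarrow> complex^3" where
  "lie3 X Y x = (\<chi> i. \<Sum>j\<in>UNIV. X x $ j * pd j (\<lambda>y. Y y $ i) x - Y x $ j * pd j (\<lambda>y. X y $ i) x)"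

text \<open>
  A frame is given by the matrix \<open>E x\<close> whose columns are its vectors \<open>V 1, V 2, V 3\<close>; the rows of
  the inverse matrix are the dual coframe.
\<close>

definition structure_coeff :: "(complex^3 \<Rightarrow> complex^3^3) \<Rightarrow> complex^3 \<Rightarrow> 3 \<Rightarrow> 3 \<Rightarrow> 3 \<Rightarrow> complex" where
  "structure_coeff E x a b c =
     (matrix_inv (E x) *v lie3 (\<lambda>y. column a (E y)) (\<lambda>y. column b (E y)) x) $ c"

text \<open>
  The Gram matrix of the frame for the metric inverse to
  $V_2 \otimes V_2 - \frac12 (V_1 \otimes V_3 + V_3 \otimes V_1)$.
\<close>

definition null_gram :: "complex^3^3" where
  "null_gram = vector [vector [0, 0, -2], vector [0, 1, 0], vector [-2, 0, 0]]"

definition gram_metric :: "(complex^3 \<Rightarrow> complex^3^3) \<Rightarrow> complex^3 \<Rightarrow> complex^3^3" where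
  "gram_metric E x = transpose (matrix_inv (E x)) ** null_gram ** matrix_inv (E x)"

text \<open>
  The general element of the Lie algebra of conformal transformations of \<open>null_gram\<close>: \<open>- n / 2\<close> is
  the scaling part, and \<open>p, q, r\<close> are coordinates on the rotations, which form a copy of
  $\mathfrak{sl}_2$ acting on the quadratic polynomials in the spectral parameter.
\<close>

definition co_mat :: "complex \<Rightarrow> complex \<Rightarrow> complex \<Rightarrow> complex \<Rightarrow> complex^3^3" where
  "co_mat n p q r = vector [vector [p - n / 2, r, 0], vector [2 * q, - (n / 2), 2 * r],
     vector [0, q, - p - n / 2]]"

text \<open>
  The spin coefficients. A Weyl connection has in the frame the matrices
  \<open>co_mat (n $ a) (p $ a) (q $ a) (r $ a)\<close>, \<open>a = 1, 2, 3\<close>, where \<open>n $ a = \<nu>(V a)\<close>. Vanishing torsion is a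
  system of nine linear equations for the nine unknowns \<open>p, q, r\<close>, given \<open>n\<close> and the structure
  coefficients \<open>C\<close>; the three vectors \<open>spin_p\<close>, \<open>spin_q\<close>, \<open>spin_r\<close> are its solution.
\<close>

definition spin_p :: "(3 \<Rightarrow> 3 \<Rightarrow> 3 \<Rightarrow> complex) \<Rightarrow> complex^3 \<Rightarrow> complex^3" where
  "spin_p C n = vector [- (n $ 1 / 2) - C 1 3 3, (C 1 3 2 / 2 - C 1 2 1 - C 2 3 3) / 2,
     n $ 3 / 2 - C 1 3 1]"

definition spin_q :: "(3 \<Rightarrow> 3 \<Rightarrow> 3 \<Rightarrow> complex) \<Rightarrow> complex^3 \<Rightarrow> complex^3" where
  "spin_q C n = vector [C 1 2 3, - (C 1 2 2 + n $ 1 / 2) / 2,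
     (C 1 2 1 - C 1 3 2 / 2 - C 2 3 3 - n $ 2) / 2]"

definition spin_r :: "(3 \<Rightarrow> 3 \<Rightarrow> 3 \<Rightarrow> complex) \<Rightarrow> complex^3 \<Rightarrow> complex^3" where
  "spin_r C n = vector [(C 1 3 2 / 2 + C 1 2 1 - C 2 3 3 - n $ 2) / 2, (C 2 3 2 - n $ 3 / 2) / 2,
     - C 2 3 1]"

lemma spin_torsion:
  assumes "\<And>a b c. C a b c = - C b a c"
  shows "co_mat (n $ a) (spin_p C n $ a) (spin_q C n $ a) (spin_r C n $ a) $ c $ b
       - co_mat (n $ b) (spin_p C n $ b) (spin_q C n $ b) (spin_r C n $ b) $ c $ a = C a b c"
proof -
  have z: "C a a c = 0" for a c using assms[of a a c] by simp
  have "\<forall>a b c. co_mat (n $ a) (spin_p C n $ a) (spin_q C n $ a) (spin_r C n $ a) $ c $ b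
       - co_mat (n $ b) (spin_p C n $ b) (spin_q C n $ b) (spin_r C n $ b) $ c $ a = C a b c"
    unfolding forall_3 co_mat_def spin_p_def spin_q_def spin_r_def
    by (simp add: z assms[of 2 1] assms[of 3 1] assms[of 3 2] field_simps)
  then show ?thesis by blast
qed

text \<open>
  The infinitesimal form of conformal invariance of \<open>null_gram\<close>; the factor \<open>- n\<close> accounts for
  $D h = \nu \otimes h$.
\<close>

lemma co_mat_conformal:
  "transpose (co_mat n p q r) ** null_gram + null_gram ** co_mat n p q r = (\<chi> i j. - n * null_gram $ i $ j)"
  by (simp add: vec_eq_iff forall_3 matrix_mul_nth sum_3 transpose_nth co_mat_def null_gram_def)

definition frame_oneform :: "(complex^3 \<Rightarrow> complex^3^3) \<Rightarrow> complex^3 \<Rightarrow> complex^3 \<Rightarrow> complex^3" where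
  "frame_oneform E x w = transpose (matrix_inv (E x)) *v w"

definition frame_comp :: "(complex^3 \<Rightarrow> complex^3^3) \<Rightarrow> (complex^3 \<Rightarrow> complex^3) \<Rightarrow> complex^3 \<Rightarrow> complex^3" where
  "frame_comp E \<nu> x = transpose (E x) *v \<nu> x"

definition form_p where
  "form_p E \<nu> x = frame_oneform E x (spin_p (structure_coeff E x) (frame_comp E \<nu> x))"
definition form_q where
  "form_q E \<nu> x = frame_oneform E x (spin_q (structure_coeff E x) (frame_comp E \<nu> x))"
definition form_r where
  "form_r E \<nu> x = frame_oneform E x (spin_r (structure_coeff E x) (frame_comp E \<nu> x))"

text \<open>
  The matrix of connection forms of the Weyl connection with respect to the frame, in the direction
  of the \<open>i\<close>-th coordinate, and its gauge transform to the coordinate frame. The latter is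
  determined by $\partial_i E + \Gamma_i E = E \omega_i$.
\<close>

definition conn_form :: "(complex^3 \<Rightarrow> complex^3^3) \<Rightarrow> (complex^3 \<Rightarrow> complex^3) \<Rightarrow> 3 \<Rightarrow> complex^3 \<Rightarrow> complex^3^3" where
  "conn_form E \<nu> i x = co_mat (\<nu> x $ i) (form_p E \<nu> x $ i) (form_q E \<nu> x $ i) (form_r E \<nu> x $ i)"

definition conn_mat :: "(complex^3 \<Rightarrow> complex^3^3) \<Rightarrow> (complex^3 \<Rightarrow> complex^3) \<Rightarrow> 3 \<Rightarrow> complex^3 \<Rightarrow> complex^3^3" where
  "conn_mat E \<nu> i x = (E x ** conn_form E \<nu> i x - pdm i E x) ** matrix_inv (E x)"

definition frame_conn :: "(complex^3 \<Rightarrow> complex^3^3) \<Rightarrow> (complex^3 \<Rightarrow> complex^3) \<Rightarrow> conn" where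
  "frame_conn E \<nu> i j k x = conn_mat E \<nu> j x $ i $ k"

lemma structure_coeff_antisym: "structure_coeff E x a b c = - structure_coeff E x b a c"
proof -
  have "lie3 X Y x = - lie3 Y X x" for X Y
    by (simp add: lie3_def vec_eq_iff sum_subtractf)
  then show ?thesis
    unfolding structure_coeff_def matrix_vector_nth
    by (metis (no_types, lifting) mult_minus_right sum.cong sum_negf vector_uminus_component)
qed

lemma co_mat_contract:
  "(\<Sum>i\<in>I. c i * co_mat (n i) (p i) (q i) (r i) $ a $ b) =
   co_mat (\<Sum>i\<in>I. c i * n i) (\<Sum>i\<in>I. c i * p i) (\<Sum>i\<in>I. c i * q i) (\<Sum>i\<in>I. c i * r i) $ a $ b"
proof -
  have "\<forall>a b. (\<Sum>i\<in>I. c i * co_mat (n i) (p i) (q i) (r i) $ a $ b) =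
   co_mat (\<Sum>i\<in>I. c i * n i) (\<Sum>i\<in>I. c i * p i) (\<Sum>i\<in>I. c i * q i) (\<Sum>i\<in>I. c i * r i) $ a $ b"
    unfolding forall_3 co_mat_def
    by (simp add: sum_subtractf sum_distrib_left sum_divide_distrib sum_negf algebra_simps)
  then show ?thesis by blast
qed

locale weyl_frame =
  fixes S :: "(complex^3) set" and E :: "complex^3 \<Rightarrow> complex^3^3" and \<nu> :: "complex^3 \<Rightarrow> complex^3"
  assumes S: "open S" and E: "holo_mat E S" and inv: "x \<in> S \<Longrightarrow> invertible (E x)"
    and \<nu>: "holo_vec \<nu> S"
begin

abbreviation "\<theta> \<equiv> \<lambda>x. matrix_inv (E x)"

lemma holo_theta: "holo_mat \<theta> S" by (rule holo_mat_inv[OF E inv S])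

lemma holo_struct: "holo_on (\<lambda>x. structure_coeff E x a b c) S"
  unfolding structure_coeff_def matrix_vector_nth lie3_def column_def
  using holo_theta E unfolding holo_mat_def
  by (simp only: vec_lambda_beta) (intro holo_intros holo_on_pd S; simp)

lemma holo_frame_comp: "holo_on (\<lambda>x. frame_comp E \<nu> x $ a) S"
  unfolding frame_comp_def matrix_vector_nth transpose_nth
  using E \<nu> unfolding holo_mat_def holo_vec_def by (intro holo_intros) auto

lemma holo_spin:
  "holo_on (\<lambda>x. spin_p (structure_coeff E x) (frame_comp E \<nu> x) $ a) S"
  "holo_on (\<lambda>x. spin_q (structure_coeff E x) (frame_comp E \<nu> x) $ a) S"
  "holo_on (\<lambda>x. spin_r (structure_coeff E x) (frame_comp E \<nu> x) $ a) S"
  by (cases a rule: exhaust_3[THEN disjE]; (elim disjE)?;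
      simp add: spin_p_def spin_q_def spin_r_def;
      intro holo_intros holo_struct holo_frame_comp; simp)+

lemma holo_forms:
  "holo_on (\<lambda>x. form_p E \<nu> x $ i) S" "holo_on (\<lambda>x. form_q E \<nu> x $ i) S"
  "holo_on (\<lambda>x. form_r E \<nu> x $ i) S" "holo_on (\<lambda>x. \<nu> x $ i) S"
  using holo_theta \<nu>
  unfolding form_p_def form_q_def form_r_def frame_oneform_def matrix_vector_nth transpose_nth
    holo_mat_def holo_vec_def
  by (auto intro!: holo_intros holo_spin)

lemma holo_conn_form: "holo_mat (conn_form E \<nu> i) S"
  unfolding holo_mat_def conn_form_def co_mat_def forall_3
  by (simp, intro conjI holo_intros holo_forms; simp)

lemma holo_conn_mat: "holo_mat (conn_mat E \<nu> i) S"
  unfolding conn_mat_def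
  by (intro holo_mat_mult holo_mat_diff E holo_conn_form holo_theta holo_mat_pdm S)

lemma theta_E: "x \<in> S \<Longrightarrow> \<theta> x ** E x = mat 1" and E_theta: "x \<in> S \<Longrightarrow> E x ** \<theta> x = mat 1"
  using inv matrix_inv_left matrix_inv_right by auto

lemma conn_mat_E: "x \<in> S \<Longrightarrow> conn_mat E \<nu> i x ** E x = E x ** conn_form E \<nu> i x - pdm i E x"
  unfolding conn_mat_def by (metis matrix_mul_assoc matrix_mul_rid theta_E)

lemma pdm_E: "x \<in> S \<Longrightarrow> pdm i E x = E x ** conn_form E \<nu> i x - conn_mat E \<nu> i x ** E x"
  by (simp add: conn_mat_E)

lemma frame_oneform_contract:
  assumes "x \<in> S"
  shows "(\<Sum>i\<in>UNIV. E x $ i $ a * frame_oneform E x w $ i) = w $ a"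
proof -
  have "(\<Sum>i\<in>UNIV. E x $ i $ a * frame_oneform E x w $ i) = (transpose (E x) *v frame_oneform E x w) $ a"
    by (simp only: matrix_vector_nth transpose_nth)
  also have "transpose (E x) *v frame_oneform E x w = transpose (\<theta> x ** E x) *v w"
    unfolding frame_oneform_def matrix_transpose_mul by (simp only: matrix_vector_mul_assoc)
  finally show ?thesis by (simp add: theta_E[OF assms])
qed

lemma conn_form_contract:
  assumes "x \<in> S"
  shows "(\<Sum>i\<in>UNIV. E x $ i $ a * conn_form E \<nu> i x $ c $ b)
    = co_mat (frame_comp E \<nu> x $ a) (spin_p (structure_coeff E x) (frame_comp E \<nu> x) $ a)
       (spin_q (structure_coeff E x) (frame_comp E \<nu> x) $ a)
       (spin_r (structure_coeff E x) (frame_comp E \<nu> x) $ a) $ c $ b"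
proof -
  have "(\<Sum>i\<in>UNIV. E x $ i $ a * \<nu> x $ i) = frame_comp E \<nu> x $ a"
    by (simp only: frame_comp_def matrix_vector_nth transpose_nth)
  then show ?thesis
    unfolding conn_form_def co_mat_contract form_p_def form_q_def form_r_def
      frame_oneform_contract[OF assms] by simp
qed

text \<open>
  Evaluated on the frame, torsion is the difference of the two sides of \<open>spin_torsion\<close>.
\<close>

lemma frame_conn_sym:
  assumes x: "x \<in> S"
  shows "frame_conn E \<nu> i j k x = frame_conn E \<nu> i k j x"
proof -
  let ?C = "structure_coeff E x"
  let ?n = "frame_comp E \<nu> x"
  define W where "W a = co_mat (?n $ a) (spin_p ?C ?n $ a) (spin_q ?C ?n $ a) (spin_r ?C ?n $ a)" for a
  define M :: "complex^3^3" where "M = (\<chi> j k. frame_conn E \<nu> i j k x - frame_conn E \<nu> i k j x)"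
  have one: "(\<Sum>j\<in>UNIV. E x $ j $ a * (\<Sum>k\<in>UNIV. conn_mat E \<nu> j x $ i $ k * E x $ k $ b))
     = (\<Sum>c\<in>UNIV. E x $ i $ c * W a $ c $ b) - (\<Sum>j\<in>UNIV. E x $ j $ a * pd j (\<lambda>y. E y $ i $ b) x)"
    for a b
  proof -
    have "(\<Sum>j\<in>UNIV. E x $ j $ a * (\<Sum>k\<in>UNIV. conn_mat E \<nu> j x $ i $ k * E x $ k $ b))
      = (\<Sum>j\<in>UNIV. E x $ j $ a * (conn_mat E \<nu> j x ** E x) $ i $ b)"
      by (simp only: matrix_mul_nth)
    also have "\<dots> = (\<Sum>j\<in>UNIV. E x $ j $ a * (\<Sum>c\<in>UNIV. E x $ i $ c * conn_form E \<nu> j x $ c $ b))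
        - (\<Sum>j\<in>UNIV. E x $ j $ a * pd j (\<lambda>y. E y $ i $ b) x)"
      by (simp add: conn_mat_E[OF x] matrix_mul_nth right_diff_distrib sum_subtractf)
    also have "(\<Sum>j\<in>UNIV. E x $ j $ a * (\<Sum>c\<in>UNIV. E x $ i $ c * conn_form E \<nu> j x $ c $ b))
      = (\<Sum>c\<in>UNIV. E x $ i $ c * (\<Sum>j\<in>UNIV. E x $ j $ a * conn_form E \<nu> j x $ c $ b))"
      by (simp add: sum_3 algebra_simps)
    finally show ?thesis unfolding W_def conn_form_contract[OF x] .
  qed
  have lie: "(\<Sum>j\<in>UNIV. E x $ j $ a * pd j (\<lambda>y. E y $ i $ b) x) - (\<Sum>j\<in>UNIV. E x $ j $ b * pd j (\<lambda>y. E y $ i $ a) x)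
      = (\<Sum>c\<in>UNIV. E x $ i $ c * ?C a b c)" for a b
  proof -
    let ?L = "lie3 (\<lambda>y. column a (E y)) (\<lambda>y. column b (E y)) x"
    have "(\<Sum>c\<in>UNIV. E x $ i $ c * ?C a b c) = (E x *v (\<theta> x *v ?L)) $ i"
      by (simp only: structure_coeff_def matrix_vector_nth)
    also have "E x *v (\<theta> x *v ?L) = ?L"
      by (simp add: matrix_vector_mul_assoc E_theta[OF x])
    finally show ?thesis by (simp add: lie3_def column_def sum_subtractf)
  qed
  have "(transpose (E x) ** M ** E x) $ a $ b = 0" for a b
  proof -
    have "(transpose (E x) ** M ** E x) $ a $ b =
        (\<Sum>j\<in>UNIV. E x $ j $ a * (\<Sum>k\<in>UNIV. conn_mat E \<nu> j x $ i $ k * E x $ k $ b))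
      - (\<Sum>j\<in>UNIV. E x $ j $ b * (\<Sum>k\<in>UNIV. conn_mat E \<nu> j x $ i $ k * E x $ k $ a))"
    proof -
      have "(transpose (E x) ** M ** E x) $ a $ b
         = (\<Sum>k\<in>UNIV. (\<Sum>j\<in>UNIV. E x $ j $ a * M $ j $ k) * E x $ k $ b)"
        by (simp only: matrix_mul_nth transpose_nth)
      then show ?thesis
        unfolding M_def frame_conn_def vec_lambda_beta sum_3 by algebra
    qed
    also have "\<dots> = (\<Sum>c\<in>UNIV. E x $ i $ c * (W a $ c $ b - W b $ c $ a - ?C a b c))"
      unfolding one right_diff_distrib sum_subtractf lie[of a b, symmetric] by algebra
    also have "\<dots> = 0"
      unfolding W_def using spin_torsion[of ?C, OF structure_coeff_antisym] by simp
    finally show ?thesis .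
  qed
  then have "transpose (E x) ** M ** E x = 0" unfolding vec_eq_iff zero_index by blast
  then have "M = 0" by (rule congruence_eq_0[OF inv[OF x]])
  then have "M $ j $ k = 0" by simp
  then show ?thesis unfolding M_def by simp
qed

lemma holo_gram_metric: "holo_mat (gram_metric E) S"
  unfolding gram_metric_def
  by (intro holo_mat_mult holo_mat_transpose holo_theta holo_mat_const)

lemma gram_metric_gram: "x \<in> S \<Longrightarrow> transpose (E x) ** gram_metric E x ** E x = null_gram"
proof -
  assume x: "x \<in> S"
  have "transpose (E x) ** gram_metric E x ** E x
     = transpose (\<theta> x ** E x) ** null_gram ** (\<theta> x ** E x)"
    unfolding gram_metric_def matrix_transpose_mul by (simp only: matrix_mul_assoc)
  then show ?thesis by (simp add: theta_E[OF x] transpose_mat)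
qed

text \<open>
  Differentiation of the constant Gram matrix $E^T h E$ and substitution of
  $\partial_i E = E \omega_i - \Gamma_i E$ reduce the claim to \<open>co_mat_conformal\<close>.
\<close>

lemma frame_conn_metric:
  assumes x: "x \<in> S"
  shows "pdm i (gram_metric E) x - transpose (conn_mat E \<nu> i x) ** gram_metric E x
     - gram_metric E x ** conn_mat E \<nu> i x = (\<chi> j k. \<nu> x $ i * gram_metric E x $ j $ k)"
proof -
  let ?h = "gram_metric E x"
  let ?\<omega> = "conn_form E \<nu> i x"
  define N :: "complex^3^3" where "N = (\<chi> j k. \<nu> x $ i * ?h $ j $ k)"
  define M where "M = pdm i (gram_metric E) x - transpose (conn_mat E \<nu> i x) ** ?h - ?h ** conn_mat E \<nu> i x - N"
  have "pdm i (\<lambda>y. transpose (E y) ** gram_metric E y ** E y) x = pdm i (\<lambda>_. null_gram) x"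
    by (rule pdm_cong[OF _ S x])
      (intro holo_mat_mult holo_mat_transpose E holo_gram_metric, simp add: gram_metric_gram)
  then have d: "transpose (pdm i E x) ** ?h ** E x + transpose (E x) ** pdm i (gram_metric E) x ** E x
     + transpose (E x) ** ?h ** pdm i E x = 0"
    by (simp add: pdm_mult[OF holo_mat_mult[OF holo_mat_transpose[OF E] holo_gram_metric] E x]
        pdm_mult[OF holo_mat_transpose[OF E] holo_gram_metric x] pdm_transpose matrix_add_rdistrib)
  have c1: "transpose (E x) ** ?h ** conn_mat E \<nu> i x ** E x =
     null_gram ** ?\<omega> - transpose (E x) ** ?h ** pdm i E x"
  proof -
    have "transpose (E x) ** ?h ** conn_mat E \<nu> i x ** E x
       = transpose (E x) ** ?h ** (E x ** ?\<omega> - pdm i E x)"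
      unfolding conn_mat_E[OF x, symmetric] by (simp only: matrix_mul_assoc)
    then show ?thesis
      unfolding matrix_diff_ldistrib matrix_mul_assoc gram_metric_gram[OF x] .
  qed
  have c2: "transpose (E x) ** transpose (conn_mat E \<nu> i x) ** ?h ** E x =
     transpose ?\<omega> ** null_gram - transpose (pdm i E x) ** ?h ** E x"
  proof -
    have t: "transpose (A - B) = transpose A - transpose B" for A B :: "complex^3^3"
      by (simp add: vec_eq_iff transpose_nth)
    have "transpose (E x) ** transpose (conn_mat E \<nu> i x) = transpose ?\<omega> ** transpose (E x) - transpose (pdm i E x)"
      unfolding matrix_transpose_mul[symmetric] conn_mat_E[OF x] by (rule t)
    then show ?thesis
      by (simp add: matrix_diff_rdistrib) (metis gram_metric_gram[OF x] matrix_mul_assoc)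
  qed
  have c3: "transpose (E x) ** N ** E x = (\<chi> j k. \<nu> x $ i * null_gram $ j $ k)"
  proof -
    have "transpose (E x) ** N ** E x = (\<chi> j k. \<nu> x $ i * (transpose (E x) ** ?h ** E x) $ j $ k)"
      by (simp add: vec_eq_iff matrix_mul_nth N_def sum_3 algebra_simps)
    then show ?thesis unfolding gram_metric_gram[OF x] .
  qed
  have "transpose (E x) ** M ** E x = transpose (E x) ** pdm i (gram_metric E) x ** E x
      - transpose (E x) ** transpose (conn_mat E \<nu> i x) ** ?h ** E x
      - transpose (E x) ** ?h ** conn_mat E \<nu> i x ** E x - transpose (E x) ** N ** E x"
    unfolding M_def matrix_diff_ldistrib matrix_diff_rdistrib by (simp only: matrix_mul_assoc)
  also have "\<dots> = - (transpose ?\<omega> ** null_gram + null_gram ** ?\<omega>) - (\<chi> j k. \<nu> x $ i * null_gram $ j $ k)"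
    unfolding c1 c2 c3 using d by (simp add: algebra_simps eq_neg_iff_add_eq_0)
  also have "\<dots> = 0"
    unfolding conn_form_def co_mat_conformal by (simp add: vec_eq_iff)
  finally have "M = 0" by (rule congruence_eq_0[OF inv[OF x]])
  then show ?thesis unfolding M_def N_def by simp
qed

lemma weyl_connection_frame_conn: "weyl_connection_on S (gram_metric E) \<nu> (frame_conn E \<nu>)"
  unfolding weyl_connection_on_def
proof (intro conjI ballI allI)
  fix x i j k assume x: "x \<in> S"
  show "frame_conn E \<nu> i j k x = frame_conn E \<nu> i k j x" by (rule frame_conn_sym[OF x])
  show "pd i (\<lambda>y. gram_metric E y $ j $ k) x
     - (\<Sum>l\<in>UNIV. frame_conn E \<nu> l i j x * gram_metric E x $ l $ k)
     - (\<Sum>l\<in>UNIV. frame_conn E \<nu> l i k x * gram_metric E x $ j $ l) = \<nu> x $ i * gram_metric E x $ j $ k"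
    using arg_cong[OF frame_conn_metric[OF x, of i], of "\<lambda>M. M $ j $ k"]
    by (simp add: matrix_mul_nth transpose_nth frame_conn_def mult.commute)
qed

end

text \<open>
  Koszul's argument: the difference of two such connections, with its upper index lowered, is
  symmetric in the first two indices and antisymmetric in the last two, hence zero.
\<close>

lemma weyl_connection_unique:
  assumes "weyl_connection_on S h \<nu> \<Gamma>" "weyl_connection_on S h \<nu> \<Gamma>'" and x: "x \<in> S"
    and h: "invertible (h x)" "transpose (h x) = h x"
  shows "\<Gamma> i j k x = \<Gamma>' i j k x"
proof -
  define K where "K i j k = (\<Sum>l\<in>UNIV. (\<Gamma> l i j x - \<Gamma>' l i j x) * h x $ l $ k)" for i j k
  have hs: "h x $ j $ l = h x $ l $ j" for j l
    using h(2) by (metis transpose_nth)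
  have sym: "K i j k = K j i k" for i j k
  proof -
    have "\<Gamma> l i j x = \<Gamma> l j i x" "\<Gamma>' l i j x = \<Gamma>' l j i x" for l
      using assms(1,2) x unfolding weyl_connection_on_def by blast+
    then show ?thesis by (simp add: K_def)
  qed
  have anti: "K i j k = - K i k j" for i j k
  proof -
    have "pd i (\<lambda>y. h y $ j $ k) x - (\<Sum>l\<in>UNIV. \<Gamma> l i j x * h x $ l $ k)
          - (\<Sum>l\<in>UNIV. \<Gamma> l i k x * h x $ j $ l) =
         pd i (\<lambda>y. h y $ j $ k) x - (\<Sum>l\<in>UNIV. \<Gamma>' l i j x * h x $ l $ k)
          - (\<Sum>l\<in>UNIV. \<Gamma>' l i k x * h x $ j $ l)"
      using assms(1,2) x unfolding weyl_connection_on_def by presburger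
    then show ?thesis
      unfolding K_def by (simp add: left_diff_distrib sum_subtractf hs[of j]) (simp add: algebra_simps)
  qed
  have K0: "K i j k = 0" for i j k
    using sym[of i j k] anti[of j i k] sym[of j k i] anti[of k j i] sym[of k i j] anti[of i k j] by simp
  define d where "d = (\<chi> a. \<Gamma> a j k x - \<Gamma>' a j k x)"
  have "d v* h x = 0"
    using K0[of j k] unfolding vec_eq_iff vector_matrix_mult_def K_def d_def
    by (simp only: vec_lambda_beta zero_index mult.commute) simp
  then have "d v* (h x ** matrix_inv (h x)) = 0"
    by (metis vector_matrix_mul_assoc vector_matrix_mult_0)
  then have "d = 0" by (simp add: matrix_inv_right[OF h(1)])
  then show ?thesis by (simp add: d_def vec_eq_iff)
qed


section \<open>Curvature\<close>

definition curv :: "(3 \<Rightarrow> complex^3 \<Rightarrow> complex^3^3) \<Rightarrow> 3 \<Rightarrow> 3 \<Rightarrow> complex^3 \<Rightarrow> complex^3^3" where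
  "curv A i j x = pdm i (A j) x - pdm j (A i) x + A i x ** A j x - A j x ** A i x"

lemma ricci_conn_mat:
  "ricci (frame_conn E \<nu>) x j k = (\<Sum>i\<in>UNIV. curv (conn_mat E \<nu>) i j x $ i $ k)"
  unfolding ricci_def curv_def frame_conn_def
  by (simp add: matrix_mul_nth sum_subtractf frame_conn_def add_diff_eq)

lemma pd_cmult: "holo_on F S \<Longrightarrow> x \<in> S \<Longrightarrow> pd i (\<lambda>y. c * F y) x = c * pd i F x"
  using pd_mult[OF holo_on_const, of F S x i c] by simp

lemma pd_div_const: "holo_on F S \<Longrightarrow> x \<in> S \<Longrightarrow> pd i (\<lambda>y. F y / c) x = pd i F x / c"
  using pd_cmult[of F S x i "1 / c"] by simp

lemma holo_div_const: "holo_on F S \<Longrightarrow> holo_on (\<lambda>y. F y / c) S"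
  using holo_on_mult[OF holo_on_const[of "1 / c"], of F S] by simp

lemma co_mat_commutator:
  "co_mat n p q r ** co_mat n' p' q' r' - co_mat n' p' q' r' ** co_mat n p q r =
   co_mat 0 (2 * (r * q' - q * r')) (q * p' - p * q') (p * r' - r * p')"
  unfolding vec_eq_iff forall_3 by (simp add: matrix_mul_nth sum_3 co_mat_def) (simp add: algebra_simps)

lemma co_mat_add: "co_mat n p q r + co_mat n' p' q' r' = co_mat (n + n') (p + p') (q + q') (r + r')"
  and co_mat_diff: "co_mat n p q r - co_mat n' p' q' r' = co_mat (n - n') (p - p') (q - q') (r - r')"
  unfolding vec_eq_iff forall_3 by (simp_all add: co_mat_def field_simps)

lemma co_mat_contract2:
  "(\<Sum>i\<in>UNIV. \<Sum>j\<in>UNIV. c i j * co_mat (n i j) (p i j) (q i j) (r i j) $ a $ b) =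
   co_mat (\<Sum>i\<in>UNIV. \<Sum>j\<in>UNIV. c i j * n i j) (\<Sum>i\<in>UNIV. \<Sum>j\<in>UNIV. c i j * p i j)
     (\<Sum>i\<in>UNIV. \<Sum>j\<in>UNIV. c i j * q i j) (\<Sum>i\<in>UNIV. \<Sum>j\<in>UNIV. c i j * r i j) $ a $ b"
  by (simp only: co_mat_contract co_mat_contract[where c = "\<lambda>_. 1", unfolded mult_1])

text \<open>
  The coefficients in the frame of $n_s = V_1 - 2 s V_2 + s^2 V_3$, the null normal of the null plane
  spanned by $V_1 - s V_2$ and $V_2 - s V_3$. The directions $n_s$ fill the null cone up to the one at
  $s = \infty$.
\<close>

definition null_dir :: "complex \<Rightarrow> complex^3" where
  "null_dir s = vector [1, - 2 * s, s\<^sup>2]"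

definition ricci_quadratic :: "conn \<Rightarrow> complex^3 \<Rightarrow> complex^3 \<Rightarrow> complex" where
  "ricci_quadratic \<Gamma> x n = (\<Sum>j\<in>UNIV. \<Sum>k\<in>UNIV. n $ j * n $ k * ricci \<Gamma> x j k)"

context weyl_frame
begin

abbreviation "P i \<equiv> \<lambda>x. form_p E \<nu> x $ i"
abbreviation "Q i \<equiv> \<lambda>x. form_q E \<nu> x $ i"
abbreviation "R i \<equiv> \<lambda>x. form_r E \<nu> x $ i"

definition curv_n where "curv_n x i j = pd i (\<lambda>y. \<nu> y $ j) x - pd j (\<lambda>y. \<nu> y $ i) x"
definition curv_p where "curv_p x i j = pd i (P j) x - pd j (P i) x + 2 * (R i x * Q j x - Q i x * R j x)"
definition curv_q where "curv_q x i j = pd i (Q j) x - pd j (Q i) x + (Q i x * P j x - P i x * Q j x)"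
definition curv_r where "curv_r x i j = pd i (R j) x - pd j (R i) x + (P i x * R j x - R i x * P j x)"

lemma pdm_conn_form:
  assumes x: "x \<in> S"
  shows "pdm i (conn_form E \<nu> j) x = co_mat (pd i (\<lambda>y. \<nu> y $ j) x) (pd i (P j) x) (pd i (Q j) x) (pd i (R j) x)"
  unfolding vec_eq_iff forall_3 pdm_nth conn_form_def co_mat_def
  by (simp add: pd_diff[OF _ _ x] pd_uminus[OF _ x] pd_cmult[OF _ x] pd_div_const[OF _ x]
      holo_forms holo_on_uminus holo_div_const holo_on_diff)

text \<open>
  The curvature of a connection with values in the conformal Lie algebra again has values there;
  \<open>curv_n\<close>, \<open>curv_p\<close>, \<open>curv_q\<close>, \<open>curv_r\<close> are its components.
\<close>

lemma curv_conn_form: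
  assumes x: "x \<in> S"
  shows "curv (conn_form E \<nu>) i j x = co_mat (curv_n x i j) (curv_p x i j) (curv_q x i j) (curv_r x i j)"
proof -
  have "curv (conn_form E \<nu>) i j x = (pdm i (conn_form E \<nu> j) x - pdm j (conn_form E \<nu> i) x)
      + (conn_form E \<nu> i x ** conn_form E \<nu> j x - conn_form E \<nu> j x ** conn_form E \<nu> i x)"
    by (simp add: curv_def)
  then show ?thesis
    unfolding pdm_conn_form[OF x] co_mat_diff
    unfolding conn_form_def co_mat_commutator co_mat_add curv_n_def curv_p_def curv_q_def curv_r_def
    by simp
qed

text \<open>
  Curvature transforms tensorially between the frame and the coordinates. This is the commutation
  of second derivatives of \<open>E\<close>, rewritten with $\partial_i E = E \omega_i - \Gamma_i E$.
\<close>

lemma curv_gauge: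
  assumes x: "x \<in> S"
  shows "E x ** curv (conn_form E \<nu>) i j x = curv (conn_mat E \<nu>) i j x ** E x"
proof -
  let ?w = "conn_form E \<nu>" and ?G = "conn_mat E \<nu>"
  have two: "pdm i (pdm j E) x = (E x ** ?w i x - ?G i x ** E x) ** ?w j x + E x ** pdm i (?w j) x
       - (pdm i (?G j) x ** E x + ?G j x ** (E x ** ?w i x - ?G i x ** E x))" for i j
  proof -
    have "pdm i (pdm j E) x = pdm i (\<lambda>y. E y ** ?w j y - ?G j y ** E y) x"
      by (rule pdm_cong[OF holo_mat_pdm[OF E S] S x pdm_E])
    also have "\<dots> = pdm i E x ** ?w j x + E x ** pdm i (?w j) x
        - (pdm i (?G j) x ** E x + ?G j x ** pdm i E x)"
      by (simp add: pdm_diff[OF holo_mat_mult[OF E holo_conn_form] holo_mat_mult[OF holo_conn_mat E] x]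
          pdm_mult[OF E holo_conn_form x] pdm_mult[OF holo_conn_mat E x])
    finally show ?thesis unfolding pdm_E[OF x] .
  qed
  have "(E x ** ?w i x - ?G i x ** E x) ** ?w j x + E x ** pdm i (?w j) x
       - (pdm i (?G j) x ** E x + ?G j x ** (E x ** ?w i x - ?G i x ** E x))
     = (E x ** ?w j x - ?G j x ** E x) ** ?w i x + E x ** pdm j (?w i) x
       - (pdm j (?G i) x ** E x + ?G i x ** (E x ** ?w j x - ?G j x ** E x))"
    unfolding two[symmetric] by (rule pdm_commute[OF E S x])
  then show ?thesis
    unfolding curv_def matrix_diff_ldistrib matrix_diff_rdistrib matrix_add_ldistrib
      matrix_add_rdistrib matrix_mul_assoc
    by (simp add: algebra_simps)
qed

definition frame2 :: "(3 \<Rightarrow> 3 \<Rightarrow> complex) \<Rightarrow> complex^3 \<Rightarrow> 3 \<Rightarrow> 3 \<Rightarrow> complex" where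
  "frame2 T x a b = (\<Sum>i\<in>UNIV. \<Sum>j\<in>UNIV. E x $ i $ a * E x $ j $ b * T i j)"

lemma frame2_antisym:
  assumes "\<And>i j. T i j = - T j i"
  shows "frame2 T x a b = - frame2 T x b a"
proof -
  have "frame2 T x b a = (\<Sum>j\<in>UNIV. \<Sum>i\<in>UNIV. E x $ i $ b * E x $ j $ a * T i j)"
    unfolding frame2_def by (rule sum.swap)
  also have "\<dots> = (\<Sum>j\<in>UNIV. \<Sum>i\<in>UNIV. - (E x $ j $ a * E x $ i $ b * T j i))"
    by (intro sum.cong refl) (subst assms, simp)
  finally show ?thesis by (simp add: frame2_def sum_negf)
qed

lemma frame2_bilinear:
  "(\<Sum>i\<in>UNIV. \<Sum>j\<in>UNIV. (E x *v u) $ i * (E x *v w) $ j * T i j)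
    = (\<Sum>a\<in>UNIV. \<Sum>b\<in>UNIV. u $ a * w $ b * frame2 T x a b)"
  unfolding frame2_def matrix_vector_nth sum_3 by algebra

lemma curv_antisym: "curv_n x i j = - curv_n x j i" "curv_p x i j = - curv_p x j i"
  "curv_q x i j = - curv_q x j i" "curv_r x i j = - curv_r x j i"
  by (simp_all add: curv_n_def curv_p_def curv_q_def curv_r_def algebra_simps)

text \<open>
  The curvature of the lift to the bundle of null planes. For a fixed value \<open>s\<close> of the spectral
  parameter it combines the components of the curvature in the same way in which \<open>spin_form\<close>
  combines the connection forms; \<open>lax_defect\<close> is its value on the null plane of \<open>s\<close>.
\<close>

definition spin_curv :: "complex \<Rightarrow> complex^3 \<Rightarrow> 3 \<Rightarrow> 3 \<Rightarrow> complex" where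
  "spin_curv s x i j = curv_q x i j + s * curv_p x i j - s\<^sup>2 * curv_r x i j"

definition lax_defect :: "complex^3 \<Rightarrow> complex \<Rightarrow> complex" where
  "lax_defect x s = (\<Sum>i\<in>UNIV. \<Sum>j\<in>UNIV. (E x *v vector [1, - s, 0]) $ i * (E x *v vector [0, 1, - s]) $ j
      * spin_curv s x i j)"

lemma frame2_spin_curv:
  "frame2 (spin_curv s x) x a b = frame2 (curv_q x) x a b + s * frame2 (curv_p x) x a b
     - s\<^sup>2 * frame2 (curv_r x) x a b"
  unfolding frame2_def spin_curv_def
  by (simp add: sum_distrib_left sum.distrib sum_subtractf algebra_simps)

lemma lax_defect_frame:
  "lax_defect x s = (\<Sum>a\<in>UNIV. \<Sum>b\<in>UNIV. vector [1, - s, 0] $ a * vector [0, 1, - s] $ b *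
     (frame2 (curv_q x) x a b + s * frame2 (curv_p x) x a b - s\<^sup>2 * frame2 (curv_r x) x a b))"
  unfolding lax_defect_def frame2_bilinear frame2_spin_curv ..

lemma ricci_quadratic_frame:
  assumes x: "x \<in> S"
  shows "ricci_quadratic (frame_conn E \<nu>) x (E x *v u) =
    (\<Sum>a\<in>UNIV. \<Sum>b\<in>UNIV. u $ b * (\<Sum>d\<in>UNIV. co_mat (frame2 (curv_n x) x a b) (frame2 (curv_p x) x a b)
        (frame2 (curv_q x) x a b) (frame2 (curv_r x) x a b) $ a $ d * u $ d))"
proof -
  let ?K = "\<lambda>i j. co_mat (curv_n x i j) (curv_p x i j) (curv_q x i j) (curv_r x i j)"
  let ?n = "E x *v u"
  have 1: "(\<Sum>k\<in>UNIV. curv (conn_mat E \<nu>) i j x $ i $ k * ?n $ k)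
     = (\<Sum>a\<in>UNIV. E x $ i $ a * (?K i j *v u) $ a)" for i j
  proof -
    have "(\<Sum>k\<in>UNIV. curv (conn_mat E \<nu>) i j x $ i $ k * ?n $ k) = (curv (conn_mat E \<nu>) i j x *v (E x *v u)) $ i"
      by (simp only: matrix_vector_nth)
    also have "curv (conn_mat E \<nu>) i j x *v (E x *v u) = E x *v (?K i j *v u)"
      by (simp only: matrix_vector_mul_assoc curv_gauge[OF x, symmetric] curv_conn_form[OF x])
    finally show ?thesis by (simp only: matrix_vector_nth)
  qed
  have "ricci_quadratic (frame_conn E \<nu>) x ?n
     = (\<Sum>j\<in>UNIV. \<Sum>i\<in>UNIV. ?n $ j * (\<Sum>k\<in>UNIV. curv (conn_mat E \<nu>) i j x $ i $ k * ?n $ k))"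
    unfolding ricci_quadratic_def ricci_conn_mat
    by (simp only: sum_3) algebra
  also have "\<dots> = (\<Sum>j\<in>UNIV. \<Sum>i\<in>UNIV. (\<Sum>b\<in>UNIV. E x $ j $ b * u $ b) * (\<Sum>a\<in>UNIV. E x $ i $ a * (?K i j *v u) $ a))"
    unfolding 1 by (simp only: matrix_vector_nth[of "E x" u])
  also have "\<dots> = (\<Sum>a\<in>UNIV. \<Sum>b\<in>UNIV. u $ b * (\<Sum>i\<in>UNIV. \<Sum>j\<in>UNIV. E x $ i $ a * E x $ j $ b * (?K i j *v u) $ a))"
    by (simp only: sum_3) algebra
  also have "\<dots> = (\<Sum>a\<in>UNIV. \<Sum>b\<in>UNIV. u $ b * (\<Sum>d\<in>UNIV. (\<Sum>i\<in>UNIV. \<Sum>j\<in>UNIV. E x $ i $ a * E x $ j $ b * ?K i j $ a $ d) * u $ d))"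
    unfolding matrix_vector_nth by (simp only: sum_3) algebra
  also have "\<dots> = (\<Sum>a\<in>UNIV. \<Sum>b\<in>UNIV. u $ b * (\<Sum>d\<in>UNIV. co_mat (frame2 (curv_n x) x a b) (frame2 (curv_p x) x a b)
        (frame2 (curv_q x) x a b) (frame2 (curv_r x) x a b) $ a $ d * u $ d))"
    by (simp only: co_mat_contract2 frame2_def)
  finally show ?thesis .
qed

text \<open>
  The identity that links the two sides of the theorem. Both are linear in the curvature components
  with respect to the frame: the Ricci form is the trace of $X \mapsto R(X, n_s) n_s$, in which the antisymmetry
  of the curvature and its special shape leave only the part acting on the null plane of \<open>s\<close>.
\<close>

lemma ricci_null_eq_defect:
  assumes x: "x \<in> S"
  shows "ricci_quadratic (frame_conn E \<nu>) x (E x *v null_dir s) = - 2 * lax_defect x s"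
proof -
  have anti: "frame2 (curv_n x) x a b = - frame2 (curv_n x) x b a"
    "frame2 (curv_p x) x a b = - frame2 (curv_p x) x b a"
    "frame2 (curv_q x) x a b = - frame2 (curv_q x) x b a"
    "frame2 (curv_r x) x a b = - frame2 (curv_r x) x b a" for a b
    by (rule frame2_antisym, rule curv_antisym)+
  have diag: "frame2 (curv_n x) x a a = 0" "frame2 (curv_p x) x a a = 0"
    "frame2 (curv_q x) x a a = 0" "frame2 (curv_r x) x a a = 0" for a
    using anti[of a a] by simp_all
  note flip = anti[of 2 1] anti[of 3 1] anti[of 3 2]
  show ?thesis
    unfolding ricci_quadratic_frame[OF x] lax_defect_frame
      null_dir_def co_mat_def sum_3 vector_3
    by (simp add: diag flip) (simp add: algebra_simps power2_eq_square)
qed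

end

section \<open>The Lax pair in a chart\<close>

definition lax_field :: "(complex^3 \<Rightarrow> complex^3) \<Rightarrow> (complex^3 \<Rightarrow> complex^3) \<Rightarrow>
   ((complex^3) \<times> complex \<Rightarrow> complex) \<Rightarrow> (complex^3) \<times> complex \<Rightarrow> (complex^3) \<times> complex" where
  "lax_field X Y g = (\<lambda>(y, l). (X y - l *s Y y, g (y, l)))"

text \<open>
  The derivative of $(x, s) \mapsto X - s Y$ in the direction \<open>(u, w)\<close>.
\<close>

definition pencil_deriv where
  "pencil_deriv X Y x s u w = (\<chi> i. (\<Sum>j\<in>UNIV. u $ j * (pd j (\<lambda>y. X y $ i) x - s * pd j (\<lambda>y. Y y $ i) x)) - w * Y x $ i)"

lemma has_derivative_fst_comp:
  assumes "holo_on F S" "x \<in> S"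
  shows "((\<lambda>p. F (fst p)) has_derivative (\<lambda>p. \<Sum>j\<in>UNIV. pd j F x * fst p $ j)) (at (x, s))"
proof -
  have "(fst has_derivative fst) (at (x, s))"
    by (rule bounded_linear_imp_has_derivative[OF bounded_linear_fst])
  from has_derivative_compose[OF this] holo_on_has_partials[OF assms, unfolded has_partials_def]
  show ?thesis by simp
qed

lemma has_derivative_snd': "((\<lambda>p. snd p) has_derivative (\<lambda>p. snd p)) (at z)"
  by (rule bounded_linear_imp_has_derivative[OF bounded_linear_snd])

lemma has_derivative_pencil:
  assumes X: "holo_vec X S" and Y: "holo_vec Y S" and x: "x \<in> S"
  shows "((\<lambda>p. (X (fst p) - snd p *s Y (fst p)) $ i) has_derivative
     (\<lambda>p. pencil_deriv X Y x s (fst p) (snd p) $ i)) (at (x, s))"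
proof -
  have h: "holo_on (\<lambda>y. X y $ i) S" "holo_on (\<lambda>y. Y y $ i) S" using X Y by (auto simp: holo_vec_def)
  have "((\<lambda>p. X (fst p) $ i - snd p * Y (fst p) $ i) has_derivative
     (\<lambda>p. (\<Sum>j\<in>UNIV. pd j (\<lambda>y. X y $ i) x * fst p $ j) -
        (s * (\<Sum>j\<in>UNIV. pd j (\<lambda>y. Y y $ i) x * fst p $ j) + snd p * Y x $ i))) (at (x, s))"
    using has_derivative_diff[OF has_derivative_fst_comp[OF h(1) x]
        has_derivative_mult[OF has_derivative_snd' has_derivative_fst_comp[OF h(2) x]]] by simp
  then show ?thesis
    by (auto elim!: has_derivative_eq_rhs
        simp: pencil_deriv_def fun_eq_iff sum_distrib_left sum_subtractf algebra_simps)
qed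

lemma has_derivative_lax_field:
  assumes X: "holo_vec X S" and Y: "holo_vec Y S" and x: "x \<in> S"
    and g: "(g has_derivative g') (at (x, s))"
  shows "(lax_field X Y g has_derivative (\<lambda>p. (pencil_deriv X Y x s (fst p) (snd p), g' p))) (at (x, s))"
  unfolding lax_field_def split_def
  by (intro has_derivative_Pair has_derivative_componentwise_vec has_derivative_pencil[OF X Y x])
    (use g in simp)

lemma lie_bracket_lax_field:
  assumes h: "holo_vec X S" "holo_vec Y S" "holo_vec Z S" and x: "x \<in> S"
    and g: "(g0 has_derivative g0') (at (x, s))" "(g1 has_derivative g1') (at (x, s))"
  shows "lie_bracket (lax_field X Y g0) (lax_field Y Z g1) (x, s) =
    (lie3 X Y x - s *s lie3 X Z x + s\<^sup>2 *s lie3 Y Z x - g0 (x, s) *s Z x + g1 (x, s) *s Y x,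
     g1' (X x - s *s Y x, g0 (x, s)) - g0' (Y x - s *s Z x, g1 (x, s)))"
proof -
  have "lie_bracket (lax_field X Y g0) (lax_field Y Z g1) (x, s) =
    (pencil_deriv Y Z x s (X x - s *s Y x) (g0 (x, s)) - pencil_deriv X Y x s (Y x - s *s Z x) (g1 (x, s)),
     g1' (X x - s *s Y x, g0 (x, s)) - g0' (Y x - s *s Z x, g1 (x, s)))"
    unfolding lie_bracket_def
      frechet_derivative_at[OF has_derivative_lax_field[OF h(1,2) x g(1)], symmetric]
      frechet_derivative_at[OF has_derivative_lax_field[OF h(2,3) x g(2)], symmetric]
    by (simp add: lax_field_def)
  moreover have "pencil_deriv Y Z x s (X x - s *s Y x) c - pencil_deriv X Y x s (Y x - s *s Z x) d
    = lie3 X Y x - s *s lie3 X Z x + s\<^sup>2 *s lie3 Y Z x - c *s Z x + d *s Y x" for c d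
    by (simp add: vec_eq_iff pencil_deriv_def lie3_def sum_3 power2_eq_square) (simp add: algebra_simps)
  ultimately show ?thesis by simp
qed

text \<open>
  The vertical part of a bracket of two lifts, pointwise: \<open>\<sigma>\<close> are the components of the 1-form that
  prescribes the lift, \<open>\<sigma>'\<close> those of its derivative along the spectral parameter, \<open>d\<close> its
  partial derivatives, and \<open>h1 - h0\<close> is the horizontal part of the bracket. The first sum on the right is
  a curvature, the second the lift of the horizontal part.
\<close>

lemma vertical_identity:
  fixes l0 l1 \<sigma> \<sigma>' :: "3 \<Rightarrow> complex" and d :: "3 \<Rightarrow> 3 \<Rightarrow> complex"
  assumes "g0 = (\<Sum>j\<in>UNIV. l0 j * \<sigma> j)" "g1 = (\<Sum>j\<in>UNIV. l1 j * \<sigma> j)"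
  shows "(\<Sum>j\<in>UNIV. l1 j * ((\<Sum>k\<in>UNIV. d k j * l0 k) + g0 * \<sigma>' j) + h1 j * \<sigma> j)
      - (\<Sum>j\<in>UNIV. l0 j * ((\<Sum>k\<in>UNIV. d k j * l1 k) + g1 * \<sigma>' j) + h0 j * \<sigma> j)
    = (\<Sum>i\<in>UNIV. \<Sum>j\<in>UNIV. l0 i * l1 j * (d i j - d j i + \<sigma> i * \<sigma>' j - \<sigma> j * \<sigma>' i))
      + (\<Sum>j\<in>UNIV. (h1 j - h0 j) * \<sigma> j)"
  unfolding assms sum_3 by algebra

context weyl_frame
begin

abbreviation "V a \<equiv> \<lambda>y. column a (E y)"

lemma holo_column: "holo_vec (V a) S"
  using E by (simp add: holo_vec_def holo_mat_def column_def)

text \<open>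
  The components in the frame of $[V_1 - s V_2, V_2 - s V_3]$ for constant \<open>s\<close>.
\<close>

definition lax_comp :: "complex^3 \<Rightarrow> complex \<Rightarrow> 3 \<Rightarrow> complex" where
  "lax_comp x s c = structure_coeff E x 1 2 c - s * structure_coeff E x 1 3 c + s\<^sup>2 * structure_coeff E x 2 3 c"

lemma E_struct: "x \<in> S \<Longrightarrow> lie3 (V a) (V b) x = E x *v (\<chi> c. structure_coeff E x a b c)"
proof -
  assume x: "x \<in> S"
  have "(\<chi> c. structure_coeff E x a b c) = \<theta> x *v lie3 (V a) (V b) x"
    by (simp add: structure_coeff_def vec_eq_iff)
  then show ?thesis by (simp add: matrix_vector_mul_assoc E_theta[OF x])
qed

lemma E_inj: "x \<in> S \<Longrightarrow> E x *v u = E x *v w \<longleftrightarrow> u = w"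
  using inj_matrix_vector_mult[OF inv] by (auto dest: injD)

lemma pencil_frame:
  "\<alpha> *s (V 1 x - s *s V 2 x) + \<beta> *s (V 2 x - s *s V 3 x) = E x *v vector [\<alpha>, \<beta> - s * \<alpha>, - s * \<beta>]"
  by (simp add: vec_eq_iff matrix_vector_nth sum_3 column_def algebra_simps)

lemma bracket_horizontal:
  assumes x: "x \<in> S"
  shows "lie3 (V 1) (V 2) x - s *s lie3 (V 1) (V 3) x + s\<^sup>2 *s lie3 (V 2) (V 3) x - a *s V 3 x + b *s V 2 x
    = E x *v vector [lax_comp x s 1, lax_comp x s 2 + b, lax_comp x s 3 - a]"
  unfolding E_struct[OF x]
  by (simp add: vec_eq_iff matrix_vector_nth sum_3 column_def lax_comp_def) (simp add: algebra_simps)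

text \<open>
  Splits integrability into a horizontal condition, free of derivatives of the vertical
  components, and a vertical one. The condition on the horizontal part says that it is annihilated by
  $s^2 \theta^1 + s \theta^2 + \theta^3$, the conormal of the null plane; the coefficients on the right of the
  vertical condition are then the only possible ones.
\<close>

lemma bracket_in_span_lax_field:
  assumes x: "x \<in> S"
    and g: "(g0 has_derivative g0') (at (x, s))" "(g1 has_derivative g1') (at (x, s))"
  shows "bracket_in_span (lax_field (V 1) (V 2) g0) (lax_field (V 2) (V 3) g1) (x, s) \<longleftrightarrow>
    lax_comp x s 3 + s * lax_comp x s 2 + s\<^sup>2 * lax_comp x s 1 = g0 (x, s) - s * g1 (x, s) \<and>
    g1' (V 1 x - s *s V 2 x, g0 (x, s)) - g0' (V 2 x - s *s V 3 x, g1 (x, s))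
      = lax_comp x s 1 * g0 (x, s) + (lax_comp x s 2 + g1 (x, s) + s * lax_comp x s 1) * g1 (x, s)"
    (is "_ \<longleftrightarrow> ?H \<and> ?v = ?\<alpha> * _ + ?\<beta> * _")
proof -
  have "bracket_in_span (lax_field (V 1) (V 2) g0) (lax_field (V 2) (V 3) g1) (x, s) \<longleftrightarrow>
    (\<exists>\<alpha> \<beta>. E x *v vector [lax_comp x s 1, lax_comp x s 2 + g1 (x, s), lax_comp x s 3 - g0 (x, s)]
        = E x *v vector [\<alpha>, \<beta> - s * \<alpha>, - s * \<beta>] \<and> ?v = \<alpha> * g0 (x, s) + \<beta> * g1 (x, s))"
    unfolding bracket_in_span_def
      lie_bracket_lax_field[OF holo_column holo_column holo_column x g] bracket_horizontal[OF x]
    unfolding lax_field_def split_conv fst_conv snd_conv pencil_frame prod.inject ..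
  also have "\<dots> \<longleftrightarrow> (\<exists>\<alpha> \<beta>. \<alpha> = ?\<alpha> \<and> \<beta> = ?\<beta> \<and> ?H \<and> ?v = \<alpha> * g0 (x, s) + \<beta> * g1 (x, s))"
  proof (intro ex_cong1)
    fix \<alpha> \<beta>
    have "lax_comp x s 1 = \<alpha> \<and> lax_comp x s 2 + g1 (x, s) = \<beta> - s * \<alpha> \<and> lax_comp x s 3 - g0 (x, s) = - s * \<beta>
      \<longleftrightarrow> \<alpha> = ?\<alpha> \<and> \<beta> = ?\<beta> \<and> ?H"
      by (auto simp: algebra_simps power2_eq_square eq_diff_eq)
    then show "(E x *v vector [lax_comp x s 1, lax_comp x s 2 + g1 (x, s), lax_comp x s 3 - g0 (x, s)]
        = E x *v vector [\<alpha>, \<beta> - s * \<alpha>, - s * \<beta>] \<and> ?v = \<alpha> * g0 (x, s) + \<beta> * g1 (x, s)) \<longleftrightarrow>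
       (\<alpha> = ?\<alpha> \<and> \<beta> = ?\<beta> \<and> ?H \<and> ?v = \<alpha> * g0 (x, s) + \<beta> * g1 (x, s))"
      unfolding E_inj[OF x] unfolding vec_eq_iff forall_3 vector_3 by blast
  qed
  also have "\<dots> \<longleftrightarrow> ?H \<and> ?v = ?\<alpha> * g0 (x, s) + ?\<beta> * g1 (x, s)" by blast
  finally show ?thesis .
qed

text \<open>
  The vertical component of the lift of a coordinate vector to the bundle of null planes: a connection
  with values in the conformal Lie algebra moves the null plane with parameter \<open>s\<close> along the vector field
  $(q + s p - s^2 r)\,\partial_s$ on the projective line. The lift of the vector \<open>V a - s *s V b\<close> of the null
  plane is \<open>lift a b\<close>.
\<close>

definition spin_form :: "complex \<Rightarrow> 3 \<Rightarrow> complex^3 \<Rightarrow> complex" where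
  "spin_form s j y = Q j y + s * P j y - s\<^sup>2 * R j y"

definition lift :: "3 \<Rightarrow> 3 \<Rightarrow> (complex^3) \<times> complex \<Rightarrow> complex" where
  "lift a b = (\<lambda>(y, l). \<Sum>j\<in>UNIV. (V a y - l *s V b y) $ j * spin_form l j y)"

definition spin_form_pd where
  "spin_form_pd s x k j = pd k (Q j) x + s * pd k (P j) x - s\<^sup>2 * pd k (R j) x"

definition spin_form_ds where
  "spin_form_ds s x j = P j x - 2 * s * R j x"

lemma spin_curv_alt:
  "spin_curv s x i j = spin_form_pd s x i j - spin_form_pd s x j i
     + spin_form s i x * spin_form_ds s x j - spin_form s j x * spin_form_ds s x i"
  unfolding spin_curv_def curv_p_def curv_q_def curv_r_def spin_form_pd_def spin_form_ds_def spin_form_def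
  by algebra

lemma has_derivative_spin_form:
  assumes x: "x \<in> S"
  shows "((\<lambda>p. spin_form (snd p) j (fst p)) has_derivative
     (\<lambda>p. (\<Sum>k\<in>UNIV. spin_form_pd s x k j * fst p $ k) + snd p * spin_form_ds s x j)) (at (x, s))"
proof -
  note d = has_derivative_fst_comp[OF holo_forms(1) x] has_derivative_fst_comp[OF holo_forms(2) x]
    has_derivative_fst_comp[OF holo_forms(3) x] has_derivative_snd'
  show ?thesis unfolding spin_form_def power2_eq_square
    by (rule has_derivative_eq_rhs,
        rule has_derivative_diff[OF has_derivative_add[OF d(2) has_derivative_mult[OF d(4) d(1)]]
          has_derivative_mult[OF has_derivative_mult[OF d(4) d(4)] d(3)]])
      (simp add: fun_eq_iff spin_form_pd_def spin_form_ds_def sum_3 algebra_simps power2_eq_square)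
qed

lemma has_derivative_lift:
  assumes x: "x \<in> S"
  shows "(lift a b has_derivative (\<lambda>p. \<Sum>j\<in>UNIV.
       (V a x - s *s V b x) $ j * ((\<Sum>k\<in>UNIV. spin_form_pd s x k j * fst p $ k) + snd p * spin_form_ds s x j)
        + pencil_deriv (V a) (V b) x s (fst p) (snd p) $ j * spin_form s j x)) (at (x, s))"
  unfolding lift_def split_def
  by (rule has_derivative_eq_rhs, rule has_derivative_sum,
      rule has_derivative_mult[OF has_derivative_pencil[OF holo_column holo_column x] has_derivative_spin_form[OF x]])
    simp

definition spin_poly :: "complex \<Rightarrow> complex^3 \<Rightarrow> 3 \<Rightarrow> complex" where
  "spin_poly s x a = spin_q (structure_coeff E x) (frame_comp E \<nu> x) $ a
     + s * spin_p (structure_coeff E x) (frame_comp E \<nu> x) $ a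
     - s\<^sup>2 * spin_r (structure_coeff E x) (frame_comp E \<nu> x) $ a"

lemma spin_form_frame:
  assumes x: "x \<in> S"
  shows "(\<Sum>j\<in>UNIV. V a x $ j * spin_form s j x) = spin_poly s x a"
proof -
  have "(\<Sum>j\<in>UNIV. V a x $ j * spin_form s j x) = (\<Sum>j\<in>UNIV. E x $ j $ a * Q j x)
      + s * (\<Sum>j\<in>UNIV. E x $ j $ a * P j x) - s\<^sup>2 * (\<Sum>j\<in>UNIV. E x $ j $ a * R j x)"
    by (simp add: spin_form_def column_def sum_3 algebra_simps)
  then show ?thesis
    unfolding form_p_def form_q_def form_r_def frame_oneform_contract[OF x] spin_poly_def .
qed

lemma lift_frame:
  assumes x: "x \<in> S"
  shows "lift a b (x, s) = spin_poly s x a - s * spin_poly s x b"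
proof -
  have "lift a b (x, s) = (\<Sum>j\<in>UNIV. V a x $ j * spin_form s j x) - s * (\<Sum>j\<in>UNIV. V b x $ j * spin_form s j x)"
    by (simp add: lift_def sum_3 algebra_simps)
  then show ?thesis unfolding spin_form_frame[OF x] .
qed

text \<open>
  The lift of a torsion-free connection meets the horizontal condition of
  \<open>bracket_in_span_lax_field\<close>.
\<close>

lemma lift_horizontal:
  assumes x: "x \<in> S"
  shows "lax_comp x s 3 + s * lax_comp x s 2 + s\<^sup>2 * lax_comp x s 1 = lift 1 2 (x, s) - s * lift 2 3 (x, s)"
  unfolding lift_frame[OF x] spin_poly_def lax_comp_def spin_p_def spin_q_def spin_r_def
  by (simp add: field_simps power2_eq_square)

text \<open>
  The bracket of the two lifts is the lift of its horizontal part, which lies in the null plane,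
  plus the vertical defect; so it lies in the span exactly where the defect vanishes.
\<close>

theorem bracket_in_span_lift_iff:
  assumes x: "x \<in> S"
  shows "bracket_in_span (lax_field (V 1) (V 2) (lift 1 2)) (lax_field (V 2) (V 3) (lift 2 3)) (x, s)
    \<longleftrightarrow> ricci_quadratic (frame_conn E \<nu>) x (E x *v null_dir s) = 0"
proof -
  let ?l0 = "V 1 x - s *s V 2 x" and ?l1 = "V 2 x - s *s V 3 x"
  let ?g0 = "lift 1 2 (x, s)" and ?g1 = "lift 2 3 (x, s)"
  let ?\<alpha> = "lax_comp x s 1" and ?\<beta> = "lax_comp x s 2 + ?g1 + s * lax_comp x s 1"
  let ?H1 = "pencil_deriv (V 2) (V 3) x s ?l0 ?g0" and ?H0 = "pencil_deriv (V 1) (V 2) x s ?l1 ?g1"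
  define D where "D a b p = (\<Sum>j\<in>UNIV.
       (V a x - s *s V b x) $ j * ((\<Sum>k\<in>UNIV. spin_form_pd s x k j * fst p $ k) + snd p * spin_form_ds s x j)
        + pencil_deriv (V a) (V b) x s (fst p) (snd p) $ j * spin_form s j x)" for a b p
  have g0: "?g0 = (\<Sum>j\<in>UNIV. ?l0 $ j * spin_form s j x)" and g1: "?g1 = (\<Sum>j\<in>UNIV. ?l1 $ j * spin_form s j x)"
    by (simp_all add: lift_def)
  have ED: "E x *v vector [1, - s, 0] = ?l0" "E x *v vector [0, 1, - s] = ?l1"
    using pencil_frame[of 1 x s 0] pencil_frame[of 0 x s 1] by simp_all
  have vert: "D 2 3 (?l0, ?g0) - D 1 2 (?l1, ?g1)
      = lax_defect x s + (\<Sum>j\<in>UNIV. (?H1 $ j - ?H0 $ j) * spin_form s j x)"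
    unfolding D_def fst_conv snd_conv vertical_identity[OF g0 g1] lax_defect_def ED spin_curv_alt ..
  have hor: "?H1 $ j - ?H0 $ j = (?\<alpha> *s ?l0 + ?\<beta> *s ?l1) $ j" for j
  proof -
    have "lie_bracket (lax_field (V 1) (V 2) (lift 1 2)) (lax_field (V 2) (V 3) (lift 2 3)) (x, s)
      = (?H1 - ?H0, D 2 3 (?l0, ?g0) - D 1 2 (?l1, ?g1))"
      unfolding lie_bracket_def
        frechet_derivative_at[OF has_derivative_lax_field[OF holo_column holo_column x has_derivative_lift[OF x]], symmetric]
      by (simp add: lax_field_def D_def)
    then have "?H1 - ?H0 = E x *v vector [lax_comp x s 1, lax_comp x s 2 + ?g1, lax_comp x s 3 - ?g0]"
      unfolding lie_bracket_lax_field[OF holo_column holo_column holo_column x has_derivative_lift[OF x] has_derivative_lift[OF x]]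
        bracket_horizontal[OF x] by simp
    also have "\<dots> = ?\<alpha> *s ?l0 + ?\<beta> *s ?l1"
      unfolding pencil_frame E_inj[OF x] using lift_horizontal[OF x, of s]
      by (simp add: vec_eq_iff forall_3) algebra
    finally show ?thesis by (metis vector_minus_component)
  qed
  have span: "(\<Sum>j\<in>UNIV. (?\<alpha> *s ?l0 + ?\<beta> *s ?l1) $ j * spin_form s j x) = ?\<alpha> * ?g0 + ?\<beta> * ?g1"
  proof -
    have "(\<Sum>j\<in>UNIV. (a *s u + b *s w) $ j * f j) = a * (\<Sum>j\<in>UNIV. u $ j * f j) + b * (\<Sum>j\<in>UNIV. w $ j * f j)"
      for a b and u w :: "complex^3" and f
      by (simp add: sum_3 algebra_simps)
    from this[of ?\<alpha> ?l0 ?\<beta> ?l1 "\<lambda>j. spin_form s j x"] show ?thesis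
      unfolding g0[symmetric] g1[symmetric] .
  qed
  have "D 2 3 (?l0, ?g0) - D 1 2 (?l1, ?g1) = ?\<alpha> * ?g0 + ?\<beta> * ?g1 \<longleftrightarrow> lax_defect x s = 0"
    unfolding vert hor span by simp
  then show ?thesis
    unfolding bracket_in_span_lax_field[OF x has_derivative_lift[OF x] has_derivative_lift[OF x]]
      D_def ricci_null_eq_defect[OF x]
    using lift_horizontal[OF x] by simp
qed

end


section \<open>The Einstein--Weyl equation in a chart\<close>

lemma quartic_coeffs_zero:
  fixes a b c d e :: complex
  assumes "\<And>s. a + b * s + c * s ^ 2 + d * s ^ 3 + e * s ^ 4 = 0"
  shows "a = 0" "b = 0" "c = 0" "d = 0" "e = 0"
proof -
  have "poly [:a, b, c, d, e:] s = 0" for s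
    using assms[of s] by (simp add: algebra_simps power_def)
  then have "[:a, b, c, d, e:] = 0" using poly_all_0_iff_0 by blast
  then show "a = 0" "b = 0" "c = 0" "d = 0" "e = 0" by simp_all
qed

definition sym_ricci :: "conn \<Rightarrow> complex^3 \<Rightarrow> complex^3^3" where
  "sym_ricci \<Gamma> x = (\<chi> i j. (ricci \<Gamma> x i j + ricci \<Gamma> x j i) / 2)"

lemma quadratic_congruence:
  fixes M E :: "complex^3^3"
  shows "(\<Sum>j\<in>UNIV. \<Sum>k\<in>UNIV. (E *v u) $ j * (E *v u) $ k * M $ j $ k) =
     (\<Sum>a\<in>UNIV. \<Sum>b\<in>UNIV. u $ a * u $ b * (transpose E ** M ** E) $ a $ b)"
  unfolding matrix_vector_nth matrix_mul_nth transpose_nth sum_3 by algebra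

lemma ricci_quadratic_sym:
  "ricci_quadratic \<Gamma> x n = (\<Sum>j\<in>UNIV. \<Sum>k\<in>UNIV. n $ j * n $ k * sym_ricci \<Gamma> x $ j $ k)"
  unfolding ricci_quadratic_def sym_ricci_def by (simp add: sum_3) (simp add: field_simps)

lemma gram_metric_sym: "transpose (gram_metric E x) = gram_metric E x"
proof -
  have "transpose null_gram = null_gram"
    by (simp add: null_gram_def vec_eq_iff forall_3 transpose_nth)
  then show ?thesis
    unfolding gram_metric_def by (simp add: matrix_transpose_mul matrix_mul_assoc)
qed

context weyl_frame
begin

lemma invertible_gram_metric:
  assumes x: "x \<in> S"
  shows "invertible (gram_metric E x)"
proof -
  have "null_gram ** vector [vector [0, 0, - 1 / 2], vector [0, 1, 0], vector [- 1 / 2, 0, 0]] = mat 1"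
    by (simp add: null_gram_def vec_eq_iff forall_3 matrix_mul_nth sum_3 mat_def)
  then have "invertible null_gram" using invertible_right_inverse by blast
  moreover have "invertible (matrix_inv (E x))"
    using theta_E[OF x] invertible_right_inverse by blast
  ultimately show ?thesis
    unfolding gram_metric_def
    by (intro invertible_mult) (metis invertible_def matrix_transpose_mul transpose_mat)+
qed

text \<open>
  A quadratic form is a multiple of the metric iff it vanishes on the null cone. For the implication
  from right to left, its restriction to $n_s$ is a quartic polynomial in \<open>s\<close> whose five coefficients are
  up to constant factors the components of the trace-free part in the frame.
\<close>

lemma einstein_iff_ricci_null:
  assumes x: "x \<in> S"
  shows "(\<exists>\<Lambda>. \<forall>i j. (ricci \<Gamma> x i j + ricci \<Gamma> x j i) / 2 = \<Lambda> * gram_metric E x $ i $ j) \<longleftrightarrow>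
    (\<forall>s. ricci_quadratic \<Gamma> x (E x *v null_dir s) = 0)"
proof
  assume "\<exists>\<Lambda>. \<forall>i j. (ricci \<Gamma> x i j + ricci \<Gamma> x j i) / 2 = \<Lambda> * gram_metric E x $ i $ j"
  then obtain \<Lambda> where L: "\<And>i j. sym_ricci \<Gamma> x $ i $ j = \<Lambda> * gram_metric E x $ i $ j"
    unfolding sym_ricci_def by auto
  show "\<forall>s. ricci_quadratic \<Gamma> x (E x *v null_dir s) = 0"
  proof
    fix s
    let ?n = "E x *v null_dir s"
    have "ricci_quadratic \<Gamma> x ?n = \<Lambda> * (\<Sum>j\<in>UNIV. \<Sum>k\<in>UNIV. ?n $ j * ?n $ k * gram_metric E x $ j $ k)"
      unfolding ricci_quadratic_sym L by (simp add: sum_distrib_left ac_simps)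
    also have "(\<Sum>j\<in>UNIV. \<Sum>k\<in>UNIV. ?n $ j * ?n $ k * gram_metric E x $ j $ k) = 0"
      unfolding quadratic_congruence gram_metric_gram[OF x]
      by (simp add: sum_3 null_gram_def null_dir_def power2_eq_square)
    finally show "ricci_quadratic \<Gamma> x ?n = 0" by simp
  qed
next
  assume *: "\<forall>s. ricci_quadratic \<Gamma> x (E x *v null_dir s) = 0"
  define B where "B = transpose (E x) ** sym_ricci \<Gamma> x ** E x"
  have sym: "B $ a $ b = B $ b $ a" for a b
  proof -
    have "sym_ricci \<Gamma> x = transpose (sym_ricci \<Gamma> x)"
      by (simp add: vec_eq_iff transpose_nth sym_ricci_def add.commute)
    then have "transpose B = B"
      unfolding B_def by (metis matrix_mul_assoc matrix_transpose_mul transpose_transpose)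
    then show ?thesis by (metis transpose_nth)
  qed
  have "B $ 1 $ 1 + (- 4 * B $ 1 $ 2) * s + (4 * B $ 2 $ 2 + 2 * B $ 1 $ 3) * s ^ 2
     + (- 4 * B $ 2 $ 3) * s ^ 3 + B $ 3 $ 3 * s ^ 4 = 0" for s
  proof -
    have "0 = (\<Sum>a\<in>UNIV. \<Sum>b\<in>UNIV. null_dir s $ a * null_dir s $ b * B $ a $ b)"
      using *[rule_format, of s] unfolding ricci_quadratic_sym quadratic_congruence B_def by simp
    also have "\<dots> = B $ 1 $ 1 + (- 4 * B $ 1 $ 2) * s + (4 * B $ 2 $ 2 + 2 * B $ 1 $ 3) * s ^ 2
     + (- 4 * B $ 2 $ 3) * s ^ 3 + B $ 3 $ 3 * s ^ 4"
      unfolding null_dir_def sum_3 vector_3 sym[of 2 1] sym[of 3 1] sym[of 3 2] by algebra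
    finally show ?thesis by simp
  qed
  from quartic_coeffs_zero[OF this] sym[of 2 1] sym[of 3 1] sym[of 3 2]
  have B: "B = (\<chi> j k. B $ 2 $ 2 * null_gram $ j $ k)"
    by (simp add: vec_eq_iff forall_3 null_gram_def) algebra
  have "transpose (E x) ** (sym_ricci \<Gamma> x - (\<chi> j k. B $ 2 $ 2 * gram_metric E x $ j $ k)) ** E x
    = B - (\<chi> j k. B $ 2 $ 2 * (transpose (E x) ** gram_metric E x ** E x) $ j $ k)"
    unfolding matrix_diff_ldistrib matrix_diff_rdistrib B_def[symmetric]
    by (simp add: vec_eq_iff matrix_mul_nth transpose_nth sum_3 algebra_simps)
  also have "\<dots> = 0" unfolding gram_metric_gram[OF x] using B by simp
  finally have "sym_ricci \<Gamma> x - (\<chi> j k. B $ 2 $ 2 * gram_metric E x $ j $ k) = 0"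
    by (rule congruence_eq_0[OF inv[OF x]])
  then have "\<forall>i j. (ricci \<Gamma> x i j + ricci \<Gamma> x j i) / 2 = B $ 2 $ 2 * gram_metric E x $ i $ j"
    by (simp add: vec_eq_iff sym_ricci_def)
  then show "\<exists>\<Lambda>. \<forall>i j. (ricci \<Gamma> x i j + ricci \<Gamma> x j i) / 2 = \<Lambda> * gram_metric E x $ i $ j" ..
qed

lemma ricci_weyl_connection:
  assumes "weyl_connection_on S (gram_metric E) \<nu> \<Gamma>" and x: "x \<in> S"
  shows "ricci \<Gamma> x = ricci (frame_conn E \<nu>) x"
proof -
  have eq: "frame_conn E \<nu> i j k y = \<Gamma> i j k y" if "y \<in> S" for i j k y
    by (rule weyl_connection_unique[OF weyl_connection_frame_conn assms(1) that
          invertible_gram_metric[OF that] gram_metric_sym])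
  have "pd l (frame_conn E \<nu> i j k) x = pd l (\<Gamma> i j k) x" for l i j k
  proof (rule pd_cong[OF _ S x eq])
    show "holo_on (frame_conn E \<nu> i j k) S"
      using holo_conn_mat[of j] unfolding holo_mat_def frame_conn_def by (simp add: frame_conn_def[abs_def])
  qed
  then show ?thesis unfolding ricci_def fun_eq_iff by (simp add: eq[OF x])
qed

definition einstein_at :: "complex^3 \<Rightarrow> bool" where
  "einstein_at x \<longleftrightarrow> (\<forall>s. ricci_quadratic (frame_conn E \<nu>) x (E x *v null_dir s) = 0)"

lemma einstein_at_iff:
  assumes "weyl_connection_on S (gram_metric E) \<nu> \<Gamma>" and x: "x \<in> S"
  shows "einstein_at x \<longleftrightarrow> (\<exists>\<Lambda>. \<forall>i j. (ricci \<Gamma> x i j + ricci \<Gamma> x j i) / 2 = \<Lambda> * gram_metric E x $ i $ j)"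
  unfolding einstein_iff_ricci_null[OF x] einstein_at_def ricci_quadratic_def
    ricci_weyl_connection[OF assms] ..

lemma einstein_at_iff_lift:
  assumes "x \<in> S"
  shows "einstein_at x \<longleftrightarrow>
    (\<forall>s. bracket_in_span (lax_field (V 1) (V 2) (lift 1 2)) (lax_field (V 2) (V 3) (lift 2 3)) (x, s))"
  unfolding bracket_in_span_lift_iff[OF assms] einstein_at_def ..

end

subsection \<open>Cubic Lax pairs\<close>

text \<open>
  The lifts of $V_1 - s V_2$ and $V_2 - s V_3$ as polynomials in \<open>s\<close>, with coefficients written in the spin
  coefficients.
\<close>

definition lax_poly0 :: "(3 \<Rightarrow> 3 \<Rightarrow> 3 \<Rightarrow> complex) \<Rightarrow> complex^3 \<Rightarrow> complex poly" where
  "lax_poly0 C n = [: spin_q C n $ 1, spin_p C n $ 1 - spin_q C n $ 2,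
     - spin_r C n $ 1 - spin_p C n $ 2, spin_r C n $ 2 :]"

definition lax_poly1 :: "(3 \<Rightarrow> 3 \<Rightarrow> 3 \<Rightarrow> complex) \<Rightarrow> complex^3 \<Rightarrow> complex poly" where
  "lax_poly1 C n = [: spin_q C n $ 2, spin_p C n $ 2 - spin_q C n $ 3,
     - spin_r C n $ 2 - spin_p C n $ 3, spin_r C n $ 3 :]"

text \<open>
  The formulas for \<open>lax_poly1\<close> solved for the values of \<open>\<nu>\<close> on the frame: each of the three lower
  coefficients of \<open>f\<close> contains exactly one of them.
\<close>

definition lax_nu :: "(3 \<Rightarrow> 3 \<Rightarrow> 3 \<Rightarrow> complex) \<Rightarrow> complex poly \<Rightarrow> complex^3" where
  "lax_nu C f = vector [- 2 * C 1 2 2 - 4 * coeff f 0, 2 * coeff f 1 + 2 * C 1 2 1 - C 1 3 2,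
     4 * C 1 3 1 - 2 * C 2 3 2 - 4 * coeff f 2]"

lemma lax_nu_poly1: "lax_nu C (lax_poly1 C n) = n"
  unfolding vec_eq_iff forall_3
  by (simp add: lax_nu_def lax_poly1_def spin_p_def spin_q_def spin_r_def numeral_2_eq_2 field_simps)

lemma cubic_poly:
  assumes "degree p \<le> 3"
  shows "p = [: coeff p 0, coeff p 1, coeff p 2, coeff p 3 :]"
proof (rule poly_eqI)
  fix n
  consider "n = 0" | "n = 1" | "n = 2" | "n = 3" | m where "n = Suc (Suc (Suc (Suc m)))"
    by (metis One_nat_def Suc_1 nat.exhaust numeral_3_eq_3)
  then show "coeff p n = coeff [: coeff p 0, coeff p 1, coeff p 2, coeff p 3 :] n"
    by cases (use assms in \<open>auto simp: numeral_2_eq_2 numeral_3_eq_3 coeff_eq_0\<close>)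
qed

lemma poly_cubic:
  fixes p :: "complex poly"
  assumes "degree p \<le> 3"
  shows "poly p s = coeff p 0 + coeff p 1 * s + coeff p 2 * s ^ 2 + coeff p 3 * s ^ 3"
proof -
  have "poly [:a, b, c, d:] s = a + b * s + c * s ^ 2 + d * s ^ 3" for a b c d :: complex
    by (simp add: algebra_simps power2_eq_square power3_eq_cube)
  then show ?thesis using cubic_poly[OF assms] by metis
qed

lemma bracket_in_span_cong:
  assumes "(X has_derivative DX) (at z)" "(Y has_derivative DY) (at z)"
    and U: "open U" "z \<in> U" and eq: "\<And>w. w \<in> U \<Longrightarrow> X w = X' w" "\<And>w. w \<in> U \<Longrightarrow> Y w = Y' w"
  shows "bracket_in_span X Y z \<longleftrightarrow> bracket_in_span X' Y' z"
proof -
  have "frechet_derivative X (at z) = frechet_derivative X' (at z)"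
    using has_derivative_transform_within_open[OF assms(1) U eq(1)] assms(1)
    by (metis frechet_derivative_at)
  moreover have "frechet_derivative Y (at z) = frechet_derivative Y' (at z)"
    using has_derivative_transform_within_open[OF assms(2) U eq(2)] assms(2)
    by (metis frechet_derivative_at)
  ultimately show ?thesis
    unfolding bracket_in_span_def lie_bracket_def using eq[OF U(2)] by simp
qed

text \<open>
  Near $\lambda = \infty$ the Lax pair turns into minus the Lax pair of the reversed frame, in the
  opposite order.
\<close>

lemma bracket_in_span_neg_swap:
  assumes "(X has_derivative DX) (at z)" "(Y has_derivative DY) (at z)" and "bracket_in_span X Y z"
  shows "bracket_in_span (\<lambda>w. - Y w) (\<lambda>w. - X w) z"
proof -
  obtain \<alpha> \<beta> where ab: "lie_bracket X Y z =
      (\<alpha> *s fst (X z) + \<beta> *s fst (Y z), \<alpha> * snd (X z) + \<beta> * snd (Y z))"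
    using assms(3) unfolding bracket_in_span_def by blast
  have d: "frechet_derivative (\<lambda>w. - X w) (at z) = (\<lambda>v. - DX v)"
    "frechet_derivative (\<lambda>w. - Y w) (at z) = (\<lambda>v. - DY v)"
    using has_derivative_minus[OF assms(1)] has_derivative_minus[OF assms(2)]
    by (metis frechet_derivative_at)+
  have d': "frechet_derivative X (at z) = DX" "frechet_derivative Y (at z) = DY"
    using assms by (metis frechet_derivative_at)+
  have "DX (- v) = - DX v" "DY (- v) = - DY v" for v
    using assms(1,2) by (metis bounded_linear.linear has_derivative_bounded_linear linear_neg)+
  then have "lie_bracket (\<lambda>w. - Y w) (\<lambda>w. - X w) z = - lie_bracket X Y z"
    unfolding lie_bracket_def d d' by simp
  then have "lie_bracket (\<lambda>w. - Y w) (\<lambda>w. - X w) z =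
      (\<beta> *s fst (- Y z) + \<alpha> *s fst (- X z), \<beta> * snd (- Y z) + \<alpha> * snd (- X z))"
    unfolding ab by (simp add: vec_eq_iff)
  then show ?thesis unfolding bracket_in_span_def by blast
qed

context weyl_frame
begin

lemma has_derivative_poly_field:
  assumes "\<And>k. holo_on (\<lambda>y. coeff (F y) k) S" "\<And>y. y \<in> S \<Longrightarrow> degree (F y) \<le> 3" and x: "x \<in> S"
  obtains g' where "((\<lambda>(y, l). poly (F y) l) has_derivative g') (at (x, s))"
proof -
  note d = has_derivative_fst_comp[OF assms(1) x]
  have c: "(\<lambda>p. coeff (F (fst p)) k) differentiable at (x, s)" for k
    using d[of k] unfolding differentiable_def by blast
  have m: "(\<lambda>p. snd p ^ k) differentiable at (x, s)" for k
    using has_derivative_power[OF has_derivative_snd', of k] unfolding differentiable_def by blast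
  have "(\<lambda>p. coeff (F (fst p)) 0 + coeff (F (fst p)) 1 * snd p ^ 1 + coeff (F (fst p)) 2 * snd p ^ 2
      + coeff (F (fst p)) 3 * snd p ^ 3) differentiable at (x, s)"
    by (intro differentiable_add differentiable_mult c m)
  then obtain g' where g': "((\<lambda>p. coeff (F (fst p)) 0 + coeff (F (fst p)) 1 * snd p + coeff (F (fst p)) 2 * snd p ^ 2
      + coeff (F (fst p)) 3 * snd p ^ 3) has_derivative g') (at (x, s))"
    unfolding differentiable_def power_one_right by blast
  have "((\<lambda>(y, l). poly (F y) l) has_derivative g') (at (x, s))"
    by (rule has_derivative_transform_within_open[OF g', of "S \<times> UNIV"])
      (use S x poly_cubic[OF assms(2)] in \<open>auto intro: open_Times\<close>)
  then show ?thesis by (rule that)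
qed

lemma lift_poly:
  assumes "x \<in> S"
  shows "lift 1 2 (x, s) = poly (lax_poly0 (structure_coeff E x) (frame_comp E \<nu> x)) s"
    and "lift 2 3 (x, s) = poly (lax_poly1 (structure_coeff E x) (frame_comp E \<nu> x)) s"
  unfolding lift_frame[OF assms] spin_poly_def lax_poly0_def lax_poly1_def
  by (simp_all add: spin_r_def[of _ n] algebra_simps power2_eq_square)

text \<open>
  A cubic pair that meets the horizontal condition comes from a Weyl connection. The three lower
  coefficients of \<open>F1\<close> agree with those of the lift by the choice of \<open>\<nu>\<close>, the top one because the
  horizontal condition has the coefficient \<open>C 2 3 1 + coeff (F1 x) 3\<close> at \<open>s ^ 4\<close>; the horizontal
  condition then determines \<open>F0\<close> from \<open>F1\<close>.
\<close>

lemma lax_imp_lift: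
  assumes F0: "\<And>k. holo_on (\<lambda>y. coeff (F0 y) k) S" "\<And>y. y \<in> S \<Longrightarrow> degree (F0 y) \<le> 3"
    and F1: "\<And>k. holo_on (\<lambda>y. coeff (F1 y) k) S" "\<And>y. y \<in> S \<Longrightarrow> degree (F1 y) \<le> 3"
    and nu: "frame_comp E \<nu> x = lax_nu (structure_coeff E x) (F1 x)" and x: "x \<in> S"
    and lax: "\<And>s. bracket_in_span (lax_field (V 1) (V 2) (\<lambda>(y, l). poly (F0 y) l))
                (lax_field (V 2) (V 3) (\<lambda>(y, l). poly (F1 y) l)) (x, s)"
  shows "poly (F0 x) s = lift 1 2 (x, s)" "poly (F1 x) s = lift 2 3 (x, s)"
proof -
  let ?C = "structure_coeff E x"
  have hor: "lax_comp x s 3 + s * lax_comp x s 2 + s\<^sup>2 * lax_comp x s 1 = poly (F0 x) s - s * poly (F1 x) s" for s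
  proof -
    obtain g0' g1' where "((\<lambda>(y, l). poly (F0 y) l) has_derivative g0') (at (x, s))"
      "((\<lambda>(y, l). poly (F1 y) l) has_derivative g1') (at (x, s))"
      using has_derivative_poly_field[OF F0 x] has_derivative_poly_field[OF F1 x] by metis
    from bracket_in_span_lax_field[OF x this] lax[of s] show ?thesis by simp
  qed
  have "(?C 1 2 3 - coeff (F0 x) 0) + (?C 1 2 2 - ?C 1 3 3 - coeff (F0 x) 1 + coeff (F1 x) 0) * s
     + (?C 2 3 3 - ?C 1 3 2 + ?C 1 2 1 - coeff (F0 x) 2 + coeff (F1 x) 1) * s ^ 2
     + (?C 2 3 2 - ?C 1 3 1 - coeff (F0 x) 3 + coeff (F1 x) 2) * s ^ 3 + (?C 2 3 1 + coeff (F1 x) 3) * s ^ 4 = 0" for s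
    using hor[of s] unfolding poly_cubic[OF F0(2)[OF x]] poly_cubic[OF F1(2)[OF x]] lax_comp_def by algebra
  from quartic_coeffs_zero(5)[OF this] have a3: "coeff (F1 x) 3 = - ?C 2 3 1"
    by (simp add: eq_neg_iff_add_eq_0 add.commute)
  have "F1 x = [: coeff (F1 x) 0, coeff (F1 x) 1, coeff (F1 x) 2, coeff (F1 x) 3 :]"
    by (rule cubic_poly[OF F1(2)[OF x]])
  also have "\<dots> = lax_poly1 ?C (frame_comp E \<nu> x)"
    unfolding nu lax_poly1_def lax_nu_def spin_p_def spin_q_def spin_r_def
    by (simp add: a3 field_simps)
  finally have f1: "F1 x = lax_poly1 ?C (frame_comp E \<nu> x)" .
  show *: "poly (F1 x) s = lift 2 3 (x, s)" for s
    unfolding lift_poly[OF x] f1 by simp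
  show "poly (F0 x) s = lift 1 2 (x, s)"
    using hor[of s] lift_horizontal[OF x, of s] * by simp
qed

lemma lax_imp_einstein:
  assumes F0: "\<And>k. holo_on (\<lambda>y. coeff (F0 y) k) S" "\<And>y. y \<in> S \<Longrightarrow> degree (F0 y) \<le> 3"
    and F1: "\<And>k. holo_on (\<lambda>y. coeff (F1 y) k) S" "\<And>y. y \<in> S \<Longrightarrow> degree (F1 y) \<le> 3"
    and nu: "\<And>x. x \<in> S \<Longrightarrow> frame_comp E \<nu> x = lax_nu (structure_coeff E x) (F1 x)"
    and lax: "\<And>x s. x \<in> S \<Longrightarrow> bracket_in_span (lax_field (V 1) (V 2) (\<lambda>(y, l). poly (F0 y) l))
                (lax_field (V 2) (V 3) (\<lambda>(y, l). poly (F1 y) l)) (x, s)"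
    and x: "x \<in> S"
  shows "einstein_at x"
  unfolding einstein_at_iff_lift[OF x]
proof
  fix s
  note L = lax_imp_lift[OF F0 F1 nu _ lax]
  show "bracket_in_span (lax_field (V 1) (V 2) (lift 1 2)) (lax_field (V 2) (V 3) (lift 2 3)) (x, s)"
    by (rule bracket_in_span_cong[THEN iffD2, OF _ _ _ _ _ _ lax[OF x]],
        rule has_derivative_lax_field[OF holo_column holo_column x has_derivative_lift[OF x]],
        rule has_derivative_lax_field[OF holo_column holo_column x has_derivative_lift[OF x]],
        rule open_Times[OF S open_UNIV])
      (use x L in \<open>auto simp: lax_field_def\<close>)
qed

lemma einstein_imp_lax:
  assumes x: "x \<in> S" and ein: "einstein_at x"
    and F: "\<And>y. y \<in> S \<Longrightarrow> F0 y = lax_poly0 (structure_coeff E y) (frame_comp E \<nu> y)"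
       "\<And>y. y \<in> S \<Longrightarrow> F1 y = lax_poly1 (structure_coeff E y) (frame_comp E \<nu> y)"
  shows "bracket_in_span (lax_field (V 1) (V 2) (\<lambda>(y, l). poly (F0 y) l))
                (lax_field (V 2) (V 3) (\<lambda>(y, l). poly (F1 y) l)) (x, s)"
    by (rule bracket_in_span_cong[THEN iffD1, OF _ _ _ _ _ _ ein[unfolded einstein_at_iff_lift[OF x], rule_format]],
        rule has_derivative_lax_field[OF holo_column holo_column x has_derivative_lift[OF x]],
        rule has_derivative_lax_field[OF holo_column holo_column x has_derivative_lift[OF x]],
        rule open_Times[OF S open_UNIV])
      (use x lift_poly F in \<open>auto simp: lax_field_def\<close>)

end

subsection \<open>Reversing the frame\<close>

text \<open>
  The frame \<open>V 3, V 2, V 1\<close> has the same metric, and its spectral parameter is \<open>1 / s\<close>. The results at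
  finite \<open>s\<close>, applied to it, describe the Lax pair near $s = \infty$.
\<close>

definition rev3 :: "3 \<Rightarrow> 3" where
  "rev3 a = (if a = 1 then 3 else if a = 2 then 2 else 1)"

lemma rev3_simps [simp]: "rev3 1 = 3" "rev3 2 = 2" "rev3 3 = 1"
  by (simp_all add: rev3_def)

definition rev_frame :: "(complex^3 \<Rightarrow> complex^3^3) \<Rightarrow> complex^3 \<Rightarrow> complex^3^3" where
  "rev_frame E x = (\<chi> i a. E x $ i $ rev3 a)"

definition rev_mat :: "complex^3^3" where
  "rev_mat = vector [vector [0, 0, 1], vector [0, 1, 0], vector [1, 0, 0]]"

lemma rev_mat_sq: "rev_mat ** rev_mat = mat 1"
  by (simp add: rev_mat_def vec_eq_iff forall_3 matrix_mul_nth sum_3 mat_def)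

lemma rev_frame_mult: "rev_frame E x = E x ** rev_mat"
  by (simp add: rev_mat_def rev_frame_def vec_eq_iff forall_3 matrix_mul_nth sum_3)

lemma column_rev_frame: "column a (rev_frame E x) = column (rev3 a) (E x)"
  by (simp add: column_def rev_frame_def)

lemma matrix_inv_rev_frame:
  assumes "invertible (E x)"
  shows "matrix_inv (rev_frame E x) = rev_mat ** matrix_inv (E x)"
proof (rule matrix_inv_unique)
  have "rev_frame E x ** (rev_mat ** matrix_inv (E x)) = E x ** (rev_mat ** rev_mat) ** matrix_inv (E x)"
    by (simp only: rev_frame_mult matrix_mul_assoc)
  then show "rev_frame E x ** (rev_mat ** matrix_inv (E x)) = mat 1"
    by (simp add: rev_mat_sq matrix_inv_right[OF assms])
qed

lemma rev_mat_vec: "(rev_mat *v w) $ a = w $ rev3 a"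
proof -
  have "\<forall>a. (rev_mat *v w) $ a = w $ rev3 a"
    by (simp add: forall_3 matrix_vector_nth sum_3 rev_mat_def)
  then show ?thesis ..
qed

lemma structure_coeff_rev_frame:
  assumes "invertible (E x)"
  shows "structure_coeff (rev_frame E) x a b c = structure_coeff E x (rev3 a) (rev3 b) (rev3 c)"
  unfolding structure_coeff_def column_rev_frame matrix_inv_rev_frame[of E x, OF assms]
  by (simp add: matrix_vector_mul_assoc[symmetric] rev_mat_vec)

lemma frame_comp_rev_frame: "frame_comp (rev_frame E) \<nu> x $ a = frame_comp E \<nu> x $ rev3 a"
  unfolding frame_comp_def matrix_vector_nth transpose_nth rev_frame_def by simp

lemma gram_metric_rev_frame:
  assumes "invertible (E x)"
  shows "gram_metric (rev_frame E) x = gram_metric E x"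
proof -
  have t: "transpose rev_mat ** null_gram ** rev_mat = null_gram"
    by (simp add: rev_mat_def null_gram_def vec_eq_iff forall_3 matrix_mul_nth sum_3 transpose_nth)
  have "gram_metric (rev_frame E) x =
     transpose (matrix_inv (E x)) ** (transpose rev_mat ** null_gram ** rev_mat) ** matrix_inv (E x)"
    unfolding gram_metric_def matrix_inv_rev_frame[of E x, OF assms] matrix_transpose_mul
    by (simp only: matrix_mul_assoc)
  then show ?thesis unfolding t gram_metric_def .
qed

text \<open>
  The right-hand sides are the polynomials $s^3 f_1(1/s)$ and $s^3 f_0(1/s)$: vertical components of
  degree three transform in this way under the change of spectral parameter.
\<close>

lemma lax_poly_rev:
  assumes C: "\<And>a b c. C a b c = - C b a c"
  shows "lax_poly0 (\<lambda>a b c. C (rev3 a) (rev3 b) (rev3 c)) (\<chi> a. n $ rev3 a) =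
      [: coeff (lax_poly1 C n) 3, coeff (lax_poly1 C n) 2, coeff (lax_poly1 C n) 1, coeff (lax_poly1 C n) 0 :]"
   and "lax_poly1 (\<lambda>a b c. C (rev3 a) (rev3 b) (rev3 c)) (\<chi> a. n $ rev3 a) =
      [: coeff (lax_poly0 C n) 3, coeff (lax_poly0 C n) 2, coeff (lax_poly0 C n) 1, coeff (lax_poly0 C n) 0 :]"
  unfolding lax_poly0_def lax_poly1_def spin_p_def spin_q_def spin_r_def
  by (simp_all add: C[of 2 1] C[of 3 1] C[of 3 2] numeral_2_eq_2 numeral_3_eq_3 field_simps)

context weyl_frame
begin

lemma weyl_frame_rev: "weyl_frame S (rev_frame E) \<nu>"
proof
  show "holo_mat (rev_frame E) S" using E by (simp add: holo_mat_def rev_frame_def)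
  show "invertible (rev_frame E x)" if "x \<in> S" for x
    unfolding rev_frame_mult using inv[OF that] rev_mat_sq
    by (intro invertible_mult) (auto simp: invertible_def)
qed (use S \<nu> in auto)

lemma einstein_imp_lax_inf:
  assumes x: "x \<in> S" and ein: "einstein_at x"
    and F: "\<And>y. y \<in> S \<Longrightarrow> F0 y = lax_poly0 (structure_coeff E y) (frame_comp E \<nu> y)"
       "\<And>y. y \<in> S \<Longrightarrow> F1 y = lax_poly1 (structure_coeff E y) (frame_comp E \<nu> y)"
  shows "bracket_in_span
     (\<lambda>(y, m). (m *s V 1 y - V 2 y, - (\<Sum>k\<le>3. coeff (F0 y) k * m ^ (3 - k))))
     (\<lambda>(y, m). (m *s V 2 y - V 3 y, - (\<Sum>k\<le>3. coeff (F1 y) k * m ^ (3 - k)))) (x, s)"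
proof -
  interpret r: weyl_frame S "rev_frame E" \<nu> by (rule weyl_frame_rev)
  have gm: "weyl_connection_on S (gram_metric (rev_frame E)) \<nu> (frame_conn (rev_frame E) \<nu>)"
    by (rule r.weyl_connection_frame_conn)
  \<comment> \<open>both frames have the same metric, hence the same Weyl connection\<close>
  have gm': "weyl_connection_on S (gram_metric E) \<nu> (frame_conn (rev_frame E) \<nu>)"
  proof -
    have "pd i (\<lambda>y. gram_metric (rev_frame E) y $ j $ k) y = pd i (\<lambda>y. gram_metric E y $ j $ k) y"
      if "y \<in> S" for i j k y
      by (rule pd_cong[OF _ S that])
        (use r.holo_gram_metric gram_metric_rev_frame[of E, OF inv] in \<open>auto simp: holo_mat_def\<close>)
    then show ?thesis
      using gm gram_metric_rev_frame[of E, OF inv] unfolding weyl_connection_on_def by simp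
  qed
  have "r.einstein_at x"
    using ein einstein_at_iff[OF gm' x] r.einstein_at_iff[OF gm x] gram_metric_rev_frame[of E x, OF inv[OF x]] by simp
  then have lax: "bracket_in_span (lax_field (r.V 1) (r.V 2) (r.lift 1 2)) (lax_field (r.V 2) (r.V 3) (r.lift 2 3)) (x, s)"
    unfolding r.einstein_at_iff_lift[OF x] by blast
  note d = has_derivative_lax_field[OF r.holo_column r.holo_column x r.has_derivative_lift[OF x]]
  have sum4: "(\<Sum>k\<le>3. c k * m ^ (3 - k)) = c 0 * m ^ 3 + c 1 * m ^ 2 + c 2 * m + c (3::nat)" for c and m :: complex
    by (simp add: numeral_3_eq_3 numeral_2_eq_2)
  have comp: "frame_comp (rev_frame E) \<nu> y = (\<chi> a. frame_comp E \<nu> y $ rev3 a)" for y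
    by (simp add: vec_eq_iff frame_comp_rev_frame)
  have struct: "structure_coeff (rev_frame E) y = (\<lambda>a b c. structure_coeff E y (rev3 a) (rev3 b) (rev3 c))"
    if "y \<in> S" for y
    by (intro ext structure_coeff_rev_frame inv that)
  have l: "r.lift 1 2 (y, m) = (\<Sum>k\<le>3. coeff (F1 y) k * m ^ (3 - k))"
      "r.lift 2 3 (y, m) = (\<Sum>k\<le>3. coeff (F0 y) k * m ^ (3 - k))" if y: "y \<in> S" for y m
    unfolding r.lift_poly[OF y] comp struct[OF y] lax_poly_rev[of "structure_coeff E y", OF structure_coeff_antisym]
      F[OF y] sum4
    by (simp_all add: algebra_simps power2_eq_square power3_eq_cube)
  show ?thesis
    by (rule bracket_in_span_cong[THEN iffD1, OF has_derivative_minus[OF d] has_derivative_minus[OF d]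
        open_Times[OF S open_UNIV] _ _ _ bracket_in_span_neg_swap[OF d d lax]])
      (use x l in \<open>auto simp: lax_field_def column_rev_frame\<close>)
qed

end


section \<open>Change of chart\<close>

text \<open>
  The terms with second derivatives of \<open>T\<close> cancel by symmetry. Naturality of the bracket makes the structure
  coefficients, and with them the spin coefficients, independent of the chart.
\<close>

lemma lie3_natural:
  assumes U: "open U" "x \<in> U" and R: "open R" and T: "\<And>i. holo_on (\<lambda>y. T y $ i) U" "\<And>y. y \<in> U \<Longrightarrow> T y \<in> R"
    and J: "\<And>y i j. y \<in> U \<Longrightarrow> J y $ i $ j = pd j (\<lambda>y. T y $ i) y"
    and XY: "holo_vec X U" "holo_vec Y U" "holo_vec X' R" "holo_vec Y' R"
    and push: "\<And>y. y \<in> U \<Longrightarrow> X' (T y) = J y *v X y" "\<And>y. y \<in> U \<Longrightarrow> Y' (T y) = J y *v Y y"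
  shows "lie3 X' Y' (T x) = J x *v lie3 X Y x"
proof -
  define D where "D i j k = pd j (pd k (\<lambda>y. T y $ i)) x" for i j k
  have D_sym: "D i j k = D i k j" for i j k
    unfolding D_def by (rule pd_commute[OF T(1) U])
  have key: "(\<Sum>l\<in>UNIV. pd l (\<lambda>z. Z' z $ i) (T x) * J x $ l $ j)
      = (\<Sum>k\<in>UNIV. D i j k * Z x $ k + J x $ i $ k * pd j (\<lambda>y. Z y $ k) x)"
    if Z: "holo_vec Z U" "holo_vec Z' R" and p: "\<And>y. y \<in> U \<Longrightarrow> Z' (T y) = J y *v Z y" for Z Z' i j
  proof -
    have h: "holo_on (\<lambda>y. Z y $ k) U" "holo_on (\<lambda>y. Z' y $ k) R" for k
      using Z by (auto simp: holo_vec_def)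
    have h1: "holo_on (\<lambda>y. pd k (\<lambda>y. T y $ i) y) U" for k
      using holo_on_pd[OF T(1) U(1)] by simp
    have h2: "holo_on (\<lambda>y. pd k (\<lambda>y. T y $ i) y * Z y $ k) U" for k
      by (rule holo_on_mult[OF h1 h(1)])
    have "(\<Sum>l\<in>UNIV. pd l (\<lambda>z. Z' z $ i) (T x) * J x $ l $ j) = pd j (\<lambda>y. Z' (T y) $ i) x"
      unfolding J[OF U(2)] by (rule pd_chain[OF h(2) T(1) U(2) T(2)[OF U(2)], symmetric])
    also have "\<dots> = pd j (\<lambda>y. \<Sum>k\<in>UNIV. pd k (\<lambda>y. T y $ i) y * Z y $ k) x"
      by (rule pd_cong[OF holo_on_compose[OF h(2) T] U]) (auto simp: p matrix_vector_nth J)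
    also have "\<dots> = (\<Sum>k\<in>UNIV. D i j k * Z x $ k + J x $ i $ k * pd j (\<lambda>y. Z y $ k) x)"
      by (simp add: pd_sum[OF h2 U(2)] pd_mult[OF h1 h(1) U(2)] D_def J[OF U(2)])
    finally show ?thesis .
  qed
  have kX: "(\<Sum>l\<in>UNIV. pd l (\<lambda>z. X' z $ i) (T x) * J x $ l $ j)
      = (\<Sum>k\<in>UNIV. D i j k * X x $ k + J x $ i $ k * pd j (\<lambda>y. X y $ k) x)" for i j
    by (rule key[OF XY(1,3)]) (rule push(1))
  have kY: "(\<Sum>l\<in>UNIV. pd l (\<lambda>z. Y' z $ i) (T x) * J x $ l $ j)
      = (\<Sum>k\<in>UNIV. D i j k * Y x $ k + J x $ i $ k * pd j (\<lambda>y. Y y $ k) x)" for i j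
    by (rule key[OF XY(2,4)]) (rule push(2))
  have "lie3 X' Y' (T x) $ i = (J x *v lie3 X Y x) $ i" for i
  proof -
    have "lie3 X' Y' (T x) $ i
      = (\<Sum>j\<in>UNIV. X x $ j * (\<Sum>l\<in>UNIV. pd l (\<lambda>z. Y' z $ i) (T x) * J x $ l $ j))
      - (\<Sum>j\<in>UNIV. Y x $ j * (\<Sum>l\<in>UNIV. pd l (\<lambda>z. X' z $ i) (T x) * J x $ l $ j))"
      unfolding lie3_def vec_lambda_beta push[OF U(2)] matrix_vector_nth sum_3 by algebra
    also have "\<dots> = (J x *v lie3 X Y x) $ i"
      unfolding kX kY unfolding lie3_def vec_lambda_beta matrix_vector_nth sum_3
        D_sym[of i 2 1] D_sym[of i 3 1] D_sym[of i 3 2] by algebra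
    finally show ?thesis .
  qed
  then show ?thesis by (simp add: vec_eq_iff)
qed

lemma frame_comp_oneform:
  assumes "invertible (E x)"
  shows "transpose (E x) *v frame_oneform E x w = w" "frame_oneform E x (transpose (E x) *v v) = v"
proof -
  have "transpose (matrix_inv (E x) ** E x) *v w = w" "transpose (E x ** matrix_inv (E x)) *v v = v"
    using assms by (simp_all add: matrix_inv_left matrix_inv_right transpose_mat)
  then show "transpose (E x) *v frame_oneform E x w = w" "frame_oneform E x (transpose (E x) *v v) = v"
    unfolding frame_oneform_def matrix_transpose_mul by (simp_all only: matrix_vector_mul_assoc)
qed

text \<open>
  Recognises the adapted frames of a given metric, without prior knowledge that the columns of
  \<open>E x\<close> are independent.
\<close>

lemma gram_metric_unique:
  assumes "transpose (E x) ** h ** E x = null_gram"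
  shows "invertible (E x)" "gram_metric E x = h"
proof -
  have "vector [vector [0, 0, - 1 / 2], vector [0, 1, 0], vector [- 1 / 2, 0, 0]] ** null_gram = mat 1"
    by (simp add: null_gram_def vec_eq_iff forall_3 matrix_mul_nth sum_3 mat_def)
  then have "(vector [vector [0, 0, - 1 / 2], vector [0, 1, 0], vector [- 1 / 2, 0, 0]]
      ** (transpose (E x) ** h)) ** E x = mat 1"
    unfolding assms[symmetric] by (simp only: matrix_mul_assoc)
  then show inv: "invertible (E x)" using invertible_left_inverse by blast
  have "gram_metric E x = transpose (E x ** matrix_inv (E x)) ** h ** (E x ** matrix_inv (E x))"
    unfolding gram_metric_def assms[symmetric] matrix_transpose_mul by (simp only: matrix_mul_assoc)
  then show "gram_metric E x = h" by (simp add: matrix_inv_right[OF inv] transpose_mat)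
qed

definition frame_field :: "'a vecfield \<Rightarrow> 'a vecfield \<Rightarrow> 'a vecfield \<Rightarrow> 'a chart \<Rightarrow> complex^3 \<Rightarrow> complex^3^3" where
  "frame_field V1 V2 V3 c x = (\<chi> i. vector [V1 c x $ i, V2 c x $ i, V3 c x $ i])"

lemma column_frame_field [simp]:
  "column 1 (frame_field V1 V2 V3 c x) = V1 c x" "column 2 (frame_field V1 V2 V3 c x) = V2 c x"
  "column 3 (frame_field V1 V2 V3 c x) = V3 c x"
  by (simp_all add: frame_field_def column_def vec_eq_iff)

lemma frame_metric_eq_gram_metric:
  assumes "invertible (frame_field V1 V2 V3 c x)"
  shows "frame_metric V1 V2 V3 c x = gram_metric (frame_field V1 V2 V3 c) x"
proof -
  let ?E = "frame_field V1 V2 V3 c"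
  define G :: "complex^3^3" where "G = vector [vector [0, 0, - 1 / 2], vector [0, 1, 0], vector [- 1 / 2, 0, 0]]"
  have GG: "G ** null_gram = mat 1"
    by (simp add: G_def null_gram_def vec_eq_iff forall_3 matrix_mul_nth sum_3 mat_def)
  have "(\<chi> i j. V2 c x $ i * V2 c x $ j - (V1 c x $ i * V3 c x $ j + V3 c x $ i * V1 c x $ j) / 2)
    = ?E x ** G ** transpose (?E x)"
    by (simp add: vec_eq_iff matrix_mul_nth transpose_nth sum_3 G_def frame_field_def field_simps)
  moreover have "matrix_inv (?E x ** G ** transpose (?E x)) = gram_metric ?E x"
  proof (rule matrix_inv_unique)
    have "(?E x ** G ** transpose (?E x)) ** gram_metric ?E x
      = ?E x ** G ** transpose (matrix_inv (?E x) ** ?E x) ** null_gram ** matrix_inv (?E x)"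
      unfolding gram_metric_def matrix_transpose_mul by (simp only: matrix_mul_assoc)
    also have "\<dots> = ?E x ** (G ** null_gram) ** matrix_inv (?E x)"
      by (simp add: matrix_inv_left[OF assms] transpose_mat matrix_mul_assoc)
    finally show "(?E x ** G ** transpose (?E x)) ** gram_metric ?E x = mat 1"
      by (simp add: GG matrix_inv_right[OF assms])
  qed
  ultimately show ?thesis unfolding frame_metric_def by simp
qed

lemma sum_axis: "(\<Sum>k\<in>UNIV. a k * axis j 1 $ k) = (a j :: complex)"
  by (simp add: axis_def if_distrib if_distribR sum.delta cong: if_cong)

locale cmanifold =
  fixes W :: "'a topology" and A :: "'a chart set"
  assumes manifold: "complex_manifold3 W A"
begin

definition jac :: "'a chart \<Rightarrow> 'a chart \<Rightarrow> complex^3 \<Rightarrow> complex^3^3" where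
  "jac c c' x = jacobian (transition c c') (at x)"

context
  fixes c assumes c: "c \<in> A"
begin

lemma chart_open: "openin W (fst c)" "open (snd c ` fst c)"
  and chart_homeo: "homeomorphic_map (subtopology W (fst c)) (top_of_set (snd c ` fst c)) (snd c)"
  using manifold c unfolding complex_manifold3_def by auto

lemma topspace_chart: "topspace (subtopology W (fst c)) = fst c"
  using openin_subset[OF chart_open(1)] by auto

lemma chart_inj: "inj_on (snd c) (fst c)"
  using homeomorphic_imp_injective_map[OF chart_homeo] topspace_chart by simp

lemma chart_inv_snd [simp]: "p \<in> fst c \<Longrightarrow> chart_inv c (snd c p) = p"
  unfolding chart_inv_def by (rule inv_into_f_f[OF chart_inj])

lemma chart_imageE:
  assumes "x \<in> chart_image c N"
  shows "chart_inv c x \<in> fst c" "chart_inv c x \<in> N" "snd c (chart_inv c x) = x"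
  using assms unfolding chart_image_def by auto

lemma chart_imageI: "p \<in> fst c \<Longrightarrow> p \<in> N \<Longrightarrow> snd c p \<in> chart_image c N"
  unfolding chart_image_def by blast

lemma open_chart_image:
  assumes "openin W N"
  shows "open (chart_image c N)"
proof -
  have "openin (subtopology W (fst c)) (fst c \<inter> N)"
    using assms openin_subtopology_Int2 by blast
  then have "openin (top_of_set (snd c ` fst c)) (chart_image c N)"
    unfolding chart_image_def
    using homeomorphic_imp_open_map[OF chart_homeo] unfolding open_map_def by blast
  then show ?thesis using chart_open(2) by (meson openin_open_eq)
qed

end

lemma chart_inv_transition:
  assumes "c \<in> A" "c' \<in> A" "x \<in> chart_image c (fst c')"
  shows "chart_inv c' (transition c c' x) = chart_inv c x"
  unfolding transition_def using assms chart_imageE by (metis chart_inv_snd)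

lemma transition_in:
  assumes "c \<in> A" "c' \<in> A" "x \<in> chart_image c (fst c' \<inter> N)"
  shows "transition c c' x \<in> chart_image c' (fst c \<inter> N)"
  using chart_imageE[OF assms(1,3)] assms(2) unfolding transition_def by (intro chart_imageI) auto

lemma transition_transition:
  assumes "c \<in> A" "c' \<in> A" "x \<in> chart_image c (fst c')"
  shows "transition c' c'' (transition c c' x) = transition c c'' x"
  using chart_inv_transition[OF assms] by (simp add: transition_def)

lemma transition_self:
  assumes "c \<in> A" "x \<in> chart_image c N"
  shows "transition c c x = x"
  using chart_imageE[OF assms] by (simp add: transition_def)

lemma open_overlap: "c \<in> A \<Longrightarrow> c' \<in> A \<Longrightarrow> openin W N \<Longrightarrow> open (chart_image c (fst c' \<inter> N))"
  by (intro open_chart_image openin_Int chart_open)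

lemma transition_holo:
  assumes "c \<in> A" "c' \<in> A"
  shows "holo_on (\<lambda>x. transition c c' x $ i) (chart_image c (fst c'))"
  using manifold assms unfolding complex_manifold3_def chart_image_def by blast

lemma chart_image_mono: "N \<subseteq> M \<Longrightarrow> chart_image c N \<subseteq> chart_image c M"
  unfolding chart_image_def by blast

lemma jac_nth:
  assumes "c \<in> A" "c' \<in> A" "x \<in> chart_image c (fst c')"
  shows "jac c c' x $ i $ j = pd j (\<lambda>y. transition c c' y $ i) x"
proof -
  have "(transition c c' has_derivative (\<lambda>v. \<chi> i. \<Sum>j\<in>UNIV. pd j (\<lambda>y. transition c c' y $ i) x * v $ j)) (at x)"
    by (rule has_derivative_componentwise_vec)
      (use holo_on_has_partials[OF transition_holo[OF assms(1,2)] assms(3)] in \<open>simp add: has_partials_def\<close>)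
  then have "frechet_derivative (transition c c') (at x)
     = (\<lambda>v. \<chi> i. \<Sum>j\<in>UNIV. pd j (\<lambda>y. transition c c' y $ i) x * v $ j)"
    by (rule frechet_derivative_at[symmetric])
  then have "jac c c' x $ i $ j = (\<Sum>k\<in>UNIV. pd k (\<lambda>y. transition c c' y $ i) x * axis j 1 $ k)"
    by (simp only: jac_def jacobian_def matrix_def vec_lambda_beta)
  also have "\<dots> = pd j (\<lambda>y. transition c c' y $ i) x"
    by (rule sum_axis)
  finally show ?thesis .
qed

lemma jac_chain:
  assumes A: "c \<in> A" "c' \<in> A" "c'' \<in> A" and x: "x \<in> chart_image c (fst c' \<inter> fst c'')"
  shows "jac c' c'' (transition c c' x) ** jac c c' x = jac c c'' x"
proof -
  have x': "x \<in> chart_image c (fst c')" "x \<in> chart_image c (fst c'')"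
    using x by (auto simp: chart_image_def)
  have t: "transition c c' x \<in> chart_image c' (fst c'')"
    using transition_in[OF A(1,2) x] by (auto simp: chart_image_def)
  have t': "transition c c' y \<in> chart_image c' (fst c'')" if "y \<in> chart_image c (fst c' \<inter> fst c'')" for y
    using transition_in[OF A(1,2) that] by (auto simp: chart_image_def)
  have tt: "holo_on (\<lambda>y. transition c c' y $ i) (chart_image c (fst c' \<inter> fst c''))" for i
    by (rule holo_on_subset[OF transition_holo[OF A(1,2)]]) (auto simp: chart_image_def)
  have "pd j (\<lambda>y. transition c c'' y $ i) x = (\<Sum>k\<in>UNIV. pd k (\<lambda>y. transition c' c'' y $ i) (transition c c' x)
      * pd j (\<lambda>y. transition c c' y $ k) x)" for i j
  proof -
    have "pd j (\<lambda>y. transition c c'' y $ i) x = pd j (\<lambda>y. transition c' c'' (transition c c' y) $ i) x"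
    proof (rule pd_cong[symmetric, OF holo_on_compose[OF transition_holo[OF A(2,3)] tt t']])
      show "open (chart_image c (fst c' \<inter> fst c''))"
        by (rule open_overlap[OF A(1,2) chart_open(1)[OF A(3)]])
      show "transition c' c'' (transition c c' y) $ i = transition c c'' y $ i"
        if "y \<in> chart_image c (fst c' \<inter> fst c'')" for y
      proof -
        have "y \<in> chart_image c (fst c')" using that by (auto simp: chart_image_def)
        from transition_transition[OF A(1,2) this] show ?thesis by simp
      qed
    qed (use x in auto)
    also have "\<dots> = (\<Sum>k\<in>UNIV. pd k (\<lambda>y. transition c' c'' y $ i) (transition c c' x)
      * pd j (\<lambda>y. transition c c' y $ k) x)"
      by (rule pd_chain[OF transition_holo[OF A(2,3)] tt x t])
    finally show ?thesis .
  qed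
  then show ?thesis
    by (simp add: vec_eq_iff matrix_mul_nth jac_nth[OF A(1,2) x'(1)] jac_nth[OF A(1,3) x'(2)] jac_nth[OF A(2,3) t])
qed

lemma holo_jac:
  assumes "c \<in> A" "c' \<in> A"
  shows "holo_mat (jac c c') (chart_image c (fst c'))"
proof -
  have o: "open (chart_image c (fst c'))" by (rule open_chart_image[OF assms(1) chart_open(1)[OF assms(2)]])
  have "holo_on (\<lambda>x. jac c c' x $ i $ j) (chart_image c (fst c'))" for i j
    by (rule holo_on_cong[OF holo_on_pd[OF transition_holo[OF assms] o] o]) (simp_all add: jac_nth[OF assms])
  then show ?thesis by (simp add: holo_mat_def)
qed

definition frame_on :: "'a set \<Rightarrow> 'a vecfield \<Rightarrow> 'a vecfield \<Rightarrow> 'a vecfield \<Rightarrow> bool" where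
  "frame_on N V1 V2 V3 \<longleftrightarrow> openin W N \<and> holo_vecfield A N V1 \<and> holo_vecfield A N V2 \<and>
     holo_vecfield A N V3 \<and> independent_on A N V1 V2 V3"

lemma frame_on_chart:
  assumes "frame_on N V1 V2 V3" "c \<in> A"
  shows "open (chart_image c N)" "holo_mat (frame_field V1 V2 V3 c) (chart_image c N)"
    and "x \<in> chart_image c N \<Longrightarrow> invertible (frame_field V1 V2 V3 c x)"
proof -
  show "open (chart_image c N)" using assms open_chart_image by (simp add: frame_on_def)
  show "holo_mat (frame_field V1 V2 V3 c) (chart_image c N)"
    using assms by (simp add: holo_mat_def frame_field_def frame_on_def holo_vecfield_def forall_3)
  assume x: "x \<in> chart_image c N"
  have "\<forall>w. frame_field V1 V2 V3 c x *v w = 0 \<longrightarrow> w = 0"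
  proof (intro allI impI)
    fix w assume "frame_field V1 V2 V3 c x *v w = 0"
    then have "w $ 1 *s V1 c x + w $ 2 *s V2 c x + w $ 3 *s V3 c x = 0"
      by (simp add: vec_eq_iff matrix_vector_nth sum_3 frame_field_def ac_simps)
    then show "w = 0"
      using assms x unfolding frame_on_def independent_on_def vec_eq_iff forall_3 zero_index by blast
  qed
  then show "invertible (frame_field V1 V2 V3 c x)"
    using invertible_left_inverse matrix_left_invertible_ker by blast
qed

lemma weyl_frame_chart:
  assumes "frame_on N V1 V2 V3" "c \<in> A" "holo_vec \<nu> (chart_image c N)"
  shows "weyl_frame (chart_image c N) (frame_field V1 V2 V3 c) \<nu>"
  by (rule weyl_frame.intro) (use frame_on_chart[OF assms(1,2)] assms(3) in auto)

lemma frame_field_transition: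
  assumes "frame_on N V1 V2 V3" "c \<in> A" "c' \<in> A" "x \<in> chart_image c (fst c' \<inter> N)"
  shows "frame_field V1 V2 V3 c' (transition c c' x) = jac c c' x ** frame_field V1 V2 V3 c x"
proof -
  have "V c' (transition c c' x) = jac c c' x *v V c x" if "V \<in> {V1, V2, V3}" for V
    using assms that unfolding frame_on_def holo_vecfield_def jac_def by blast
  then have "V1 c' (transition c c' x) = jac c c' x *v V1 c x" "V2 c' (transition c c' x) = jac c c' x *v V2 c x"
    "V3 c' (transition c c' x) = jac c c' x *v V3 c x" by auto
  then show ?thesis
    by (simp add: vec_eq_iff forall_3 frame_field_def matrix_mul_nth matrix_vector_nth)
qed

lemma frame_field_inv_transition:
  assumes "frame_on N V1 V2 V3" "c \<in> A" "c' \<in> A" "x \<in> chart_image c (fst c' \<inter> N)"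
  shows "matrix_inv (frame_field V1 V2 V3 c' (transition c c' x)) ** jac c c' x
     = matrix_inv (frame_field V1 V2 V3 c x)"
proof -
  let ?E = "frame_field V1 V2 V3"
  have x: "x \<in> chart_image c N" using assms(4) by (auto simp: chart_image_def)
  have x': "transition c c' x \<in> chart_image c' N"
    using transition_in[OF assms(2-4)] by (auto simp: chart_image_def)
  have "matrix_inv (?E c' (transition c c' x)) ** jac c c' x ** (?E c x ** matrix_inv (?E c x))
     = matrix_inv (?E c' (transition c c' x)) ** ?E c' (transition c c' x) ** matrix_inv (?E c x)"
    unfolding frame_field_transition[OF assms] by (simp only: matrix_mul_assoc)
  then show ?thesis
    using frame_on_chart(3)[OF assms(1,2) x] frame_on_chart(3)[OF assms(1,3) x']
    by (simp add: matrix_inv_left matrix_inv_right)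
qed

lemma structure_coeff_transition:
  assumes F: "frame_on N V1 V2 V3" and A: "c \<in> A" "c' \<in> A" and x: "x \<in> chart_image c (fst c' \<inter> N)"
  shows "structure_coeff (frame_field V1 V2 V3 c') (transition c c' x) = structure_coeff (frame_field V1 V2 V3 c) x"
proof (intro ext)
  fix a b e
  let ?E = "frame_field V1 V2 V3"
  let ?U = "chart_image c (fst c' \<inter> N)"
  have N: "openin W N" using F by (simp add: frame_on_def)
  have col: "holo_vec (\<lambda>y. column a (?E d y)) (chart_image d N)" if "d \<in> A" for a d
    using frame_on_chart(2)[OF F that] by (simp add: holo_mat_def holo_vec_def column_def)
  have "lie3 (\<lambda>y. column a (?E c' y)) (\<lambda>y. column b (?E c' y)) (transition c c' x)
     = jac c c' x *v lie3 (\<lambda>y. column a (?E c y)) (\<lambda>y. column b (?E c y)) x"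
  proof (rule lie3_natural[OF _ x])
    show "open ?U" by (rule open_overlap[OF A N])
    show "open (chart_image c' N)" by (rule open_chart_image[OF A(2) N])
    show "holo_on (\<lambda>y. transition c c' y $ i) ?U" for i
      by (rule holo_on_subset[OF transition_holo[OF A]]) (auto simp: chart_image_def)
    show "transition c c' y \<in> chart_image c' N" if "y \<in> ?U" for y
      using transition_in[OF A that] by (auto simp: chart_image_def)
    show "jac c c' y $ i $ j = pd j (\<lambda>y. transition c c' y $ i) y" if "y \<in> ?U" for y i j
      by (rule jac_nth[OF A]) (use that in \<open>auto simp: chart_image_def\<close>)
    show "holo_vec (\<lambda>y. column a (?E c' y)) (chart_image c' N)" "holo_vec (\<lambda>y. column b (?E c' y)) (chart_image c' N)"
      by (rule col[OF A(2)])+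
    show "holo_vec (\<lambda>y. column a (?E c y)) ?U" "holo_vec (\<lambda>y. column b (?E c y)) ?U"
      using col[OF A(1)] chart_image_mono[of "fst c' \<inter> N" N c] unfolding holo_vec_def
      by (meson holo_on_subset inf_le2)+
    have "column a (J ** M) = J *v column a M" for a and J M :: "complex^3^3"
      by (simp add: vec_eq_iff column_def matrix_mul_nth matrix_vector_nth)
    then show "column a (?E c' (transition c c' y)) = jac c c' y *v column a (?E c y)"
       "column b (?E c' (transition c c' y)) = jac c c' y *v column b (?E c y)" if "y \<in> ?U" for y
      unfolding frame_field_transition[OF F A that] by auto
  qed
  then show "structure_coeff (?E c') (transition c c' x) a b e = structure_coeff (?E c) x a b e"
    unfolding structure_coeff_def
    by (simp add: matrix_vector_mul_assoc frame_field_inv_transition[OF F A x])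
qed

end


section \<open>From Lax pairs to Einstein--Weyl structures\<close>

text \<open>
  The 1-form of the Weyl structure of a Lax pair. It is written through frame components, so that its
  transformation law follows from that of the coframe.
\<close>

definition lax_weyl_form :: "'a vecfield \<Rightarrow> 'a vecfield \<Rightarrow> 'a vecfield \<Rightarrow>
    ('a \<Rightarrow> complex poly) \<Rightarrow> ('a \<Rightarrow> complex poly) \<Rightarrow> 'a oneform" where
  "lax_weyl_form V1 V2 V3 f0 f1 c x = frame_oneform (frame_field V1 V2 V3 c) x
     (lax_nu (structure_coeff (frame_field V1 V2 V3 c) x) (f1 (chart_inv c x)))"

lemma weyl_connection_on_cong:
  assumes "holo_mat h S" "open S" "\<And>x. x \<in> S \<Longrightarrow> h x = h' x"
  shows "weyl_connection_on S h \<nu> \<Gamma> \<longleftrightarrow> weyl_connection_on S h' \<nu> \<Gamma>"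
proof -
  have "pd i (\<lambda>y. h y $ j $ k) x = pd i (\<lambda>y. h' y $ j $ k) x" if "x \<in> S" for i j k x
    by (rule pd_cong[OF _ assms(2) that]) (use assms in \<open>auto simp: holo_mat_def\<close>)
  then show ?thesis unfolding weyl_connection_on_def using assms(3) by simp
qed

context cmanifold
begin

lemma lax_data_frame: "openin W N \<Longrightarrow> lax_data A N V1 V2 V3 f0 f1 \<Longrightarrow> frame_on N V1 V2 V3"
  by (simp add: lax_data_def frame_on_def)

lemma holo_vec_lax_weyl_form:
  assumes N: "openin W N" and lax: "lax_data A N V1 V2 V3 f0 f1" and c: "c \<in> A"
  shows "holo_vec (lax_weyl_form V1 V2 V3 f0 f1 c) (chart_image c N)"
proof -
  note F = lax_data_frame[OF N lax]
  interpret weyl_frame "chart_image c N" "frame_field V1 V2 V3 c" "\<lambda>_. 0"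
    by (rule weyl_frame_chart[OF F c]) (simp add: holo_vec_def holo_on_const)
  have f: "holo_on (\<lambda>x. coeff (f1 (chart_inv c x)) k) (chart_image c N)" for k
    using lax c by (simp add: lax_data_def cubic_on_def holo_fun_def)
  have "holo_on (\<lambda>x. lax_nu (structure_coeff (frame_field V1 V2 V3 c) x) (f1 (chart_inv c x)) $ a) (chart_image c N)" for a
  proof -
    have "\<forall>a. holo_on (\<lambda>x. lax_nu (structure_coeff (frame_field V1 V2 V3 c) x) (f1 (chart_inv c x)) $ a) (chart_image c N)"
      unfolding forall_3 lax_nu_def vector_3 by (intro conjI holo_intros holo_struct f)
    then show ?thesis ..
  qed
  then show ?thesis
    unfolding lax_weyl_form_def frame_oneform_def
    by (intro holo_mat_vec holo_mat_transpose holo_theta) (simp add: holo_vec_def)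
qed

text \<open>
  In each chart the pair \<open>f0, f1\<close> is the lift of the Weyl connection (\<open>lax_imp_lift\<close>), and
  integrability gives the Einstein equation.
\<close>

lemma einstein_weyl_of_lax_data:
  assumes N: "openin W N" and lax: "lax_data A N V1 V2 V3 f0 f1"
  shows "einstein_weyl A N (frame_metric V1 V2 V3) (lax_weyl_form V1 V2 V3 f0 f1)"
proof -
  note F = lax_data_frame[OF N lax]
  let ?E = "frame_field V1 V2 V3" and ?\<nu> = "lax_weyl_form V1 V2 V3 f0 f1"
  have wf: "weyl_frame (chart_image c N) (?E c) (?\<nu> c)" if "c \<in> A" for c
    by (rule weyl_frame_chart[OF F that holo_vec_lax_weyl_form[OF N lax that]])
  have fm: "frame_metric V1 V2 V3 c x = gram_metric (?E c) x" if "c \<in> A" "x \<in> chart_image c N" for c x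
    by (rule frame_metric_eq_gram_metric[OF frame_on_chart(3)[OF F that]])
  have sub: "x \<in> chart_image c N" if "x \<in> chart_image c (M \<inter> N)" for c x M
    using that by (auto simp: chart_image_def)
  have hm: "holo_mat (frame_metric V1 V2 V3 c) (chart_image c N)" if "c \<in> A" for c
    by (rule holo_mat_cong[OF weyl_frame.holo_gram_metric[OF wf[OF that]] frame_on_chart(1)[OF F that]])
      (simp add: fm that)
  have "holo_metric A N (frame_metric V1 V2 V3)"
    unfolding holo_metric_def
  proof (intro conjI ballI allI)
    fix c i j assume c: "c \<in> A"
    show "holo_on (\<lambda>x. frame_metric V1 V2 V3 c x $ i $ j) (chart_image c N)"
      using hm[OF c] by (simp add: holo_mat_def)
  next
    fix c x assume c: "c \<in> A" and x: "x \<in> chart_image c N"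
    show "transpose (frame_metric V1 V2 V3 c x) = frame_metric V1 V2 V3 c x"
      "invertible (frame_metric V1 V2 V3 c x)"
      unfolding fm[OF c x] by (rule gram_metric_sym weyl_frame.invertible_gram_metric[OF wf[OF c] x])+
  next
    fix c c' x assume c: "c \<in> A" "c' \<in> A" and x: "x \<in> chart_image c (fst c' \<inter> N)"
    note inv = frame_field_inv_transition[OF F c x]
    show "frame_metric V1 V2 V3 c x = transpose (jacobian (transition c c') (at x)) **
        frame_metric V1 V2 V3 c' (transition c c' x) ** jacobian (transition c c') (at x)"
      unfolding fm[OF c(1) sub[OF x]] fm[OF c(2) sub[OF transition_in[OF c x]]] gram_metric_def
        inv[symmetric] jac_def[symmetric] matrix_transpose_mul
      by (simp only: matrix_mul_assoc)
  qed
  moreover have "holo_oneform A N ?\<nu>"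
    unfolding holo_oneform_def
  proof (intro conjI ballI allI)
    fix c i assume c: "c \<in> A"
    show "holo_on (\<lambda>x. ?\<nu> c x $ i) (chart_image c N)"
      using holo_vec_lax_weyl_form[OF N lax c] by (simp add: holo_vec_def)
  next
    fix c c' x assume c: "c \<in> A" "c' \<in> A" and x: "x \<in> chart_image c (fst c' \<inter> N)"
    have x': "x \<in> chart_image c (fst c')" using x by (auto simp: chart_image_def)
    show "?\<nu> c x = transpose (jacobian (transition c c') (at x)) *v ?\<nu> c' (transition c c' x)"
      unfolding lax_weyl_form_def structure_coeff_transition[OF F c x] chart_inv_transition[OF c x']
        frame_oneform_def frame_field_inv_transition[OF F c x, symmetric] matrix_transpose_mul
        jac_def[symmetric]
      by (simp only: matrix_vector_mul_assoc)
  qed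
  moreover have "\<exists>\<Gamma>. weyl_connection_on (chart_image c N) (frame_metric V1 V2 V3 c) (?\<nu> c) \<Gamma> \<and>
        (\<forall>x\<in>chart_image c N. \<exists>\<Lambda>. \<forall>i j.
           (ricci \<Gamma> x i j + ricci \<Gamma> x j i) / 2 = \<Lambda> * frame_metric V1 V2 V3 c x $ i $ j)"
    if c: "c \<in> A" for c
  proof (rule exI, intro conjI ballI)
    interpret weyl_frame "chart_image c N" "?E c" "?\<nu> c" by (rule wf[OF c])
    note wc = weyl_connection_frame_conn
    show "weyl_connection_on (chart_image c N) (frame_metric V1 V2 V3 c) (?\<nu> c) (frame_conn (?E c) (?\<nu> c))"
      using weyl_connection_on_cong[OF hm[OF c] S] fm[OF c] wc by blast
    fix x assume x: "x \<in> chart_image c N"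
    have f: "holo_on (\<lambda>y. coeff (f (chart_inv c y)) k) (chart_image c N)"
       "y \<in> chart_image c N \<Longrightarrow> degree (f (chart_inv c y)) \<le> 3" if "f \<in> {f0, f1}" for f k y
      using lax c that chart_imageE[OF c] by (auto simp: lax_data_def cubic_on_def holo_fun_def)
    have "einstein_at x"
    proof (rule lax_imp_einstein[OF f(1) f(2) f(1) f(2) _ _ x])
      show "frame_comp (?E c) (?\<nu> c) y = lax_nu (structure_coeff (?E c) y) (f1 (chart_inv c y))"
        if "y \<in> chart_image c N" for y
        unfolding frame_comp_def lax_weyl_form_def by (rule frame_comp_oneform(1)[of "?E c", OF inv[OF that]])
      show "bracket_in_span (lax_field (V 1) (V 2) (\<lambda>(y, l). poly (f0 (chart_inv c y)) l))
           (lax_field (V 2) (V 3) (\<lambda>(y, l). poly (f1 (chart_inv c y)) l)) (y, s)"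
        if "y \<in> chart_image c N" for y s
        using lax c that by (simp add: lax_data_def lax_integrable_def lax_def lax_field_def)
    qed auto
    then show "\<exists>\<Lambda>. \<forall>i j. (ricci (frame_conn (?E c) (?\<nu> c)) x i j + ricci (frame_conn (?E c) (?\<nu> c)) x j i) / 2
        = \<Lambda> * frame_metric V1 V2 V3 c x $ i $ j"
      using einstein_at_iff[OF wc x] fm[OF c x] by simp
  qed
  ultimately show ?thesis unfolding einstein_weyl_def by blast
qed

end


section \<open>Local null frames\<close>

definition bil :: "complex^3^3 \<Rightarrow> complex^3 \<Rightarrow> complex^3 \<Rightarrow> complex" where
  "bil M u w = (\<Sum>i\<in>UNIV. \<Sum>j\<in>UNIV. u $ i * M $ i $ j * w $ j)"

lemma bil_add: "bil M (u + v) w = bil M u w + bil M v w" "bil M u (v + w) = bil M u v + bil M u w"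
  and bil_scale: "bil M (c *s u) w = c * bil M u w" "bil M u (c *s w) = c * bil M u w"
  and bil_diff: "bil M (u - v) w = bil M u w - bil M v w" "bil M u (v - w) = bil M u v - bil M u w"
  by (simp_all add: bil_def sum_3 algebra_simps)

lemma bil_sum: "bil M u (\<Sum>i\<in>I. f i) = (\<Sum>i\<in>I. bil M u (f i))"
  by (induction I rule: infinite_finite_induct) (auto simp: bil_add bil_def[of M u 0])

lemma bil_sum_left: "bil M (\<Sum>i\<in>I. f i) u = (\<Sum>i\<in>I. bil M (f i) u)"
  by (induction I rule: infinite_finite_induct) (auto simp: bil_add bil_def[of M 0 u])

lemma bil_sym: "transpose M = M \<Longrightarrow> bil M u w = bil M w u"
proof -
  assume "transpose M = M"
  then have m: "M $ i $ j = M $ j $ i" for i j by (metis transpose_nth)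
  show ?thesis unfolding bil_def sum_3 m[of 2 1] m[of 3 1] m[of 3 2] by algebra
qed

lemma bil_nondegenerate:
  assumes "invertible M" "\<And>v. bil M u v = 0"
  shows "u = 0"
proof -
  have "u v* M = 0"
  proof (simp add: vec_eq_iff, intro allI)
    fix j
    have "(u v* M) $ j = bil M u (axis j 1)"
      unfolding bil_def sum_axis by (simp add: vector_matrix_mult_def mult.commute)
    then show "(u v* M) $ j = 0" using assms(2) by simp
  qed
  then have "u v* (M ** matrix_inv M) = 0" by (metis vector_matrix_mul_assoc vector_matrix_mult_0)
  then show ?thesis by (simp add: matrix_inv_right[OF assms(1)])
qed

text \<open>
  A complex orthogonal projection \<open>P\<close> can produce null vectors, but not only null vectors: if all of
  its values were null, polarisation would make its image totally null and orthogonal to the \<open>u i\<close>,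
  hence zero, and fewer than three vectors would span the space.
\<close>

lemma exists_nonnull_complement:
  fixes k :: nat
  assumes M: "invertible M" "transpose M = M" and k: "k < 3"
    and on: "\<And>i j. i < k \<Longrightarrow> j < k \<Longrightarrow> bil M (u i) (u j) = (if i = j then 1 else 0)"
  obtains w where "bil M (w - (\<Sum>i<k. bil M w (u i) *s u i)) (w - (\<Sum>i<k. bil M w (u i) *s u i)) \<noteq> 0"
proof (rule ccontr)
  define P where "P w = w - (\<Sum>i<k. bil M w (u i) *s u i)" for w
  assume "\<not> thesis"
  then have null: "bil M (P w) (P w) = 0" for w using that unfolding P_def by blast
  have orth: "bil M (P w) (u j) = 0" if "j < k" for w j
  proof -
    have "bil M (P w) (u j) = bil M w (u j) - (\<Sum>i<k. bil M w (u i) * bil M (u i) (u j))"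
      by (simp add: P_def bil_diff bil_sum_left bil_scale)
    also have "(\<Sum>i<k. bil M w (u i) * bil M (u i) (u j)) = (\<Sum>i<k. if i = j then bil M w (u i) else 0)"
      by (rule sum.cong) (use on that in auto)
    also have "\<dots> = bil M w (u j)" using that by simp
    finally show ?thesis by simp
  qed
  have P_add: "P (v + w) = P v + P w" for v w
    by (simp add: P_def bil_add vector_sadd_rdistrib sum.distrib algebra_simps)
  have PP: "bil M (P v) (P w) = 0" for v w
    using null[of "v + w"] null[of v] null[of w] bil_sym[OF M(2), of "P v" "P w"]
    by (simp add: P_add bil_add)
  have "bil M (P w) v = 0" for v w
  proof -
    have "bil M (P w) v = bil M (P w) (P v) + (\<Sum>i<k. bil M v (u i) * bil M (P w) (u i))"
      by (simp add: P_def[of v] bil_diff bil_sum bil_scale)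
    then show ?thesis using PP orth by simp
  qed
  then have "P w = 0" for w by (rule bil_nondegenerate[OF M(1)])
  then have w: "w = (\<Sum>i<k. bil M w (u i) *s u i)" for w by (simp add: P_def)
  have "w \<in> vec.span (u ` {..<k})" for w
    by (subst w) (intro vec.span_sum vec.span_scale vec.span_base, auto)
  then have "vec.dim (UNIV :: (complex^3) set) \<le> card (u ` {..<k})"
    by (intro vec.dim_le_card) auto
  also have "\<dots> \<le> k" using card_image_le[of "{..<k}" u] by simp
  finally show False using k by (simp add: vec.dim_UNIV card_cart_basis)
qed

definition orthonormal_on :: "(complex^3) set \<Rightarrow> (complex^3 \<Rightarrow> complex^3^3) \<Rightarrow> nat \<Rightarrow>
    (nat \<Rightarrow> complex^3 \<Rightarrow> complex^3) \<Rightarrow> bool" where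
  "orthonormal_on U h k u \<longleftrightarrow> (\<forall>i<k. holo_vec (u i) U) \<and>
     (\<forall>x\<in>U. \<forall>i<k. \<forall>j<k. bil (h x) (u i x) (u j x) = (if i = j then 1 else 0))"

text \<open>
  A Gram--Schmidt step on a neighbourhood of a point: a constant vector that works at the point works
  nearby, and normalisation requires a holomorphic square root of a function without zeros.
\<close>

lemma orthonormal_extend:
  assumes S: "open S" "x0 \<in> S" and h: "holo_mat h S" "\<And>x. x \<in> S \<Longrightarrow> transpose (h x) = h x"
    and inv: "invertible (h x0)" and k: "k < 3" and on: "orthonormal_on S h k u"
  obtains U v where "open U" "x0 \<in> U" "U \<subseteq> S" "orthonormal_on U h (Suc k) (u(k := v))"
proof -
  obtain w where w: "bil (h x0) (w - (\<Sum>i<k. bil (h x0) w (u i x0) *s u i x0))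
      (w - (\<Sum>i<k. bil (h x0) w (u i x0) *s u i x0)) \<noteq> 0"
  proof (rule exists_nonnull_complement[OF inv h(2)[OF S(2)] k])
    show "bil (h x0) (u i x0) (u j x0) = (if i = j then 1 else 0)" if "i < k" "j < k" for i j
      using on S that by (simp add: orthonormal_on_def)
  qed
  define p where "p x = w - (\<Sum>i<k. bil (h x) w (u i x) *s u i x)" for x
  define q where "q x = bil (h x) (p x) (p x)" for x
  have q0: "q x0 \<noteq> 0" using w by (simp add: q_def p_def)
  have hu: "holo_on (\<lambda>x. u i x $ a) S" if "i < k" for i a
    using on that by (simp add: orthonormal_on_def holo_vec_def)
  have hh: "holo_on (\<lambda>x. h x $ a $ b) S" for a b using h by (simp add: holo_mat_def)
  have hp: "holo_on (\<lambda>x. p x $ a) S" for a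
    unfolding p_def bil_def vector_minus_component sum_component vector_smult_component
    by (intro holo_intros hu hh) auto
  have hq: "holo_on q S" unfolding q_def bil_def by (intro holo_intros hp hh)
  \<comment> \<open>\<open>r\<close> is a square root of \<open>q\<close>; dividing by \<open>q x0\<close> moves the values near \<open>x0\<close> off the branch cut of \<open>csqrt\<close>\<close>
  define U where "U = {x \<in> S. q x / q x0 \<in> - \<real>\<^sub>\<le>\<^sub>0}"
  define r where "r x = csqrt (q x0) * csqrt (q x / q x0)" for x
  have hq': "holo_on (\<lambda>x. q x / q x0) S" by (intro holo_intros hq) (use q0 in auto)
  have U: "open U" "x0 \<in> U" "U \<subseteq> S"
  proof -
    have "open (S \<inter> (\<lambda>x. q x / q x0) -` (- \<real>\<^sub>\<le>\<^sub>0))"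
      by (rule continuous_open_preimage[OF holo_on_imp_continuous_on[OF hq'] S(1)])
        (simp add: closed_nonpos_Reals_complex open_Compl)
    then show "open U" by (simp add: U_def Collect_conj_eq vimage_def)
    show "x0 \<in> U" using S q0 by (simp add: U_def complex_nonpos_Reals_iff)
  qed (auto simp: U_def)
  have hr: "holo_on r U"
    unfolding r_def
  proof (rule holo_on_mult[OF holo_on_const], rule holo_on_comp_field[OF holo_on_subset[OF hq' U(3)]])
    show "csqrt field_differentiable at (q x / q x0)" if "x \<in> U" for x
      by (rule field_differentiable_at_csqrt) (use that in \<open>simp add: U_def\<close>)
  qed
  have r2: "r x * r x = q x" for x
    using q0 by (simp add: r_def power2_eq_square[symmetric] power_mult_distrib)
  have r0: "r x \<noteq> 0" if "x \<in> U" for x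
  proof -
    have "q x \<noteq> 0" using that by (auto simp: U_def)
    then show ?thesis using r2[of x] by auto
  qed
  define v where "v x = (1 / r x) *s p x" for x
  have orth: "bil (h x) (p x) (u j x) = 0" if "j < k" "x \<in> S" for x j
  proof -
    have "bil (h x) (p x) (u j x) = bil (h x) w (u j x) - (\<Sum>i<k. bil (h x) w (u i x) * bil (h x) (u i x) (u j x))"
      by (simp add: p_def bil_diff bil_sum_left bil_scale)
    also have "(\<Sum>i<k. bil (h x) w (u i x) * bil (h x) (u i x) (u j x)) = (\<Sum>i<k. if i = j then bil (h x) w (u i x) else 0)"
      by (rule sum.cong) (use on that in \<open>auto simp: orthonormal_on_def\<close>)
    also have "\<dots> = bil (h x) w (u j x)" using that by simp
    finally show ?thesis by simp
  qed
  have "holo_vec v U"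
    unfolding holo_vec_def v_def vector_smult_component
    by (intro allI holo_intros hr holo_on_subset[OF hp U(3)]) (use r0 in auto)
  moreover have "bil (h x) (v x) (v x) = 1" if "x \<in> U" for x
    using r0[OF that] by (simp add: v_def bil_scale q_def[symmetric] r2[symmetric])
  moreover have "bil (h x) (v x) (u j x) = 0" "bil (h x) (u j x) (v x) = 0" if "x \<in> U" "j < k" for x j
  proof -
    show "bil (h x) (v x) (u j x) = 0" using that U orth by (auto simp: v_def bil_scale)
    then show "bil (h x) (u j x) (v x) = 0" using bil_sym[OF h(2)] that U by (metis subsetD)
  qed
  moreover have "holo_on (\<lambda>x. u i x $ a) U" if "i < k" for i a
    by (rule holo_on_subset[OF hu[OF that] U(3)])
  ultimately have "orthonormal_on U h (Suc k) (u(k := v))"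
    using on U(3) unfolding orthonormal_on_def less_Suc_eq
    by (auto simp: holo_vec_def)
  then show ?thesis using that U by blast
qed

text \<open>
  From an orthonormal frame $u_0, u_1, u_2$ the null frame is $u_0 + i u_2$, $u_1$, $i u_2 - u_0$.
\<close>

lemma local_null_frame:
  assumes S: "open S" "x0 \<in> S" and h: "holo_mat h S" "\<And>x. x \<in> S \<Longrightarrow> transpose (h x) = h x"
    and inv: "invertible (h x0)"
  obtains U E where "open U" "x0 \<in> U" "U \<subseteq> S" "holo_mat E U"
    "\<And>x. x \<in> U \<Longrightarrow> transpose (E x) ** h x ** E x = null_gram"
proof -
  have "k \<le> 3 \<Longrightarrow> \<exists>U u. open U \<and> x0 \<in> U \<and> U \<subseteq> S \<and> orthonormal_on U h k u" for k
  proof (induction k)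
    case 0
    show ?case by (rule exI[of _ S]) (use S in \<open>auto simp: orthonormal_on_def\<close>)
  next
    case (Suc k)
    then obtain U u where U: "open U" "x0 \<in> U" "U \<subseteq> S" "orthonormal_on U h k u" by auto
    have hU: "holo_mat h U" using h(1) U(3) by (auto simp: holo_mat_def intro: holo_on_subset)
    have sU: "transpose (h x) = h x" if "x \<in> U" for x using h(2) U(3) that by auto
    have k: "k < 3" using Suc.prems by simp
    obtain U' v where "open U'" "x0 \<in> U'" "U' \<subseteq> U" "orthonormal_on U' h (Suc k) (u(k := v))"
      using orthonormal_extend[OF U(1,2) hU sU inv k U(4)] by blast
    then show ?case using U(3) by blast
  qed
  from this[of 3] obtain U u where U: "open U" "x0 \<in> U" "U \<subseteq> S" and on: "orthonormal_on U h 3 u" by auto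
  define E :: "complex^3 \<Rightarrow> complex^3^3" where
    "E x = (\<chi> i. vector [u 0 x $ i + \<i> * u 2 x $ i, u 1 x $ i, \<i> * u 2 x $ i - u 0 x $ i])" for x
  have hu: "holo_on (\<lambda>x. u i x $ a) U" if "i < 3" for i a
    using on that by (simp add: orthonormal_on_def holo_vec_def)
  have "holo_mat E U"
    unfolding holo_mat_def E_def forall_3 vec_lambda_beta vector_3
    by (intro conjI holo_intros hu) auto
  moreover have "transpose (E x) ** h x ** E x = null_gram" if x: "x \<in> U" for x
  proof -
    have o: "bil (h x) (u i x) (u j x) = (if i = j then 1 else 0)" if "i < 3" "j < 3" for i j
      using on x that by (simp add: orthonormal_on_def)
    have g: "(transpose (E x) ** h x ** E x) $ a $ b = bil (h x) (column a (E x)) (column b (E x))" for a b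
      unfolding bil_def matrix_mul_nth transpose_nth column_def vec_lambda_beta sum_3 by algebra
    have cols: "column 1 (E x) = u 0 x + \<i> *s u 2 x" "column 2 (E x) = u 1 x" "column 3 (E x) = \<i> *s u 2 x - u 0 x"
      by (simp_all add: E_def column_def vec_eq_iff)
    show ?thesis
      unfolding vec_eq_iff forall_3 g cols by (simp add: null_gram_def bil_add bil_diff bil_scale o)
  qed
  ultimately show ?thesis using that U by blast
qed


section \<open>From Einstein--Weyl structures to Lax pairs\<close>

lemma (in weyl_frame) holo_lax_poly:
  "holo_on (\<lambda>x. coeff (lax_poly0 (structure_coeff E x) (frame_comp E \<nu> x)) k) S"
  "holo_on (\<lambda>x. coeff (lax_poly1 (structure_coeff E x) (frame_comp E \<nu> x)) k) S"
proof -
  consider "k = 0" | "k = 1" | "k = 2" | "k = 3" | m where "k = Suc (Suc (Suc (Suc m)))"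
    by (metis One_nat_def Suc_1 nat.exhaust numeral_3_eq_3)
  then show "holo_on (\<lambda>x. coeff (lax_poly0 (structure_coeff E x) (frame_comp E \<nu> x)) k) S"
    "holo_on (\<lambda>x. coeff (lax_poly1 (structure_coeff E x) (frame_comp E \<nu> x)) k) S"
    by (cases; simp add: lax_poly0_def lax_poly1_def numeral_2_eq_2 numeral_3_eq_3 holo_on_const;
        intro holo_intros holo_spin)+
qed

lemma degree_lax_poly: "degree (lax_poly0 C n) \<le> 3" "degree (lax_poly1 C n) \<le> 3"
  by (rule degree_le, simp add: lax_poly0_def lax_poly1_def coeff_pCons split: nat.split)+

context cmanifold
begin

text \<open>
  A null frame is constructed in one chart \<open>c0\<close> around \<open>p\<close> and transported to the other charts by the
  Jacobians of the coordinate changes. The polynomials are the lifts for the given Weyl connection.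
  The frame is normalised so that its metric is \<open>h\<close> itself, whence the conformal factor \<open>1\<close>.
\<close>

lemma lax_data_of_einstein_weyl:
  assumes ew: "einstein_weyl A (topspace W) h \<nu>" and p: "p \<in> topspace W"
  obtains N V1 V2 V3 f0 f1 where "openin W N" "p \<in> N" "lax_data A N V1 V2 V3 f0 f1"
    "same_weyl A N h \<nu> (frame_metric V1 V2 V3) (lax_weyl_form V1 V2 V3 f0 f1)"
proof -
  let ?T = "topspace W"
  obtain c0 where c0: "c0 \<in> A" "p \<in> fst c0"
    using manifold p unfolding complex_manifold3_def by blast
  have fst_sub: "fst c \<subseteq> ?T" if "c \<in> A" for c using openin_subset[OF chart_open(1)[OF that]] .
  have hm: "holo_metric A ?T h" and ho: "holo_oneform A ?T \<nu>" using ew by (auto simp: einstein_weyl_def)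
  define S0 where "S0 = chart_image c0 ?T"
  have S0: "open S0" "snd c0 p \<in> S0"
    unfolding S0_def using open_chart_image[OF c0(1) openin_topspace] chart_imageI[OF c0(1,2) p] by auto
  have h0: "holo_mat (h c0) S0" "transpose (h c0 x) = h c0 x" "invertible (h c0 x)" if "x \<in> S0" for x
    using hm c0 that by (auto simp: holo_metric_def holo_mat_def S0_def)
  obtain U E0 where U: "open U" "snd c0 p \<in> U" "U \<subseteq> S0" and E0: "holo_mat E0 U"
    and gram0: "\<And>x. x \<in> U \<Longrightarrow> transpose (E0 x) ** h c0 x ** E0 x = null_gram"
    using local_null_frame[OF S0 h0(1)[OF S0(2)] h0(2) h0(3)[OF S0(2)]] by blast
  define N where "N = {q \<in> fst c0. snd c0 q \<in> U}"
  have N: "openin W N" "p \<in> N" "N \<subseteq> fst c0"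
  proof -
    have "continuous_map (subtopology W (fst c0)) (top_of_set (snd c0 ` fst c0)) (snd c0)"
      using homeomorphic_imp_continuous_map[OF chart_homeo[OF c0(1)]] .
    then have "continuous_map (subtopology W (fst c0)) euclidean (snd c0)"
      by (simp add: continuous_map_in_subtopology)
    from openin_continuous_map_preimage[OF this, of U] U(1)
    have "openin (subtopology W (fst c0)) N"
      unfolding topspace_chart[OF c0(1)] N_def by simp
    then show "openin W N" using openin_open_subtopology[OF chart_open(1)[OF c0(1)]] by blast
  qed (use c0 U in \<open>auto simp: N_def\<close>)
  let ?t = "\<lambda>c. transition c c0"
  have inN: "x \<in> chart_image c (fst c0 \<inter> N)" "x \<in> chart_image c (fst c0)" "x \<in> chart_image c ?T"
    "?t c x \<in> U" "?t c x \<in> chart_image c0 (fst c)" "?t c x \<in> chart_image c0 N"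
    if c: "c \<in> A" and x: "x \<in> chart_image c N" for c x
  proof -
    show 1: "x \<in> chart_image c (fst c0 \<inter> N)" "x \<in> chart_image c (fst c0)" "x \<in> chart_image c ?T"
      using x N(3) fst_sub[OF c] by (auto simp: chart_image_def)
    have "?t c x \<in> chart_image c0 (fst c \<inter> N)" by (rule transition_in[OF c c0(1) 1(1)])
    then show "?t c x \<in> U" "?t c x \<in> chart_image c0 (fst c)" "?t c x \<in> chart_image c0 N"
      by (auto simp: chart_image_def N_def)
  qed
  define F where "F c x = jac c0 c (?t c x) ** E0 (?t c x)" for c x
  define V where "V a c x = column a (F c x)" for a c x
  have FV: "frame_field (V 1) (V 2) (V 3) c x = F c x" for c x
    by (simp add: frame_field_def V_def column_def vec_eq_iff forall_3)
  have ocN: "open (chart_image c N)" if "c \<in> A" for c by (rule open_chart_image[OF that N(1)])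
  have roundtrip: "transition c0 c (?t c x) = x" if c: "c \<in> A" and x: "x \<in> chart_image c N" for c x
    using transition_transition[OF c c0(1) inN(2)[OF c x], of c] transition_self[OF c x] by simp
  have Fholo: "holo_mat (F c) (chart_image c N)" if c: "c \<in> A" for c
  proof -
    have t: "holo_on (\<lambda>x. ?t c x $ i) (chart_image c N)" for i
      by (rule holo_on_subset[OF transition_holo[OF c c0(1)]]) (use inN(2)[OF c] in auto)
    have "holo_mat (\<lambda>x. jac c0 c (?t c x)) (chart_image c N)"
      unfolding holo_mat_def
      by (intro allI holo_on_compose[OF _ t inN(5)[OF c]]) (use holo_jac[OF c0(1) c] in \<open>simp_all add: holo_mat_def\<close>)
    moreover have "holo_mat (\<lambda>x. E0 (?t c x)) (chart_image c N)"
      unfolding holo_mat_def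
      by (intro allI holo_on_compose[OF _ t inN(4)[OF c]]) (use E0 in \<open>simp_all add: holo_mat_def\<close>)
    ultimately show ?thesis unfolding F_def[abs_def] by (rule holo_mat_mult)
  qed
  have Ftrans: "F c' (transition c c' x) = jac c c' x ** F c x"
    if c: "c \<in> A" "c' \<in> A" and x: "x \<in> chart_image c (fst c' \<inter> N)" for c c' x
  proof -
    have x': "x \<in> chart_image c N" "x \<in> chart_image c (fst c')" using x by (auto simp: chart_image_def)
    have tt: "?t c' (transition c c' x) = ?t c x" by (rule transition_transition[OF c x'(2)])
    have "?t c x \<in> chart_image c0 (fst c \<inter> fst c')"
    proof -
      have "x \<in> chart_image c (fst c0 \<inter> fst c')" using inN(2)[OF c(1) x'(1)] x'(2)
        chart_imageE[OF c(1)] by (metis IntI chart_imageI c(1))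
      from transition_in[OF c(1) c0(1) this] show ?thesis .
    qed
    from jac_chain[OF c0(1) c this] have "jac c c' x ** jac c0 c (?t c x) = jac c0 c' (?t c x)"
      unfolding roundtrip[OF c(1) x'(1)] .
    then show ?thesis unfolding F_def tt by (simp add: matrix_mul_assoc)
  qed
  have gram: "transpose (F c x) ** h c x ** F c x = null_gram" if c: "c \<in> A" and x: "x \<in> chart_image c N" for c x
  proof -
    let ?y = "?t c x" and ?J = "jac c0 c (?t c x)"
    have "?y \<in> chart_image c0 (fst c \<inter> ?T)" using inN(5)[OF c x] fst_sub[OF c] by (auto simp: chart_image_def)
    then have "h c0 ?y = transpose ?J ** h c (transition c0 c ?y) ** ?J"
      using hm c0(1) c unfolding holo_metric_def jac_def by blast
    then have "transpose (E0 ?y) ** (transpose ?J ** h c x ** ?J) ** E0 ?y = null_gram"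
      using gram0[OF inN(4)[OF c x]] roundtrip[OF c x] by simp
    then show ?thesis unfolding F_def matrix_transpose_mul by (simp add: matrix_mul_assoc)
  qed
  have Finv: "invertible (F c x)" "gram_metric (F c) x = h c x" if "c \<in> A" "x \<in> chart_image c N" for c x
    using gram_metric_unique[of "F c", OF gram[OF that]] by auto
  have frame: "frame_on N (V 1) (V 2) (V 3)"
    unfolding frame_on_def
  proof (intro conjI N(1))
    have "holo_vecfield A N (V a)" for a
      unfolding holo_vecfield_def
    proof (intro conjI ballI allI)
      show "holo_on (\<lambda>x. V a c x $ i) (chart_image c N)" if "c \<in> A" for c i
        using Fholo[OF that] by (simp add: V_def column_def holo_mat_def)
      show "V a c' (transition c c' x) = jacobian (transition c c') (at x) *v V a c x"
        if "c \<in> A" "c' \<in> A" "x \<in> chart_image c (fst c' \<inter> N)" for c c' x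
        unfolding V_def Ftrans[OF that] jac_def
        by (simp add: vec_eq_iff column_def matrix_mul_nth matrix_vector_nth)
    qed
    then show "holo_vecfield A N (V 1)" "holo_vecfield A N (V 2)" "holo_vecfield A N (V 3)" by auto
    show "independent_on A N (V 1) (V 2) (V 3)"
      unfolding independent_on_def
    proof (intro ballI allI impI)
      fix c x \<alpha> \<beta> \<gamma> assume c: "c \<in> A" and x: "x \<in> chart_image c N"
        and z: "\<alpha> *s V 1 c x + \<beta> *s V 2 c x + \<gamma> *s V 3 c x = 0"
      have "F c x *v vector [\<alpha>, \<beta>, \<gamma>] = \<alpha> *s V 1 c x + \<beta> *s V 2 c x + \<gamma> *s V 3 c x"
        by (simp add: vec_eq_iff matrix_vector_nth sum_3 V_def column_def ac_simps)
      then have "F c x *v vector [\<alpha>, \<beta>, \<gamma>] = F c x *v 0" using z by simp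
      then have "(vector [\<alpha>, \<beta>, \<gamma>] :: complex^3) = 0"
        using inj_matrix_vector_mult[OF Finv(1)[OF c x]] by (meson injD)
      then show "\<alpha> = 0 \<and> \<beta> = 0 \<and> \<gamma> = 0" by (simp add: vec_eq_iff forall_3)
    qed
  qed
  have FV': "frame_field (V 1) (V 2) (V 3) c = F c" for c by (rule ext) (rule FV)
  have nuh: "holo_vec (\<nu> c) (chart_image c N)" if c: "c \<in> A" for c
    unfolding holo_vec_def
  proof
    fix a
    have "holo_on (\<lambda>x. \<nu> c x $ a) (chart_image c ?T)" using ho c by (simp add: holo_oneform_def)
    then show "holo_on (\<lambda>x. \<nu> c x $ a) (chart_image c N)"
      by (rule holo_on_subset) (use inN(3)[OF c] in auto)
  qed
  have wf: "weyl_frame (chart_image c N) (F c) (\<nu> c)" if c: "c \<in> A" for c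
    using weyl_frame_chart[OF frame c nuh[OF c]] unfolding FV' .
  have fm: "frame_metric (V 1) (V 2) (V 3) c x = h c x" if "c \<in> A" "x \<in> chart_image c N" for c x
    using frame_metric_eq_gram_metric[of "V 1" "V 2" "V 3" c x] Finv[OF that] unfolding FV' by simp
  have comp: "frame_comp (F c0) (\<nu> c0) (?t c x) = frame_comp (F c) (\<nu> c) x"
    "structure_coeff (F c0) (?t c x) = structure_coeff (F c) x" if c: "c \<in> A" and x: "x \<in> chart_image c N" for c x
  proof -
    note x' = inN(1)[OF c x]
    show "structure_coeff (F c0) (?t c x) = structure_coeff (F c) x"
      using structure_coeff_transition[OF frame c c0(1) x'] unfolding FV' .
    have "x \<in> chart_image c (fst c0 \<inter> ?T)" using x' by (auto simp: chart_image_def N_def dest: fst_sub[OF c, THEN subsetD])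
    then have "\<nu> c x = transpose (jac c c0 x) *v \<nu> c0 (?t c x)"
      using ho c c0(1) unfolding holo_oneform_def jac_def by blast
    then show "frame_comp (F c0) (\<nu> c0) (?t c x) = frame_comp (F c) (\<nu> c) x"
      unfolding frame_comp_def Ftrans[OF c c0(1) x'] matrix_transpose_mul
      by (simp only: matrix_vector_mul_assoc)
  qed
  \<comment> \<open>the expressions are independent of the chart, so evaluating them in \<open>c0\<close> defines functions on \<open>N\<close>\<close>
  define f0 where "f0 q = lax_poly0 (structure_coeff (F c0) (snd c0 q)) (frame_comp (F c0) (\<nu> c0) (snd c0 q))" for q
  define f1 where "f1 q = lax_poly1 (structure_coeff (F c0) (snd c0 q)) (frame_comp (F c0) (\<nu> c0) (snd c0 q))" for q
  have f: "f0 (chart_inv c x) = lax_poly0 (structure_coeff (F c) x) (frame_comp (F c) (\<nu> c) x)"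
    "f1 (chart_inv c x) = lax_poly1 (structure_coeff (F c) x) (frame_comp (F c) (\<nu> c) x)"
    if c: "c \<in> A" and x: "x \<in> chart_image c N" for c x
    using comp[OF that] by (simp_all add: f0_def f1_def transition_def)
  have ein: "weyl_frame.einstein_at (F c) (\<nu> c) x" if c: "c \<in> A" and x: "x \<in> chart_image c N" for c x
  proof -
    interpret weyl_frame "chart_image c N" "F c" "\<nu> c" by (rule wf[OF c])
    obtain \<Gamma> where \<Gamma>: "weyl_connection_on (chart_image c ?T) (h c) (\<nu> c) \<Gamma>"
      and ric: "\<And>x. x \<in> chart_image c ?T \<Longrightarrow> \<exists>\<Lambda>. \<forall>i j. (ricci \<Gamma> x i j + ricci \<Gamma> x j i) / 2 = \<Lambda> * h c x $ i $ j"
      using ew c unfolding einstein_weyl_def by blast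
    have "weyl_connection_on (chart_image c N) (h c) (\<nu> c) \<Gamma>"
      using \<Gamma> inN(3)[OF c] unfolding weyl_connection_on_def by blast
    then have "weyl_connection_on (chart_image c N) (gram_metric (F c)) (\<nu> c) \<Gamma>"
      using weyl_connection_on_cong[OF holo_gram_metric S Finv(2)[OF c]] by blast
    from einstein_at_iff[OF this x] ric[OF inN(3)[OF c x]] show ?thesis
      unfolding Finv(2)[OF c x] by simp
  qed
  have "lax_data A N (V 1) (V 2) (V 3) f0 f1"
    unfolding lax_data_def
  proof (intro conjI)
    have "holo_on (\<lambda>x. coeff (f0 (chart_inv c x)) k) (chart_image c N)"
      "holo_on (\<lambda>x. coeff (f1 (chart_inv c x)) k) (chart_image c N)" if c: "c \<in> A" for c k
      by (rule holo_on_cong[OF weyl_frame.holo_lax_poly(1)[OF wf[OF c]] ocN[OF c]]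
          holo_on_cong[OF weyl_frame.holo_lax_poly(2)[OF wf[OF c]] ocN[OF c]], simp add: f[OF c])+
    then show "cubic_on A N f0" "cubic_on A N f1"
      unfolding cubic_on_def holo_fun_def by (auto simp: f0_def f1_def degree_lax_poly)
    show "lax_integrable A N (V 1) (V 2) (V 3) f0 f1"
      unfolding lax_integrable_def
    proof (intro ballI allI conjI)
      fix c x s assume c: "c \<in> A" and x: "x \<in> chart_image c N"
      interpret w: weyl_frame "chart_image c N" "F c" "\<nu> c" by (rule wf[OF c])
      have V_eq: "V a c = w.V a" for a by (simp add: V_def fun_eq_iff)
      show "bracket_in_span (lax (V 1) (V 2) f0 c) (lax (V 2) (V 3) f1 c) (x, s)"
        using w.einstein_imp_lax[OF x ein[OF c x] f[OF c]]
        by (simp add: lax_def lax_field_def V_def)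
      show "bracket_in_span (lax_inf (V 1) (V 2) f0 c) (lax_inf (V 2) (V 3) f1 c) (x, s)"
        using w.einstein_imp_lax_inf[OF x ein[OF c x] f[OF c]]
        by (simp add: lax_inf_def V_def)
    qed
  qed (use frame in \<open>auto simp: frame_on_def\<close>)
  moreover have "same_weyl A N h \<nu> (frame_metric (V 1) (V 2) (V 3)) (lax_weyl_form (V 1) (V 2) (V 3) f0 f1)"
    unfolding same_weyl_def
  proof (intro exI[of _ "\<lambda>_. 1"] conjI ballI allI)
    show "holo_fun A N (\<lambda>_. 1)" by (simp add: holo_fun_def holo_on_const)
    fix c x i j assume c: "c \<in> A" and x: "x \<in> chart_image c N"
    show "frame_metric (V 1) (V 2) (V 3) c x $ i $ j = 1\<^sup>2 * h c x $ i $ j" by (simp add: fm[OF c x])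
    have "lax_weyl_form (V 1) (V 2) (V 3) f0 f1 c x = \<nu> c x"
      unfolding lax_weyl_form_def FV' f[OF c x] lax_nu_poly1
      unfolding frame_comp_def by (rule frame_comp_oneform(2)[of "F c", OF Finv(1)[OF c x]])
    then show "lax_weyl_form (V 1) (V 2) (V 3) f0 f1 c x $ i = \<nu> c x $ i + 2 * (pd i (\<lambda>y. 1) x / 1)"
      by simp
  qed auto
  ultimately show ?thesis using that N by blast
qed

end

theorem proposition4p1:
  fixes W :: "'a topology" and A :: "'a chart set"
  assumes "complex_manifold3 W A"
  shows "\<exists>nu_of :: 'a vecfield \<Rightarrow> 'a vecfield \<Rightarrow> 'a vecfield \<Rightarrow>
             ('a \<Rightarrow> complex poly) \<Rightarrow> ('a \<Rightarrow> complex poly) \<Rightarrow> 'a oneform.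
    (\<forall>N V1 V2 V3 f0 f1. openin W N \<longrightarrow> lax_data A N V1 V2 V3 f0 f1 \<longrightarrow>
        einstein_weyl A N (frame_metric V1 V2 V3) (nu_of V1 V2 V3 f0 f1)) \<and>
    (\<forall>h \<nu>. einstein_weyl A (topspace W) h \<nu> \<longrightarrow>
        (\<forall>p\<in>topspace W. \<exists>N V1 V2 V3 f0 f1. openin W N \<and> p \<in> N \<and>
           lax_data A N V1 V2 V3 f0 f1 \<and>
           same_weyl A N h \<nu> (frame_metric V1 V2 V3) (nu_of V1 V2 V3 f0 f1)))"
proof -
  interpret cmanifold W A by unfold_locales (rule assms)
  show ?thesis
    by (intro exI[of _ lax_weyl_form] conjI allI impI ballI)
      (blast intro: einstein_weyl_of_lax_data, metis lax_data_of_einstein_weyl)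
qed

end
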